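(* The $M$-module $\mathcal{M}_3^0=\bigoplus_k M_{3,k}(\Gamma[\sqrt{-3}])$ is freely generated by the Eisenstein series $E_0,E_1,E_2,E_3$ of weight $(3,3)$.
   Context: Let $F=\mathbb{Q}(\sqrt{-3})\subset\mathbb{C}$, $\rho=(-1+\sqrt{-3})/2$, $O_F=\mathbb{Z}[\rho]$. Let $h(z,w)=z_1\bar w_2+z_2\bar w_1+z_3\bar w_3$, $\Gamma=\{g\in \mathrm{GL}_3(O_F): h(gz,gw)=h(z,w)\}$, $\Gamma_1=\{g\in\Gamma:\det g=1\}$, $\Gamma[\sqrt{-3}]=\{g\in\Gamma: g\equiv 1 \bmod \sqrt{-3}\}$, $\Gamma_1[\sqrt{-3}]=\Gamma_1\cap\Gamma[\sqrt{-3}]$. Let $B=\{(u,v)\in\mathbb{C}^2: 2\,\mathrm{Re}\,v+|u|^2<0\}$, where $(u,v)$ corresponds to the line $(v:1:u)$. A matrix $g=(g_{ij})$ acts by $(u,v)\mapsto\left(\frac{g_{31}v+g_{32}+g_{33}u}{j_1},\frac{g_{11}v+g_{12}+g_{13}u}{j_1}\right)$ with $j_1=j_1(g,u,v)=g_{21}v+g_{22}+g_{23}u$. With $G_{ij}$ the minor of $g_{ij}$ put $j_2(g,u,v)=\det(g)^{-1}\begin{pmatrix}G_{32}u+G_{33}&G_{32}v+G_{31}\\ G_{12}u+G_{13}&G_{12}v+G_{11}\end{pmatrix}$. For a vector $x=(a,b)^t$ let $\mathrm{Sym}^j(x)=(a^j,a^{j-1}b,\dots,b^j)^t$, and let $\mathrm{Sym}^j(A)$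 be the matrix with $\mathrm{Sym}^j(A)\mathrm{Sym}^j(x)=\mathrm{Sym}^j(Ax)$. For $f:B\to \mathrm{Sym}^j(\mathbb{C}^2)$ put $(f|_{j,k}g)(b)=j_1(g,b)^{-k}\,\mathrm{Sym}^j(j_2(g,b)^{-1})f(g\cdot b)$. $M_{j,k}(\Gamma[\sqrt{-3}])$ is the space of holomorphic $f:B\to\mathrm{Sym}^j(\mathbb{C}^2)$ with $f|_{j,k}g=f$ for all $g\in\Gamma[\sqrt{-3}]$. Such $f$ has a Fourier-Jacobi expansion $f(u,v)=\sum_{n\ge0}f_n(u)w^n$, $w=e^{2\pi v/\sqrt3}$. The four cusps of $\Gamma_1[\sqrt{-3}]$ are represented by $c_1=(1:0:0)$, $c_2=(0:1:0)$ and $c_3,c_4$ (the points $(\rho:1:\pm1)$ in some fixed order). The permutation of the cusps gives an isomorphism $\Gamma_1/\Gamma_1[\sqrt{-3}]\cong S_4$, and $S_4$ acts on $M_{j,k}(\Gamma[\sqrt{-3}])$ by $\sigma(f)=f|_{j,k}g^{-1}$ for $g\in\Gamma_1$ inducing $\sigma$. $M=\bigoplus_k M_{0,k}(\Gamma[\sqrt{-3}])$. It is known that $M=\mathbb{C}[\varphi_0,\varphi_1,\varphi_2]$ is a polynomial ring with $\varphi_i\in M_{0,3}(\Gamma[\sqrt{-3}])$ having constant term $1$ in the Fourier-Jacobi expansion and such that $x_1=\varphi_0+\varphi_1+\varphi_2$, $x_2=-3\varphi_0+\varphi_1+\varphi_2$, $x_3=\varphi_0-3\varphi_1+\varphi_2$,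 $x_4=\varphi_0+\varphi_1-3\varphi_2$ satisfy $\sigma(x_i)=\mathrm{sgn}(\sigma)x_{\sigma(i)}$. For scalar-valued forms $f$ of weight $k$ and $g$ of weight $l$ put $[f,g]=\frac1l f\nabla g-\frac1k g\nabla f$, with $\nabla f=(\partial f/\partial u,\partial f/\partial v)^t$. Put $\Phi_0=-\frac{[\varphi_1,\varphi_2]}{6\pi\sqrt{-1}}$, $\Phi_1=-\frac{[\varphi_2,\varphi_0]}{6\pi\sqrt{-1}}$, $\Phi_2=-\frac{[\varphi_0,\varphi_1]}{6\pi\sqrt{-1}}$. Put $E_i=\frac{\mathrm{Sym}^3(\Phi_i)}{(\varphi_{i+1}\varphi_{i+2}(\varphi_{i+1}-\varphi_{i+2}))^2}$ for $i=0,1,2$ (indices mod 3) and $E_3=\frac{\mathrm{Sym}^3(\Phi_0+\Phi_1+\Phi_2)}{((\varphi_0-\varphi_1)(\varphi_0-\varphi_2)(\varphi_1-\varphi_2))^2}$; these are modular forms of weight $(3,3)$ on $\Gamma[\sqrt{-3}]$. *)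

theory Defs
  imports
    "HOL-Analysis.Analysis"
    "HOL-Algebra.Module"
    "HOL-Combinatorics.Permutations"
    "HOL-Library.Poly_Mapping"
    "HOL-Library.Function_Algebras"
begin

section \<open>The Picard modular group\<close>

definition rho :: complex where
  "rho = (-1 + \<i> * sqrt 3) / 2"

definition sqrt_m3 :: complex where
  "sqrt_m3 = \<i> * sqrt 3"

definition O_F :: "complex set" where
  "O_F = {of_int a + of_int b * rho |a b. True}"

definition herm :: "complex^3 \<Rightarrow> complex^3 \<Rightarrow> complex" where
  "herm z w = z$1 * cnj (w$2) + z$2 * cnj (w$1) + z$3 * cnj (w$3)"

definition GL3_OF :: "(complex^3^3) set" where
  "GL3_OF = {g. (\<forall>i j. g$i$j \<in> O_F) \<and>
     (\<exists>g'. (\<forall>i j. g'$i$j \<in> O_F) \<and> g ** g' = mat 1 \<and> g' ** g = mat 1)}"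

definition Gam :: "(complex^3^3) set" where
  "Gam = {g \<in> GL3_OF. \<forall>z w. herm (g *v z) (g *v w) = herm z w}"

definition Gam1 :: "(complex^3^3) set" where
  "Gam1 = {g \<in> Gam. det g = 1}"

definition congr_one :: "complex^3^3 \<Rightarrow> bool" where
  "congr_one g \<longleftrightarrow> (\<forall>i j. \<exists>x\<in>O_F. g$i$j - mat 1 $i$j = sqrt_m3 * x)"

definition Gam_sqrt :: "(complex^3^3) set" where
  "Gam_sqrt = {g \<in> Gam. congr_one g}"

definition Gam1_sqrt :: "(complex^3^3) set" where
  "Gam1_sqrt = Gam1 \<inter> Gam_sqrt"

section \<open>The ball and the factors of automorphy\<close>

definition ball2 :: "(complex \<times> complex) set" where
  "ball2 = {(u, v). 2 * Re v + (cmod u)\<^sup>2 < 0}"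

definition j1 :: "complex^3^3 \<Rightarrow> complex \<times> complex \<Rightarrow> complex" where
  "j1 g = (\<lambda>(u, v). g$2$1 * v + g$2$2 + g$2$3 * u)"

definition act :: "complex^3^3 \<Rightarrow> complex \<times> complex \<Rightarrow> complex \<times> complex" where
  "act g = (\<lambda>(u, v).
     ((g$3$1 * v + g$3$2 + g$3$3 * u) / j1 g (u, v),
      (g$1$1 * v + g$1$2 + g$1$3 * u) / j1 g (u, v)))"

text \<open>The minors below carry no sign; with this convention \<open>j1 g \<cdot> j2 g\<close> is the inverse
  transpose of the Jacobian matrix of \<open>act g\<close>. The two remaining row (column) indices are
  listed in increasing order.\<close>

definition other_indices :: "3 \<Rightarrow> 3 \<times> 3" where
  "other_indices i = (if i = 1 then (2, 3) else if i = 2 then (1, 3) else (1, 2))"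

definition minor3 :: "complex^3^3 \<Rightarrow> 3 \<Rightarrow> 3 \<Rightarrow> complex" where
  "minor3 g i j = (case (other_indices i, other_indices j) of
     ((p, q), (r, s)) \<Rightarrow> g$p$r * g$q$s - g$p$s * g$q$r)"

definition j2 :: "complex^3^3 \<Rightarrow> complex \<times> complex \<Rightarrow> complex^2^2" where
  "j2 g = (\<lambda>(u, v). vector
     [(1 / det g) *s vector [minor3 g 3 2 * u + minor3 g 3 3, minor3 g 3 2 * v + minor3 g 3 1],
      (1 / det g) *s vector [minor3 g 1 2 * u + minor3 g 1 3, minor3 g 1 2 * v + minor3 g 1 1]])"

section \<open>Symmetric powers\<close>

text \<open>Elements of \<open>Sym\<^sup>j(\<complex>\<^sup>2) = \<complex>\<^sup>j\<^sup>+\<^sup>1\<close> are functions on the naturals vanishing at all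
  indices beyond \<open>j\<close>; matrices are treated in the same way.\<close>

definition symv :: "nat \<Rightarrow> complex^2 \<Rightarrow> nat \<Rightarrow> complex" where
  "symv j x = (\<lambda>i. if i \<le> j then (x$1) ^ (j - i) * (x$2) ^ i else 0)"

definition is_symm :: "nat \<Rightarrow> complex^2^2 \<Rightarrow> (nat \<Rightarrow> nat \<Rightarrow> complex) \<Rightarrow> bool" where
  "is_symm j A S \<longleftrightarrow>
     (\<forall>i m. j < i \<or> j < m \<longrightarrow> S i m = 0) \<and>
     (\<forall>x i. (\<Sum>m\<le>j. S i m * symv j x m) = symv j (A *v x) i)"

definition symm :: "nat \<Rightarrow> complex^2^2 \<Rightarrow> nat \<Rightarrow> nat \<Rightarrow> complex" where
  "symm j A = (THE S. is_symm j A S)"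

lemma binary_form_times_linear:
  fixes c :: "nat \<Rightarrow> complex"
  shows "\<exists>c'. \<forall>a b. (\<alpha> * a + \<beta> * b) * (\<Sum>m\<le>n. c m * (a ^ (n - m) * b ^ m)) =
           (\<Sum>m\<le>Suc n. c' m * (a ^ (Suc n - m) * b ^ m))"
proof -
  let ?c = "\<lambda>m. (if m \<le> n then \<alpha> * c m else 0) + (if m = 0 then 0 else \<beta> * c (m - 1))"
  have "(\<alpha> * a + \<beta> * b) * (\<Sum>m\<le>n. c m * (a ^ (n - m) * b ^ m)) =
      (\<Sum>m\<le>Suc n. ?c m * (a ^ (Suc n - m) * b ^ m))" for a b
  proof -
    have 1: "(\<Sum>m\<le>Suc n. (if m \<le> n then \<alpha> * c m else 0) * (a ^ (Suc n - m) * b ^ m)) =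
        \<alpha> * a * (\<Sum>m\<le>n. c m * (a ^ (n - m) * b ^ m))"
      by (auto simp: sum_distrib_left Suc_diff_le mult_ac intro!: sum.cong)
    have 2: "(\<Sum>m\<le>Suc n. (if m = 0 then 0 else \<beta> * c (m - 1)) * (a ^ (Suc n - m) * b ^ m)) =
        \<beta> * b * (\<Sum>m\<le>n. c m * (a ^ (n - m) * b ^ m))"
      by (subst sum.atMost_Suc_shift) (simp add: sum_distrib_left mult_ac)
    show ?thesis
      unfolding distrib_right sum.distrib 1 2 ..
  qed
  then show ?thesis by (intro exI[of _ ?c]) blast
qed

lemma binary_form_of_linear_powers:
  fixes \<alpha> \<beta> \<gamma> \<delta> :: complex
  shows "\<exists>c. \<forall>a b. (\<alpha> * a + \<beta> * b) ^ p * (\<gamma> * a + \<delta> * b) ^ q =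
           (\<Sum>m\<le>p + q. c m * (a ^ (p + q - m) * b ^ m))"
proof (induction p)
  case 0
  show ?case
  proof (induction q)
    case 0
    show ?case by (rule exI[of _ "\<lambda>_. 1"]) simp
  next
    case (Suc q)
    then obtain c where c: "\<And>a b. (\<alpha> * a + \<beta> * b) ^ 0 * (\<gamma> * a + \<delta> * b) ^ q =
        (\<Sum>m\<le>0 + q. c m * (a ^ (0 + q - m) * b ^ m))" by blast
    from binary_form_times_linear[of \<gamma> \<delta> c q] show ?case
      using c by simp
  qed
next
  case (Suc p)
  then obtain c where c: "\<And>a b. (\<alpha> * a + \<beta> * b) ^ p * (\<gamma> * a + \<delta> * b) ^ q =
      (\<Sum>m\<le>p + q. c m * (a ^ (p + q - m) * b ^ m))" by blast
  from binary_form_times_linear[of \<alpha> \<beta> c "p + q"] show ?case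
    using c by (simp add: mult.assoc)
qed

lemma ex1_symm: "\<exists>!S. is_symm j A S"
proof (rule ex_ex1I)
  have "\<exists>c. \<forall>x. (\<Sum>m\<le>j. c m * symv j x m) = symv j (A *v x) i" if "i \<le> j" for i
  proof -
    obtain c where "\<And>a b. (A$1$1 * a + A$1$2 * b) ^ (j - i) * (A$2$1 * a + A$2$2 * b) ^ i =
        (\<Sum>m\<le>j - i + i. c m * (a ^ (j - i + i - m) * b ^ m))"
      using binary_form_of_linear_powers by blast
    then show ?thesis using that
      by (intro exI[of _ c])
        (auto simp: symv_def matrix_vector_mult_def sum_2 intro!: sum.cong)
  qed
  then obtain C where C: "\<And>i x. i \<le> j \<Longrightarrow> (\<Sum>m\<le>j. C i m * symv j x m) = symv j (A *v x) i"
    by metis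
  define S where "S = (\<lambda>i m. if i \<le> j \<and> m \<le> j then C i m else 0)"
  have "(\<Sum>m\<le>j. S i m * symv j x m) = symv j (A *v x) i" for i x
  proof (cases "i \<le> j")
    case True
    then show ?thesis by (simp add: S_def flip: C[OF True, of x] cong: sum.cong_simp)
  next
    case False
    then show ?thesis by (simp add: S_def symv_def)
  qed
  then have "is_symm j A S" by (auto simp: is_symm_def S_def)
  then show "\<exists>S. is_symm j A S" by blast
next
  fix S T assume ST: "is_symm j A S" "is_symm j A T"
  have "S i m = T i m" for i m
  proof (cases "m \<le> j")
    case True
    have "(\<Sum>m\<le>j. (S i m - T i m) * z ^ m) = 0" for z
    proof -
      define x :: "complex^2" where "x = vector [1, z]"
      have x: "symv j x m = z ^ m" if "m \<le> j" for m
        using that by (simp add: symv_def x_def)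
      have "(\<Sum>m\<le>j. S i m * symv j x m) = (\<Sum>m\<le>j. T i m * symv j x m)"
        using ST by (simp add: is_symm_def)
      then show ?thesis using x by (simp add: left_diff_distrib sum_subtractf cong: sum.cong_simp)
    qed
    then show ?thesis using True
      using polyfun_eq_0[of "\<lambda>m. S i m - T i m" j] by auto
  next
    case False
    then show ?thesis using ST by (simp add: is_symm_def)
  qed
  then show "S = T" by blast
qed

lemma is_symm_symm: "is_symm j A (symm j A)"
  unfolding symm_def by (rule theI'[OF ex1_symm])

section \<open>Modular forms\<close>

definition holomorphic2_on ::
    "(complex \<times> complex \<Rightarrow> complex) \<Rightarrow> (complex \<times> complex) set \<Rightarrow> bool" where
  "holomorphic2_on f S \<longleftrightarrow>
     (\<forall>b\<in>S. \<exists>p q. (f has_derivative (\<lambda>(s, t). p * s + q * t)) (at b))"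

text \<open>Functions on the ball are extended by \<open>0\<close>, so that equality of functions is equality
  on the ball.\<close>

definition holo_maps :: "nat \<Rightarrow> (complex \<times> complex \<Rightarrow> nat \<Rightarrow> complex) set" where
  "holo_maps j = {f. (\<forall>i\<le>j. holomorphic2_on (\<lambda>b. f b i) ball2) \<and>
     (\<forall>b i. b \<notin> ball2 \<or> j < i \<longrightarrow> f b i = 0)}"

definition slash :: "nat \<Rightarrow> int \<Rightarrow> complex^3^3 \<Rightarrow> (complex \<times> complex \<Rightarrow> nat \<Rightarrow> complex)
    \<Rightarrow> complex \<times> complex \<Rightarrow> nat \<Rightarrow> complex" where
  "slash j k g f = (\<lambda>b i. if b \<in> ball2
     then j1 g b powi (- k) * (\<Sum>m\<le>j. symm j (matrix_inv (j2 g b)) i m * f (act g b) m)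
     else 0)"

definition modular_forms :: "nat \<Rightarrow> int \<Rightarrow> (complex \<times> complex \<Rightarrow> nat \<Rightarrow> complex) set" where
  "modular_forms j k = {f \<in> holo_maps j. \<forall>g\<in>Gam_sqrt. slash j k g f = f}"

text \<open>The identification of \<open>\<complex>\<close> with \<open>Sym\<^sup>0(\<complex>\<^sup>2)\<close>:\<close>

definition scal :: "(complex \<times> complex \<Rightarrow> complex) \<Rightarrow> complex \<times> complex \<Rightarrow> nat \<Rightarrow> complex" where
  "scal f = (\<lambda>b i. if i = 0 then f b else 0)"

definition scalar_forms :: "int \<Rightarrow> (complex \<times> complex \<Rightarrow> complex) set" where
  "scalar_forms k = {f. scal f \<in> modular_forms 0 k}"

definition FJ_expansion :: "(complex \<times> complex \<Rightarrow> complex) \<Rightarrow> (nat \<Rightarrow> complex \<Rightarrow> complex) \<Rightarrow> bool"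
  where
  "FJ_expansion f c \<longleftrightarrow>
     (\<forall>(u, v)\<in>ball2. (\<lambda>n. c n u * exp (2 * pi * v / sqrt 3) ^ n) sums f (u, v))"

definition FJ_constant_term_one :: "(complex \<times> complex \<Rightarrow> complex) \<Rightarrow> bool" where
  "FJ_constant_term_one f \<longleftrightarrow> (\<exists>c. FJ_expansion f c \<and> (\<forall>u. c 0 u = 1))"

section \<open>The cusps and the action of the symmetric group\<close>

text \<open>The parameter \<open>eps\<close>, which is \<open>1\<close> or \<open>-1\<close>, fixes the order of the last two cusps.\<close>

definition cusp :: "complex \<Rightarrow> nat \<Rightarrow> complex^3" where
  "cusp eps i = (if i = 1 then vector [1, 0, 0] else if i = 2 then vector [0, 1, 0]
     else if i = 3 then vector [rho, 1, eps] else vector [rho, 1, - eps])"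

definition same_cusp :: "complex^3 \<Rightarrow> complex^3 \<Rightarrow> bool" where
  "same_cusp z w \<longleftrightarrow> (\<exists>\<gamma>\<in>Gam1_sqrt. \<exists>c. c \<noteq> 0 \<and> \<gamma> *v z = c *s w)"

definition induces :: "complex \<Rightarrow> complex^3^3 \<Rightarrow> (nat \<Rightarrow> nat) \<Rightarrow> bool" where
  "induces eps g \<sigma> \<longleftrightarrow> (\<forall>i\<in>{1..4}. same_cusp (g *v cusp eps i) (cusp eps (\<sigma> i)))"

definition x_form :: "(nat \<Rightarrow> complex \<times> complex \<Rightarrow> complex) \<Rightarrow> nat \<Rightarrow> complex \<times> complex \<Rightarrow> complex"
  where
  "x_form \<phi> i = (\<lambda>b.
     if i = 1 then \<phi> 0 b + \<phi> 1 b + \<phi> 2 b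
     else if i = 2 then - 3 * \<phi> 0 b + \<phi> 1 b + \<phi> 2 b
     else if i = 3 then \<phi> 0 b - 3 * \<phi> 1 b + \<phi> 2 b
     else \<phi> 0 b + \<phi> 1 b - 3 * \<phi> 2 b)"

section \<open>The graded ring and the graded module\<close>

text \<open>An element of a direct sum over all weights is a finitely supported family of forms.\<close>

definition form_ring :: "(int \<Rightarrow>\<^sub>0 (complex \<times> complex \<Rightarrow> complex)) ring" where
  "form_ring = \<lparr>carrier = {a. \<forall>k. Poly_Mapping.lookup a k \<in> scalar_forms k},
     mult = (*), one = Poly_Mapping.single 0 (indicator ball2), zero = 0, add = (+)\<rparr>"

definition lift_scalars :: "(int \<Rightarrow>\<^sub>0 (complex \<times> complex \<Rightarrow> complex))
    \<Rightarrow> (int \<Rightarrow>\<^sub>0 (complex \<times> complex \<Rightarrow> nat \<Rightarrow> complex))" where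
  "lift_scalars a = Poly_Mapping.map (\<lambda>f b _. f b) a"

text \<open>Scalars act componentwise on vectors; the product in the definition of \<open>form_smult\<close>
  convolves the weights and multiplies the coordinates of the values.\<close>

definition form_smult :: "(int \<Rightarrow>\<^sub>0 (complex \<times> complex \<Rightarrow> complex))
    \<Rightarrow> (int \<Rightarrow>\<^sub>0 (complex \<times> complex \<Rightarrow> nat \<Rightarrow> complex))
    \<Rightarrow> (int \<Rightarrow>\<^sub>0 (complex \<times> complex \<Rightarrow> nat \<Rightarrow> complex))" where
  "form_smult a F = lift_scalars a * F"

text \<open>The multiplication and unit of the ring part of the module record play no role.\<close>

definition form_module :: "nat \<Rightarrow> (int \<Rightarrow>\<^sub>0 (complex \<times> complex \<Rightarrow> complex),
    int \<Rightarrow>\<^sub>0 (complex \<times> complex \<Rightarrow> nat \<Rightarrow> complex)) module" where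
  "form_module j = \<lparr>carrier = {F. \<forall>k. Poly_Mapping.lookup F k \<in> modular_forms j k},
     mult = (*), one = 1, zero = 0, add = (+), smult = form_smult\<rparr>"

definition freely_generated_by ::
    "('a, 'm) ring_scheme \<Rightarrow> ('a, 'b, 'n) module_scheme \<Rightarrow> nat \<Rightarrow> (nat \<Rightarrow> 'b) \<Rightarrow> bool" where
  "freely_generated_by R M n e \<longleftrightarrow>
     Module.module R M \<and> (\<forall>i<n. e i \<in> carrier M) \<and>
     bij_betw (\<lambda>a. \<Oplus>\<^bsub>M\<^esub>i\<in>{..<n}. a i \<odot>\<^bsub>M\<^esub> e i) ({..<n} \<rightarrow>\<^sub>E carrier R) (carrier M)"

lemma sum_fun_apply: "(\<Sum>x\<in>A. f x) b = (\<Sum>x\<in>A. f x b)"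
  for f :: "'a \<Rightarrow> 'b \<Rightarrow> 'c::comm_monoid_add"
  by (induction A rule: infinite_finite_induct) simp_all

lemma lookup_times_eq_sum:
  fixes p q :: "int \<Rightarrow>\<^sub>0 'a::comm_ring_1"
  shows "Poly_Mapping.lookup (p * q) n =
    (\<Sum>k\<in>Poly_Mapping.keys p. Poly_Mapping.lookup p k * Poly_Mapping.lookup q (n - k))"
proof -
  have "Poly_Mapping.lookup (p * q) n =
      (\<Sum>l. Poly_Mapping.lookup p l * (\<Sum>m. Poly_Mapping.lookup q m when n = l + m))"
    by (simp add: times_poly_mapping.rep_eq prod_fun_def)
  also have "\<dots> = (\<Sum>l. Poly_Mapping.lookup p l * Poly_Mapping.lookup q (n - l))"
  proof (rule Sum_any.cong)
    fix l
    have "(\<Sum>m. Poly_Mapping.lookup q m when n = l + m) =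
        (\<Sum>m. Poly_Mapping.lookup q m when n - l = m)"
      by (rule Sum_any.cong) (auto simp: when_def)
    then show "Poly_Mapping.lookup p l * (\<Sum>m. Poly_Mapping.lookup q m when n = l + m) =
        Poly_Mapping.lookup p l * Poly_Mapping.lookup q (n - l)"
      by simp
  qed
  also have "\<dots> = (\<Sum>k\<in>Poly_Mapping.keys p. Poly_Mapping.lookup p k * Poly_Mapping.lookup q (n - k))"
    by (rule Sum_any.expand_superset) (auto simp: in_keys_iff)
  finally show ?thesis .
qed

lemma lookup_lift_scalars:
  "Poly_Mapping.lookup (lift_scalars a) k = (\<lambda>b _. Poly_Mapping.lookup a k b)"
  by (auto simp: lift_scalars_def Poly_Mapping.map.rep_eq when_def fun_eq_iff)

lemma lift_scalars_add: "lift_scalars (a + b) = lift_scalars a + lift_scalars b"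
  by (intro poly_mapping_eqI) (simp add: lookup_add lookup_lift_scalars fun_eq_iff)

lemma keys_lift_scalars: "Poly_Mapping.keys (lift_scalars a) = Poly_Mapping.keys a"
  by (auto simp: in_keys_iff lookup_lift_scalars fun_eq_iff)

lemma lift_scalars_mult: "lift_scalars (a * b) = lift_scalars a * lift_scalars b"
  by (intro poly_mapping_eqI)
    (simp add: lookup_times_eq_sum lookup_lift_scalars keys_lift_scalars fun_eq_iff sum_fun_apply)

lemma lookup_form_smult:
  "Poly_Mapping.lookup (form_smult a F) n b i =
    (\<Sum>k\<in>Poly_Mapping.keys a. Poly_Mapping.lookup a k b * Poly_Mapping.lookup F (n - k) b i)"
  by (simp add: form_smult_def lookup_times_eq_sum sum_fun_apply lookup_lift_scalars
      keys_lift_scalars)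

lemma symm_0: "symm 0 A i 0 = (if i = 0 then 1 else 0)"
  proof -
  have "(\<Sum>m\<le>0. symm 0 A i m * symv 0 0 m) = symv 0 (A *v 0) i"
    using is_symm_symm[of 0 A] unfolding is_symm_def by blast
  then show ?thesis by (simp add: symv_def)
qed

lemma j1_neq_0:
  assumes "g \<in> Gam" "b \<in> ball2"
  shows "j1 g b \<noteq> 0"
proof
  assume j0: "j1 g b = 0"
  obtain u v where b: "b = (u, v)" by (cases b)
  define z :: "complex^3" where "z = vector [v, 1, u]"
  have "(g *v z)$2 = j1 g b"
    by (simp add: b j1_def z_def matrix_vector_mult_def sum_3)
  then have "herm (g *v z) (g *v z) = of_real ((cmod ((g *v z)$3))\<^sup>2)"
    using j0 by (simp add: herm_def complex_norm_square del: of_real_power)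
  moreover have "herm (g *v z) (g *v z) = herm z z"
    using assms(1) by (simp add: Gam_def)
  moreover have "Re (herm z z) = 2 * Re v + (cmod u)\<^sup>2"
    by (simp add: herm_def z_def cmod_power2 flip: power2_eq_square)
  ultimately have "2 * Re v + (cmod u)\<^sup>2 \<ge> 0"
    by (metis Re_complex_of_real zero_le_power2)
  then show False
    using assms(2) by (simp add: b ball2_def)
qed

lemma holomorphic2_on_const: "holomorphic2_on (\<lambda>_. c) S"
  unfolding holomorphic2_on_def
proof
  fix b
  have "((\<lambda>_. c) has_derivative (\<lambda>(s, t). 0 * s + 0 * t)) (at b)"
    by (rule has_derivative_eq_rhs[OF has_derivative_const]) auto
  then show "\<exists>p q. ((\<lambda>_. c) has_derivative (\<lambda>(s, t). p * s + q * t)) (at b)" by blast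
qed

lemma holomorphic2_on_add:
  assumes "holomorphic2_on f S" "holomorphic2_on h S"
  shows "holomorphic2_on (\<lambda>b. f b + h b) S"
  unfolding holomorphic2_on_def
proof
  fix b assume "b \<in> S"
  with assms obtain p q p' q' where
    "(f has_derivative (\<lambda>(s, t). p * s + q * t)) (at b)"
    "(h has_derivative (\<lambda>(s, t). p' * s + q' * t)) (at b)"
    unfolding holomorphic2_on_def by blast
  from has_derivative_add[OF this]
  have "((\<lambda>b. f b + h b) has_derivative (\<lambda>(s, t). (p + p') * s + (q + q') * t)) (at b)"
    by (rule has_derivative_eq_rhs) (auto simp: algebra_simps)
  then show "\<exists>p q. ((\<lambda>b. f b + h b) has_derivative (\<lambda>(s, t). p * s + q * t)) (at b)"
    by blast
qed

lemma holomorphic2_on_mult: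
  assumes "holomorphic2_on f S" "holomorphic2_on h S"
  shows "holomorphic2_on (\<lambda>b. f b * h b) S"
  unfolding holomorphic2_on_def
proof
  fix b assume "b \<in> S"
  with assms obtain p q p' q' where
    "(f has_derivative (\<lambda>(s, t). p * s + q * t)) (at b)"
    "(h has_derivative (\<lambda>(s, t). p' * s + q' * t)) (at b)"
    unfolding holomorphic2_on_def by blast
  from has_derivative_mult[OF this]
  have "((\<lambda>b. f b * h b) has_derivative
      (\<lambda>(s, t). (f b * p' + h b * p) * s + (f b * q' + h b * q) * t)) (at b)"
    by (rule has_derivative_eq_rhs) (auto simp: algebra_simps)
  then show "\<exists>p q. ((\<lambda>b. f b * h b) has_derivative (\<lambda>(s, t). p * s + q * t)) (at b)"
    by blast
qed

lemma slash_add: "slash j k g (f + h) = slash j k g f + slash j k g h"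
  by (auto simp: slash_def fun_eq_iff distrib_left sum.distrib)

lemma modular_forms_zero: "0 \<in> modular_forms j k"
  by (auto simp: modular_forms_def holo_maps_def slash_def fun_eq_iff holomorphic2_on_const)

lemma modular_forms_add:
  assumes "f \<in> modular_forms j k" "h \<in> modular_forms j k"
  shows "f + h \<in> modular_forms j k"
  using assms
  by (auto simp: modular_forms_def holo_maps_def slash_add intro!: holomorphic2_on_add)

lemma slash_mult:
  assumes "g \<in> Gam"
  shows "slash j (k + l) g (\<lambda>b i. f b * F b i) =
    (\<lambda>b i. slash 0 k g (scal f) b 0 * slash j l g F b i)"
  using j1_neq_0[OF assms]
  by (auto simp: slash_def fun_eq_iff scal_def symm_0 power_int_diff power_int_minus
      sum_distrib_left field_simps)

lemma modular_forms_mult: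
  assumes "f \<in> scalar_forms k" "F \<in> modular_forms j l"
  shows "(\<lambda>b i. f b * F b i) \<in> modular_forms j (k + l)"
proof -
  have f: "holomorphic2_on f ball2" "\<And>g. g \<in> Gam_sqrt \<Longrightarrow> slash 0 k g (scal f) = scal f"
    using assms(1) by (auto simp: scalar_forms_def modular_forms_def holo_maps_def scal_def)
  have "slash j (k + l) g (\<lambda>b i. f b * F b i) = (\<lambda>b i. f b * F b i)" if "g \<in> Gam_sqrt" for g
  proof -
    have "g \<in> Gam" using that by (simp add: Gam_sqrt_def)
    moreover have "slash j l g F = F"
      using assms(2) that by (simp add: modular_forms_def)
    ultimately show ?thesis
      using f(2)[OF that] by (simp add: slash_mult scal_def)
  qed
  then show ?thesis
    using assms(2) f(1) by (auto simp: modular_forms_def holo_maps_def intro!: holomorphic2_on_mult)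
qed

lemma const_scalar_form: "(\<lambda>b. c * indicator ball2 b) \<in> scalar_forms 0"
proof -
  have "open ball2"
    unfolding ball2_def case_prod_unfold
    by (intro open_Collect_less continuous_intros)
  have "holomorphic2_on (\<lambda>b. c * indicator ball2 b) ball2"
    unfolding holomorphic2_on_def
  proof
    fix b assume b: "b \<in> ball2"
    with holomorphic2_on_const[of c ball2] obtain p q where
      "((\<lambda>_. c) has_derivative (\<lambda>(s, t). p * s + q * t)) (at b)"
      unfolding holomorphic2_on_def by blast
    then have "((\<lambda>b. c * indicator ball2 b) has_derivative (\<lambda>(s, t). p * s + q * t)) (at b)"
      using \<open>open ball2\<close> b by (rule has_derivative_transform_within_open) simp
    then show "\<exists>p q. ((\<lambda>b. c * indicator ball2 b) has_derivative
        (\<lambda>(s, t). p * s + q * t)) (at b)" by blast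
  qed
  moreover have "act g b \<in> ball2" if "g \<in> Gam" "b \<in> ball2" for g b
  proof -
    obtain u v where b: "b = (u, v)" by (cases b)
    define z :: "complex^3" where "z = vector [v, 1, u]"
    define y where "y = g *v z"
    have y2: "y$2 = j1 g b" and y: "act g b = (y$3 / y$2, y$1 / y$2)"
      by (simp_all add: b j1_def act_def y_def z_def matrix_vector_mult_def sum_3)
    have nz: "y$2 \<noteq> 0" using j1_neq_0[OF that] y2 by simp
    have "herm y y = herm z z"
      using that(1) by (simp add: Gam_def y_def)
    then have "Re (herm y y) < 0"
      using that(2) by (simp add: herm_def z_def b ball2_def cmod_power2 flip: power2_eq_square)
    moreover have "Re (herm y y) = (cmod (y$2))\<^sup>2 * (2 * Re (y$1 / y$2) + (cmod (y$3 / y$2))\<^sup>2)"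
    proof -
      have "Re (y$1 / y$2) = Re (y$1 * cnj (y$2)) / (cmod (y$2))\<^sup>2"
        by (simp add: complex_div_cnj[of "y$1"])
      moreover have "(cmod (y$3 / y$2))\<^sup>2 = (cmod (y$3))\<^sup>2 / (cmod (y$2))\<^sup>2"
        by (simp add: norm_divide power_divide)
      moreover have "Re (herm y y) = 2 * Re (y$1 * cnj (y$2)) + (cmod (y$3))\<^sup>2"
        by (simp add: herm_def cmod_power2 flip: power2_eq_square)
      ultimately show ?thesis using nz by (simp add: field_simps)
    qed
    ultimately show ?thesis
      using nz by (simp add: y ball2_def mult_less_0_iff)
  qed
  ultimately show ?thesis
    by (auto simp: scalar_forms_def modular_forms_def holo_maps_def scal_def slash_def
        fun_eq_iff symm_0 Gam_sqrt_def indicator_def)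
qed

lemma modular_forms_minus:
  assumes "f \<in> modular_forms j k"
  shows "- f \<in> modular_forms j k"
proof -
  have "f b i = 0" if "b \<notin> ball2" for b i
    using assms that unfolding modular_forms_def holo_maps_def by blast
  then have "- f = (\<lambda>b i. (-1 * indicator ball2 b) * f b i)"
    by (auto simp: fun_eq_iff indicator_def)
  then show ?thesis
    using modular_forms_mult[OF const_scalar_form[of "-1"] assms] by simp
qed

lemma modular_forms_sum:
  "(\<And>x. x \<in> A \<Longrightarrow> f x \<in> modular_forms j k) \<Longrightarrow> (\<Sum>x\<in>A. f x) \<in> modular_forms j k"
  by (induction A rule: infinite_finite_induct) (auto intro: modular_forms_zero modular_forms_add)

lemma scal_simps:
  "scal 0 = 0" "scal (f + h) = scal f + scal h" "scal (- f) = - scal f"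
  "scal (\<Sum>x\<in>A. F x) = (\<Sum>x\<in>A. scal (F x))" "scal (f * h) = (\<lambda>b i. f b * scal h b i)"
  by (auto simp: scal_def fun_eq_iff sum_fun_apply)

lemma cring_form_ring: "cring form_ring"
proof (rule cringI)
  show "abelian_group form_ring"
  proof (rule abelian_groupI)
    fix x assume "x \<in> carrier form_ring"
    then show "\<exists>y\<in>carrier form_ring. y \<oplus>\<^bsub>form_ring\<^esub> x = \<zero>\<^bsub>form_ring\<^esub>"
      by (intro bexI[of _ "- x"])
        (auto simp: form_ring_def scalar_forms_def scal_simps intro!: modular_forms_minus)
  qed (auto simp: form_ring_def scalar_forms_def scal_simps lookup_add add.assoc add.commute
      intro!: modular_forms_zero modular_forms_add)
  show "comm_monoid form_ring"
  proof (rule comm_monoidI)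
    fix x y assume xy: "x \<in> carrier form_ring" "y \<in> carrier form_ring"
    have "Poly_Mapping.lookup x k * Poly_Mapping.lookup y (n - k) \<in> scalar_forms n" for k n
      using xy modular_forms_mult[of "Poly_Mapping.lookup x k" k
          "scal (Poly_Mapping.lookup y (n - k))" 0 "n - k"]
      by (simp add: form_ring_def scalar_forms_def scal_simps)
    then show "x \<otimes>\<^bsub>form_ring\<^esub> y \<in> carrier form_ring"
      by (auto simp: form_ring_def scalar_forms_def lookup_times_eq_sum scal_simps(4)
          intro!: modular_forms_sum)
  next
    show "\<one>\<^bsub>form_ring\<^esub> \<in> carrier form_ring"
      using const_scalar_form[of 1] modular_forms_zero
      by (auto simp: form_ring_def lookup_single when_def scalar_forms_def scal_simps)
  next
    fix x assume x: "x \<in> carrier form_ring"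
    have "indicator ball2 b * Poly_Mapping.lookup x n b = Poly_Mapping.lookup x n b" for b n
    proof (cases "b \<in> ball2")
      case False
      have "scal (Poly_Mapping.lookup x n) \<in> modular_forms 0 n"
        using x by (simp add: form_ring_def scalar_forms_def)
      then have "scal (Poly_Mapping.lookup x n) b 0 = 0"
        using False unfolding modular_forms_def holo_maps_def by blast
      then show ?thesis by (simp add: scal_def)
    qed simp
    then show "\<one>\<^bsub>form_ring\<^esub> \<otimes>\<^bsub>form_ring\<^esub> x = x"
      by (intro poly_mapping_eqI)
        (simp add: form_ring_def lookup_times_eq_sum fun_eq_iff sum_fun_apply in_keys_iff,
          metis zero_neq_one)
  qed (auto simp: form_ring_def mult_ac)
qed (auto simp: form_ring_def distrib_right)

lemma modular_forms_outside:
  assumes "F \<in> modular_forms j k" "b \<notin> ball2"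
  shows "F b i = 0"
  using assms unfolding modular_forms_def holo_maps_def by blast

lemma module_form_module: "Module.module form_ring (form_module j)"
proof (rule Module.moduleI)
  show "cring form_ring" by (rule cring_form_ring)
  show "abelian_group (form_module j)"
  proof (rule abelian_groupI)
    fix x assume "x \<in> carrier (form_module j)"
    then show "\<exists>y\<in>carrier (form_module j). y \<oplus>\<^bsub>form_module j\<^esub> x = \<zero>\<^bsub>form_module j\<^esub>"
      by (intro bexI[of _ "- x"]) (auto simp: form_module_def intro!: modular_forms_minus)
  qed (auto simp: form_module_def lookup_add add.assoc add.commute
      intro!: modular_forms_zero modular_forms_add)
next
  fix a x assume a: "a \<in> carrier form_ring" and x: "x \<in> carrier (form_module j)"
  have "(\<lambda>b i. Poly_Mapping.lookup a k b * Poly_Mapping.lookup x (n - k) b i) \<in> modular_forms j n"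
    for k n
    using a x modular_forms_mult[of "Poly_Mapping.lookup a k" k
        "Poly_Mapping.lookup x (n - k)" j "n - k"]
    by (simp add: form_ring_def form_module_def)
  moreover have "Poly_Mapping.lookup (form_smult a x) n = (\<Sum>k\<in>Poly_Mapping.keys a.
      (\<lambda>b i. Poly_Mapping.lookup a k b * Poly_Mapping.lookup x (n - k) b i))" for n
    by (simp add: fun_eq_iff lookup_form_smult sum_fun_apply)
  ultimately show "a \<odot>\<^bsub>form_module j\<^esub> x \<in> carrier (form_module j)"
    by (auto simp: form_module_def intro!: modular_forms_sum)
next
  fix x assume x: "x \<in> carrier (form_module j)"
  have "indicator ball2 b * Poly_Mapping.lookup x n b i = Poly_Mapping.lookup x n b i" for b n i
    using x by (cases "b \<in> ball2") (auto simp: form_module_def intro: modular_forms_outside)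
  then show "\<one>\<^bsub>form_ring\<^esub> \<odot>\<^bsub>form_module j\<^esub> x = x"
    by (intro poly_mapping_eqI)
      (simp add: form_ring_def form_module_def fun_eq_iff lookup_form_smult in_keys_iff,
        metis zero_neq_one)
qed (auto simp: form_module_def form_ring_def form_smult_def distrib_left distrib_right mult.assoc
    lift_scalars_add lift_scalars_mult)

text \<open>A polynomial in three variables is given by its coefficients, indexed by exponents.\<close>

definition eval_poly3 :: "(nat \<Rightarrow> complex \<times> complex \<Rightarrow> complex)
    \<Rightarrow> (nat \<times> nat \<times> nat \<Rightarrow>\<^sub>0 complex) \<Rightarrow> int \<Rightarrow>\<^sub>0 (complex \<times> complex \<Rightarrow> complex)" where
  "eval_poly3 \<phi> P = finsum form_ring (\<lambda>(p, q, r).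
     Poly_Mapping.single 0 (\<lambda>b. Poly_Mapping.lookup P (p, q, r) * indicator ball2 b)
       \<otimes>\<^bsub>form_ring\<^esub> Poly_Mapping.single 3 (\<phi> 0) [^]\<^bsub>form_ring\<^esub> p
       \<otimes>\<^bsub>form_ring\<^esub> Poly_Mapping.single 3 (\<phi> 1) [^]\<^bsub>form_ring\<^esub> q
       \<otimes>\<^bsub>form_ring\<^esub> Poly_Mapping.single 3 (\<phi> 2) [^]\<^bsub>form_ring\<^esub> r) (Poly_Mapping.keys P)"

definition polynomial_generators :: "(nat \<Rightarrow> complex \<times> complex \<Rightarrow> complex) \<Rightarrow> bool" where
  "polynomial_generators \<phi> \<longleftrightarrow> bij_betw (eval_poly3 \<phi>) UNIV (carrier form_ring)"

section \<open>The Eisenstein series\<close>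

definition grad :: "(complex \<times> complex \<Rightarrow> complex) \<Rightarrow> complex \<times> complex \<Rightarrow> complex^2" where
  "grad f = (\<lambda>(u, v). vector [deriv (\<lambda>s. f (s, v)) u, deriv (\<lambda>t. f (u, t)) v])"

definition bracket :: "int \<Rightarrow> int \<Rightarrow> (complex \<times> complex \<Rightarrow> complex)
    \<Rightarrow> (complex \<times> complex \<Rightarrow> complex) \<Rightarrow> complex \<times> complex \<Rightarrow> complex^2" where
  "bracket k l f g = (\<lambda>b. (1 / of_int l * f b) *s grad g b - (1 / of_int k * g b) *s grad f b)"

definition Phi :: "(nat \<Rightarrow> complex \<times> complex \<Rightarrow> complex) \<Rightarrow> nat \<Rightarrow> complex \<times> complex \<Rightarrow> complex^2"
  where
  "Phi \<phi> i = (\<lambda>b. - ((1 / (6 * pi * \<i>)) *s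
     bracket 3 3 (\<phi> ((i + 1) mod 3)) (\<phi> ((i + 2) mod 3)) b))"

definition eis_num :: "(nat \<Rightarrow> complex \<times> complex \<Rightarrow> complex) \<Rightarrow> nat \<Rightarrow> complex \<times> complex
    \<Rightarrow> nat \<Rightarrow> complex" where
  "eis_num \<phi> i = (\<lambda>b. symv 3 (if i < 3 then Phi \<phi> i b else Phi \<phi> 0 b + Phi \<phi> 1 b + Phi \<phi> 2 b))"

definition eis_den :: "(nat \<Rightarrow> complex \<times> complex \<Rightarrow> complex) \<Rightarrow> nat \<Rightarrow> complex \<times> complex \<Rightarrow> complex"
  where
  "eis_den \<phi> i = (\<lambda>b. if i < 3
     then (\<phi> ((i + 1) mod 3) b * \<phi> ((i + 2) mod 3) b *
           (\<phi> ((i + 1) mod 3) b - \<phi> ((i + 2) mod 3) b))\<^sup>2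
     else ((\<phi> 0 b - \<phi> 1 b) * (\<phi> 0 b - \<phi> 2 b) * (\<phi> 1 b - \<phi> 2 b))\<^sup>2)"

text \<open>The quotient defining an Eisenstein series is a quotient of holomorphic functions whose
  denominator has zeros on the ball, so it denotes the holomorphic function that agrees with
  the pointwise quotient away from these zeros.\<close>

definition is_eisenstein :: "(nat \<Rightarrow> complex \<times> complex \<Rightarrow> complex) \<Rightarrow> nat
    \<Rightarrow> (complex \<times> complex \<Rightarrow> nat \<Rightarrow> complex) \<Rightarrow> bool" where
  "is_eisenstein \<phi> i E \<longleftrightarrow> E \<in> holo_maps 3 \<and>
     (\<forall>b\<in>ball2. eis_den \<phi> i b \<noteq> 0 \<longrightarrow> (\<forall>m. E b m = eis_num \<phi> i b m / eis_den \<phi> i b))"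

end

theory Submission
  imports Defs "HOL-Complex_Analysis.Conformal_Mappings"
begin

text \<open>
  Write \<open>\<Delta>\<close> for the determinant of the four vectors \<open>E\<^sub>0, E\<^sub>1, E\<^sub>2, E\<^sub>3\<close>. A form \<open>F\<close> has, by Cramer's rule, a
  unique expression \<open>F = \<Sum> (N\<^sub>l / \<Delta>) E\<^sub>l\<close> wherever \<open>\<Delta> \<noteq> 0\<close>, in which \<open>N\<^sub>l\<close> is the determinant with
  \<open>E\<^sub>l\<close> replaced by \<open>F\<close>. So the claim is that \<open>\<Delta>\<close> is not identically zero and divides every \<open>N\<^sub>l\<close>
  in the ring of scalar forms. Both follow from the identity \<open>\<Delta> = c \<cdot> D\<close>, where \<open>c \<noteq> 0\<close> is a constant
  and \<open>D\<close> is the product of the six differences \<open>x\<^sub>a - x\<^sub>b\<close>, a form of weight \<open>18\<close>.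

  \<^item> A vector \<open>r\<close> of norm \<open>1\<close> is the center of a reflection of order three in the congruence
    subgroup. At a point of its mirror the value of every vector-valued form is fixed by the symmetric
    cube of a matrix that is not scalar, so any four such values are linearly dependent
    (\<open>det4_zero_on_mirror\<close>): \<open>\<Delta>\<close> and all \<open>N\<^sub>l\<close> vanish on all mirrors.

  \<^item> Each difference \<open>x\<^sub>a - x\<^sub>b\<close> vanishes on some mirror on which the \<open>x\<^sub>i\<close> are not all proportional
    (\<open>mirror_of_exists\<close>). For \<open>x\<^sub>3 - x\<^sub>4\<close> this is the mirror \<open>u = 0\<close>: the element \<open>(u, v) \<mapsto> (-u, v)\<close>
    fixes it pointwise and transposes the last two cusps. The other pairs are reached by the action of
    the symmetric group on the cusps, realised by explicit matrices.

  \<^item> Modulo a linear form \<open>l\<close> a scalar form is a binary form in two other generators. If it vanishes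
    on a mirror on which \<open>l\<close> vanishes and those two generators are not proportional, the binary form
    has infinitely many roots and is zero. Hence a form that vanishes on all mirrors is divisible by
    \<open>D\<close> (\<open>divide_by_differences\<close>).

  \<^item> As the weight of \<open>\<Delta>\<close> is \<open>18\<close>, the quotient \<open>\<Delta> / D\<close> has weight \<open>0\<close> and is constant. It is not zero:
    by the homogeneous Vandermonde determinant \<open>\<Delta>\<close> is, where \<open>D \<noteq> 0\<close>, a nonzero multiple of the sixth
    power of the Jacobian determinant of \<open>\<phi>\<^sub>0, \<phi>\<^sub>1, \<phi>\<^sub>2\<close>. That Jacobian does not vanish identically,
    because \<open>\<phi>\<^sub>1 - \<phi>\<^sub>2\<close> vanishes on the mirror \<open>u = 0\<close> to a finite order while the ratio of \<open>\<phi>\<^sub>2\<close> and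
    \<open>\<phi>\<^sub>0\<close> is not constant on it (\<open>jac_zero_imp_zero\<close>).
\<close>

section \<open>Holomorphic functions of two variables\<close>

lemma holomorphic2_onI:
  assumes "\<And>b. b \<in> S \<Longrightarrow> (f has_derivative (\<lambda>(s, t). p b * s + q b * t)) (at b)"
  shows "holomorphic2_on f S"
  using assms unfolding holomorphic2_on_def by blast

lemma grad_of_has_derivative:
  assumes "(f has_derivative (\<lambda>(s, t). p * s + q * t)) (at (u, v))"
  shows "grad f (u, v) $ 1 = p" "grad f (u, v) $ 2 = q"
proof -
  have "((\<lambda>s. (s, v)) has_derivative (\<lambda>s. (s, 0))) (at u)"
    by (auto intro!: derivative_eq_intros)
  from has_derivative_compose[OF this assms]
  have "((\<lambda>s. f (s, v)) has_field_derivative p) (at u)"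
    by (simp add: has_field_derivative_def mult_commute_abs)
  then show "grad f (u, v) $ 1 = p" by (simp add: grad_def DERIV_imp_deriv)
  have "((\<lambda>t. (u, t)) has_derivative (\<lambda>t. (0, t))) (at v)"
    by (auto intro!: derivative_eq_intros)
  from has_derivative_compose[OF this assms]
  have "((\<lambda>t. f (u, t)) has_field_derivative q) (at v)"
    by (simp add: has_field_derivative_def mult_commute_abs)
  then show "grad f (u, v) $ 2 = q" by (simp add: grad_def DERIV_imp_deriv)
qed

lemma holomorphic2_on_has_derivative_grad:
  assumes "holomorphic2_on f S" "b \<in> S"
  shows "(f has_derivative (\<lambda>(s, t). grad f b $ 1 * s + grad f b $ 2 * t)) (at b)"
proof -
  obtain p q where pq: "(f has_derivative (\<lambda>(s, t). p * s + q * t)) (at b)"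
    using assms unfolding holomorphic2_on_def by blast
  moreover have "grad f b $ 1 = p" "grad f b $ 2 = q"
    using grad_of_has_derivative[of f p q "fst b" "snd b"] pq by simp_all
  ultimately show ?thesis by simp
qed

lemma holomorphic2_on_compose_curve:
  assumes "holomorphic2_on f S" "(x z, y z) \<in> S"
    and "(x has_field_derivative x') (at z)" "(y has_field_derivative y') (at z)"
  shows "((\<lambda>z. f (x z, y z)) has_field_derivative
    grad f (x z, y z) $ 1 * x' + grad f (x z, y z) $ 2 * y') (at z)"
proof -
  have "((\<lambda>z. (x z, y z)) has_derivative (\<lambda>h. (x' * h, y' * h))) (at z)"
    using assms(3,4) by (intro has_derivative_Pair) (simp_all add: has_field_derivative_def)
  from has_derivative_compose[OF this holomorphic2_on_has_derivative_grad[OF assms(1,2)]]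
  show ?thesis
    unfolding has_field_derivative_def
    by (rule has_derivative_eq_rhs) (auto simp: algebra_simps)
qed

lemma holomorphic2_on_slices:
  assumes "holomorphic2_on f S" "(u, v) \<in> S"
  shows "((\<lambda>s. f (s, v)) has_field_derivative grad f (u, v) $ 1) (at u)"
    and "((\<lambda>t. f (u, t)) has_field_derivative grad f (u, v) $ 2) (at v)"
  using holomorphic2_on_compose_curve[OF assms(1), of "\<lambda>s. s" u "\<lambda>_. v" 1 0]
    holomorphic2_on_compose_curve[OF assms(1), of "\<lambda>_. u" v "\<lambda>s. s" 0 1] assms(2)
  by simp_all

lemma holomorphic2_on_imp_continuous_on:
  "holomorphic2_on f S \<Longrightarrow> continuous_on S f"
  by (meson holomorphic2_on_def has_derivative_continuous continuous_at_imp_continuous_on)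

lemma holomorphic2_on_fst: "holomorphic2_on fst S"
  by (rule holomorphic2_onI[of _ _ "\<lambda>_. 1" "\<lambda>_. 0"])
    (auto intro!: derivative_eq_intros)

lemma holomorphic2_on_snd: "holomorphic2_on snd S"
  by (rule holomorphic2_onI[of _ _ "\<lambda>_. 0" "\<lambda>_. 1"])
    (auto intro!: derivative_eq_intros)

lemma holomorphic2_on_compose_holomorphic:
  assumes "holomorphic2_on f S" "\<And>b. b \<in> S \<Longrightarrow> h field_differentiable at (f b)"
  shows "holomorphic2_on (\<lambda>b. h (f b)) S"
proof (rule holomorphic2_onI)
  fix b assume b: "b \<in> S"
  have "(h has_derivative (*) (deriv h (f b))) (at (f b))"
    using assms(2)[OF b] field_differentiable_derivI by (simp add: has_field_derivative_def)
  from has_derivative_compose[OF holomorphic2_on_has_derivative_grad[OF assms(1) b] this]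
  show "((\<lambda>b. h (f b)) has_derivative
      (\<lambda>(s, t). (deriv h (f b) * grad f b $ 1) * s + (deriv h (f b) * grad f b $ 2) * t)) (at b)"
    by (rule has_derivative_eq_rhs) (auto simp: algebra_simps)
qed

lemma holomorphic2_on_minus: "holomorphic2_on f S \<Longrightarrow> holomorphic2_on (\<lambda>b. - f b) S"
  using holomorphic2_on_mult[OF holomorphic2_on_const[of "-1"], of f S] by simp

lemma holomorphic2_on_diff:
  "holomorphic2_on f S \<Longrightarrow> holomorphic2_on g S \<Longrightarrow> holomorphic2_on (\<lambda>b. f b - g b) S"
  using holomorphic2_on_add[OF _ holomorphic2_on_minus, of f S g] by simp

lemma holomorphic2_on_power: "holomorphic2_on f S \<Longrightarrow> holomorphic2_on (\<lambda>b. f b ^ n) S"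
  by (induction n) (auto intro: holomorphic2_on_const holomorphic2_on_mult)

lemma holomorphic2_on_sum:
  "(\<And>i. i \<in> A \<Longrightarrow> holomorphic2_on (f i) S) \<Longrightarrow> holomorphic2_on (\<lambda>b. \<Sum>i\<in>A. f i b) S"
  by (induction A rule: infinite_finite_induct)
    (auto intro: holomorphic2_on_const holomorphic2_on_add)

lemma holomorphic2_on_divide:
  assumes "holomorphic2_on f S" "holomorphic2_on g S" "\<And>b. b \<in> S \<Longrightarrow> g b \<noteq> 0"
  shows "holomorphic2_on (\<lambda>b. f b / g b) S"
  unfolding divide_inverse
  using assms
  by (intro holomorphic2_on_mult holomorphic2_on_compose_holomorphic[of g S inverse])
    (auto intro!: derivative_intros)

lemma holomorphic2_on_power_int:
  assumes "holomorphic2_on f S" "\<And>b. b \<in> S \<Longrightarrow> f b \<noteq> 0"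
  shows "holomorphic2_on (\<lambda>b. f b powi k) S"
proof (cases "k \<ge> 0")
  case True
  then show ?thesis by (simp add: power_int_def holomorphic2_on_power[OF assms(1)])
next
  case False
  then have "(\<lambda>b. f b powi k) = (\<lambda>b. 1 / f b ^ nat (- k))"
    by (simp add: power_int_def power_inverse divide_inverse)
  then show ?thesis
    using assms by (simp add: holomorphic2_on_divide holomorphic2_on_const holomorphic2_on_power)
qed

lemma holomorphic2_on_compose:
  assumes "holomorphic2_on f T" "holomorphic2_on x S" "holomorphic2_on y S"
    and "\<And>b. b \<in> S \<Longrightarrow> (x b, y b) \<in> T"
  shows "holomorphic2_on (\<lambda>b. f (x b, y b)) S"
proof (rule holomorphic2_onI)
  fix b assume b: "b \<in> S"
  let ?f = "grad f (x b, y b)"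
  have "((\<lambda>b. (x b, y b)) has_derivative
      (\<lambda>h. (case h of (s, t) \<Rightarrow> grad x b $ 1 * s + grad x b $ 2 * t,
        case h of (s, t) \<Rightarrow> grad y b $ 1 * s + grad y b $ 2 * t))) (at b)"
    using assms(2,3) b by (intro has_derivative_Pair holomorphic2_on_has_derivative_grad)
  from has_derivative_compose[OF this
      holomorphic2_on_has_derivative_grad[OF assms(1) assms(4)[OF b]]]
  show "((\<lambda>b. f (x b, y b)) has_derivative
      (\<lambda>(s, t). (?f $ 1 * grad x b $ 1 + ?f $ 2 * grad y b $ 1) * s
        + (?f $ 1 * grad x b $ 2 + ?f $ 2 * grad y b $ 2) * t)) (at b)"
    by (rule has_derivative_eq_rhs) (auto simp: algebra_simps)
qed

lemma holomorphic2_on_cong: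
  assumes "holomorphic2_on f S" "open S" "\<And>b. b \<in> S \<Longrightarrow> g b = f b"
  shows "holomorphic2_on g S"
proof (rule holomorphic2_onI)
  fix b assume "b \<in> S"
  show "(g has_derivative (\<lambda>(s, t). grad f b $ 1 * s + grad f b $ 2 * t)) (at b)"
    by (rule has_derivative_transform_within_open
        [OF holomorphic2_on_has_derivative_grad[OF assms(1) \<open>b \<in> S\<close>] assms(2) \<open>b \<in> S\<close>])
      (simp add: assms(3))
qed

lemmas holomorphic2_intros = holomorphic2_on_const holomorphic2_on_add holomorphic2_on_mult
  holomorphic2_on_minus holomorphic2_on_diff holomorphic2_on_power holomorphic2_on_sum
  holomorphic2_on_divide holomorphic2_on_power_int holomorphic2_on_fst holomorphic2_on_snd

lemma holomorphic2_on_swap: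
  assumes "holomorphic2_on f S"
  shows "holomorphic2_on (\<lambda>(s, t). f (t, s)) (prod.swap ` S)"
  using holomorphic2_on_compose[OF assms holomorphic2_on_snd holomorphic2_on_fst, of "prod.swap ` S"]
  by (force simp: case_prod_unfold)

definition circ :: "real \<Rightarrow> real \<Rightarrow> complex" where
  "circ r t = r * exp (2 * pi * \<i> * t)"

lemma norm_circ [simp]: "cmod (circ r t) = \<bar>r\<bar>"
  by (simp add: circ_def norm_mult norm_exp_eq_Re)

lemma circ_eq_0_iff [simp]: "circ r t = 0 \<longleftrightarrow> r = 0"
  by (simp add: circ_def)

lemma continuous_on_circ [continuous_intros]:
  "continuous_on S f \<Longrightarrow> continuous_on S (\<lambda>x. circ r (f x))"
  unfolding circ_def by (intro continuous_intros)

text \<open>Cauchy's formula for a derivative at the centre of a circle.\<close>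

lemma deriv_eq_circle_mean:
  assumes "r > 0" "continuous_on (cball u r) g" "g holomorphic_on ball u r"
  shows "deriv g u = integral {0..1}
    (\<lambda>t. g (u + circ r t) / circ r t)"
proof -
  have "(g has_field_derivative (1 / (2 * of_real pi * \<i>) *
      contour_integral (circlepath u r) (\<lambda>w. g w / (w - u)^2))) (at u)"
    using assms by (intro Cauchy_derivative_integral_circlepath) auto
  then have "deriv g u = 1 / (2 * of_real pi * \<i>) *
      contour_integral (circlepath u r) (\<lambda>w. g w / (w - u)^2)"
    by (rule DERIV_imp_deriv)
  also have "\<dots> = integral {0..1} (\<lambda>t. 1 / (2 * of_real pi * \<i>) *
      (g (circlepath u r t) / (circlepath u r t - u)^2 * vector_derivative (circlepath u r) (at t)))"
    by (simp only: contour_integral_integral integral_mult_right)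
  also have "\<dots> = integral {0..1}
      (\<lambda>t. g (u + circ r t) / circ r t)"
    using assms(1)
    by (intro integral_cong)
      (simp add: vector_derivative_circlepath, simp add: circlepath circ_def power2_eq_square field_simps)
  finally show ?thesis .
qed

text \<open>One radius serves for all points of a neighbourhood, so that the partial derivative inherits
  there the regularity of the integrand.\<close>

lemma grad_1_eq_circle_mean:
  assumes S: "open S" "b0 \<in> S"
    and f: "continuous_on S f" "\<And>u v. (u, v) \<in> S \<Longrightarrow> (\<lambda>s. f (s, v)) field_differentiable at u"
  obtains e where "e > 0" "ball b0 e \<subseteq> S"
    "\<And>u v t. (u, v) \<in> ball b0 e \<Longrightarrow> (u + circ e t, v) \<in> S"
    "\<And>u v. (u, v) \<in> ball b0 e \<Longrightarrow> grad f (u, v) $ 1 = integral {0..1}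
      (\<lambda>t. f (u + circ e t, v) / circ e t)"
proof -
  obtain e' where e': "e' > 0" "ball b0 e' \<subseteq> S"
    using S by (meson open_contains_ball)
  \<comment> \<open>a circle of radius \<open>e\<close> around a point at distance less than \<open>e\<close> stays in the ball of radius \<open>e'\<close>\<close>
  define e where "e = e' / 3"
  have in_S: "(w, v) \<in> S" if "(u, v) \<in> ball b0 e" "cmod (w - u) \<le> e" for u v w
  proof -
    have "dist b0 (w, v) \<le> dist b0 (u, v) + dist (u, v) (w, v)" by (rule dist_triangle)
    also have "\<dots> < e'"
      using that e'(1) by (simp add: dist_Pair_Pair dist_norm norm_minus_commute e_def)
    finally show ?thesis using e'(2) by auto
  qed
  show thesis
  proof
    show "e > 0" using e' by (simp add: e_def)
    show "ball b0 e \<subseteq> S" using e' by (auto simp: e_def)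
    show "(u + circ e t, v) \<in> S"
      if "(u, v) \<in> ball b0 e" for u v t
      using in_S[OF that, of "u + circ e t"] \<open>e > 0\<close>
      by (simp add: norm_mult norm_exp_eq_Re)
    fix u v assume uv: "(u, v) \<in> ball b0 e"
    have *: "(s, v) \<in> S" if "s \<in> cball u e" for s
      using in_S[OF uv, of s] that by (simp add: dist_norm norm_minus_commute)
    have "deriv (\<lambda>s. f (s, v)) u = integral {0..1}
      (\<lambda>t. f (u + circ e t, v) / circ e t)"
    proof (rule deriv_eq_circle_mean)
      show "continuous_on (cball u e) (\<lambda>s. f (s, v))"
        by (rule continuous_on_compose2[OF f(1)]) (auto intro!: continuous_intros *)
      show "(\<lambda>s. f (s, v)) holomorphic_on ball u e"
        unfolding holomorphic_on_def
        by (auto intro!: field_differentiable_at_within f(2) *)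
    qed fact
    then show "grad f (u, v) $ 1 = integral {0..1}
      (\<lambda>t. f (u + circ e t, v) / circ e t)"
      by (simp add: grad_def)
  qed
qed

lemma continuous_on_grad_1:
  assumes "open S" "continuous_on S f"
    and "\<And>u v. (u, v) \<in> S \<Longrightarrow> (\<lambda>s. f (s, v)) field_differentiable at u"
  shows "continuous_on S (\<lambda>b. grad f b $ 1)"
proof -
  have "continuous (at b0) (\<lambda>b. grad f b $ 1)" if b0: "b0 \<in> S" for b0
  proof -
    obtain e where e: "e > 0" "ball b0 e \<subseteq> S"
      "\<And>u v t. (u, v) \<in> ball b0 e \<Longrightarrow> (u + circ e t, v) \<in> S"
      "\<And>u v. (u, v) \<in> ball b0 e \<Longrightarrow> grad f (u, v) $ 1 = integral {0..1}
        (\<lambda>t. f (u + circ e t, v) / circ e t)"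
      using grad_1_eq_circle_mean[OF assms(1) b0 assms(2,3)] by blast
    let ?F = "\<lambda>b t. f (fst b + circ e t, snd b) / circ e t"
    have "continuous_on (ball b0 e \<times> cbox 0 1) (\<lambda>(b, t). ?F b t)"
      unfolding case_prod_unfold
      using e(1,3) by (intro continuous_intros continuous_on_compose2[OF assms(2)]) auto
    then have "continuous_on (ball b0 e) (\<lambda>b. integral (cbox 0 1) (?F b))"
      by (rule integral_continuous_on_param)
    then have "continuous_on (ball b0 e) (\<lambda>b. grad f b $ 1)"
      by (rule continuous_on_eq) (use e(4) in \<open>force simp: cbox_interval\<close>)
    then show ?thesis
      using e(1) by (simp add: continuous_on_eq_continuous_at)
  qed
  then show ?thesis
    by (simp add: continuous_at_imp_continuous_on)
qed

lemma grad_swap: "grad (\<lambda>(s, t). f (t, s)) (v, u) $ 1 = grad f (u, v) $ 2"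
  by (simp add: grad_def)

lemma open_swap: "open S \<Longrightarrow> open (prod.swap ` S)" for S :: "(complex \<times> complex) set"
proof -
  assume "open S"
  then have "open (prod.swap -` S)"
    by (rule open_vimage) (auto simp: prod.swap_def intro!: continuous_intros)
  moreover have "prod.swap -` S = prod.swap ` S" by force
  ultimately show ?thesis by simp
qed

lemma continuous_on_grad_2:
  assumes "open S" "continuous_on S f"
    and "\<And>u v. (u, v) \<in> S \<Longrightarrow> (\<lambda>t. f (u, t)) field_differentiable at v"
  shows "continuous_on S (\<lambda>b. grad f b $ 2)"
proof -
  have "continuous_on (prod.swap ` S) (\<lambda>b. grad (\<lambda>(s, t). f (t, s)) b $ 1)"
  proof (rule continuous_on_grad_1)
    show "open (prod.swap ` S)" using assms(1) by (rule open_swap)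
    show "continuous_on (prod.swap ` S) (\<lambda>(s, t). f (t, s))"
      unfolding case_prod_unfold
      by (rule continuous_on_compose2[OF assms(2)]) (auto intro!: continuous_intros)
  qed (auto intro!: assms(3))
  then have "continuous_on S (\<lambda>b. grad (\<lambda>(s, t). f (t, s)) (snd b, fst b) $ 1)"
    by (rule continuous_on_compose2) (force intro!: continuous_intros)+
  then show ?thesis by (simp add: grad_swap)
qed

text \<open>A continuous function that is holomorphic in each variable has continuous partial
  derivatives by Cauchy's formula, hence is differentiable.\<close>

lemma separately_holomorphic_imp_holomorphic2_on:
  assumes "open S" "continuous_on S f"
    and "\<And>u v. (u, v) \<in> S \<Longrightarrow> (\<lambda>s. f (s, v)) field_differentiable at u"
    and "\<And>u v. (u, v) \<in> S \<Longrightarrow> (\<lambda>t. f (u, t)) field_differentiable at v"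
  shows "holomorphic2_on f S"
proof (rule holomorphic2_onI, clarify)
  have slices: "((\<lambda>s. f (s, v)) has_field_derivative grad f (u, v) $ 1) (at u)"
    "((\<lambda>t. f (u, t)) has_field_derivative grad f (u, v) $ 2) (at v)" if "(u, v) \<in> S" for u v
    using assms(3,4)[OF that] by (simp_all add: grad_def field_differentiable_derivI)
  fix u0 v0 assume "(u0, v0) \<in> S"
  then obtain X Y where XY: "open X" "open Y" "u0 \<in> X" "v0 \<in> Y" "X \<times> Y \<subseteq> S"
    using assms(1) by (metis open_prod_elim SigmaE2)
  obtain e where e: "e > 0" "ball v0 e \<subseteq> Y"
    using XY by (meson open_contains_ball)
  let ?q = "\<lambda>x y. blinfun_mult_right (grad f (x, y) $ 2)"
  have "((\<lambda>(x, y). f (x, y)) has_derivative (\<lambda>(tx, ty). grad f (u0, v0) $ 1 * tx + ?q u0 v0 ty))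
      (at (u0, v0) within X \<times> ball v0 e)"
  proof (rule has_derivative_partialsI)
    show "((\<lambda>x. f (x, v0)) has_derivative (*) (grad f (u0, v0) $ 1)) (at u0 within X)"
      using has_field_derivative_at_within[OF slices(1)[OF \<open>(u0, v0) \<in> S\<close>]]
      by (simp add: has_field_derivative_def)
    show "((\<lambda>y. f (x, y)) has_derivative blinfun_apply (?q x y)) (at y within ball v0 e)"
      if "x \<in> X" "y \<in> ball v0 e" for x y
    proof -
      have "(x, y) \<in> S" using that XY e by auto
      from has_field_derivative_at_within[OF slices(2)[OF this]] show ?thesis
        by (simp add: has_field_derivative_def blinfun_mult_right.rep_eq)
    qed
    have "continuous (at (u0, v0)) (\<lambda>b. grad f b $ 2)"
      using continuous_on_grad_2[OF assms(1,2,4)] \<open>(u0, v0) \<in> S\<close> assms(1)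
      by (simp add: continuous_on_eq_continuous_at)
    then have "continuous (at (u0, v0)) (\<lambda>(x, y). ?q x y)"
      unfolding case_prod_unfold prod.collapse
      by (rule bounded_linear.continuous[OF bounded_linear_blinfun_mult_right])
    then show "continuous (at (u0, v0) within X \<times> ball v0 e) (\<lambda>(x, y). ?q x y)"
      by (rule continuous_at_imp_continuous_within)
  qed (use e in auto)
  moreover have "at (u0, v0) within X \<times> ball v0 e = at (u0, v0)"
    using XY e by (intro at_within_open open_Times) auto
  ultimately show "(f has_derivative (\<lambda>(s, t). grad f (u0, v0) $ 1 * s + grad f (u0, v0) $ 2 * t))
      (at (u0, v0))"
    by (simp add: case_prod_unfold)
qed

text \<open>The mean over a circle in the first variable may be differentiated in the second one.\<close>

lemma holomorphic2_on_grad_1: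
  assumes "open S" "holomorphic2_on f S"
  shows "holomorphic2_on (\<lambda>b. grad f b $ 1) S"
proof (rule separately_holomorphic_imp_holomorphic2_on[OF assms(1)])
  have fd: "(\<lambda>s. f (s, v)) field_differentiable at u" "(\<lambda>t. f (u, t)) field_differentiable at v"
    if "(u, v) \<in> S" for u v
    using holomorphic2_on_slices[OF assms(2) that] by (auto simp: field_differentiable_def)
  have cf: "continuous_on S f" by (rule holomorphic2_on_imp_continuous_on[OF assms(2)])
  show "continuous_on S (\<lambda>b. grad f b $ 1)"
    by (rule continuous_on_grad_1[OF assms(1) cf fd(1)])
  fix u v assume uv: "(u, v) \<in> S"
  show "(\<lambda>s. grad f (s, v) $ 1) field_differentiable at u"
  proof -
    let ?U = "{s. (s, v) \<in> S}"
    have "open ?U"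
      using open_vimage[OF assms(1), of "\<lambda>s. (s, v)"] by (simp add: vimage_def continuous_intros)
    moreover have "(\<lambda>s. f (s, v)) holomorphic_on ?U"
      unfolding holomorphic_on_def by (auto intro!: field_differentiable_at_within fd)
    ultimately have "deriv (\<lambda>s. f (s, v)) holomorphic_on ?U"
      by (rule holomorphic_deriv[rotated])
    then have "deriv (\<lambda>s. f (s, v)) field_differentiable at u"
      using \<open>open ?U\<close> uv by (simp add: holomorphic_on_imp_differentiable_at)
    then show ?thesis by (simp add: grad_def)
  qed
  show "(\<lambda>t. grad f (u, t) $ 1) field_differentiable at v"
  proof -
    obtain e where e: "e > 0" "ball (u, v) e \<subseteq> S"
      "\<And>u' v' t. (u', v') \<in> ball (u, v) e
        \<Longrightarrow> (u' + circ e t, v') \<in> S"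
      "\<And>u' v'. (u', v') \<in> ball (u, v) e \<Longrightarrow> grad f (u', v') $ 1 = integral {0..1}
        (\<lambda>t. f (u' + circ e t, v') / circ e t)"
      using grad_1_eq_circle_mean[OF assms(1) uv cf fd(1)] by blast
    have ball: "(u, y) \<in> ball (u, v) e" if "y \<in> ball v e" for y
      using that by (simp add: dist_Pair_Pair)
    have "(\<lambda>y. integral (cbox 0 1) (\<lambda>t. f (u + circ e t, y) / circ e t)) holomorphic_on ball v e"
    proof (rule leibniz_rule_holomorphic)
      fix y and t :: real assume y: "y \<in> ball v e"
      have "(u + circ e t, y) \<in> S" using e(3)[OF ball[OF y]] by simp
      then have "((\<lambda>y. f (u + circ e t, y)) has_field_derivative grad f (u + circ e t, y) $ 2)
          (at y within ball v e)"
        by (rule has_field_derivative_at_within[OF holomorphic2_on_slices(2)[OF assms(2)]])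
      then show "((\<lambda>y. f (u + circ e t, y) / circ e t) has_field_derivative
          grad f (u + circ e t, y) $ 2 / circ e t) (at y within ball v e)"
        by (rule DERIV_cdivide)
    next
      fix y assume y: "y \<in> ball v e"
      have "continuous_on (cbox 0 1) (\<lambda>t. f (u + circ e t, y) / circ e t)"
        using e(1) e(3)[OF ball[OF y]] by (intro continuous_intros continuous_on_compose2[OF cf]) auto
      then show "(\<lambda>t. f (u + circ e t, y) / circ e t) integrable_on cbox 0 1"
        by (rule integrable_continuous)
    next
      show "continuous_on (ball v e \<times> cbox 0 1) (\<lambda>(y, t). grad f (u + circ e t, y) $ 2 / circ e t)"
        unfolding case_prod_unfold
        using e(1) e(3)[OF ball]
        by (intro continuous_intros continuous_on_compose2[OF continuous_on_grad_2[OF assms(1) cf fd(2)]])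
          auto
    qed simp
    then have "(\<lambda>y. grad f (u, y) $ 1) holomorphic_on ball v e"
      by (rule holomorphic_transform) (use e(4) ball in \<open>simp add: cbox_interval\<close>)
    then show ?thesis
      using e(1) by (simp add: holomorphic_on_imp_differentiable_at)
  qed
qed

lemma holomorphic2_on_grad_2:
  assumes "open S" "holomorphic2_on f S"
  shows "holomorphic2_on (\<lambda>b. grad f b $ 2) S"
proof -
  have "holomorphic2_on (\<lambda>b. grad (\<lambda>(s, t). f (t, s)) b $ 1) (prod.swap ` S)"
    by (intro holomorphic2_on_grad_1 open_swap holomorphic2_on_swap assms)
  from holomorphic2_on_compose[OF this holomorphic2_on_snd holomorphic2_on_fst, of S]
  have "holomorphic2_on (\<lambda>b. grad (\<lambda>(s, t). f (t, s)) (snd b, fst b) $ 1) S"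
    by force
  then show ?thesis by (simp add: grad_swap)
qed

section \<open>Identity theorems on the ball\<close>

lemma open_ball2: "open ball2"
  unfolding ball2_def case_prod_unfold
  by (intro open_Collect_less continuous_intros)

lemma convex_ball2: "convex ball2"
proof (rule convexI)
  fix x y :: "complex \<times> complex" and s t :: real
  assume xy: "x \<in> ball2" "y \<in> ball2" and st: "0 \<le> s" "0 \<le> t" "s + t = 1"
  let ?a = "cmod (fst x)" and ?c = "cmod (fst y)"
  have x: "2 * Re (snd x) + ?a\<^sup>2 < 0" and y: "2 * Re (snd y) + ?c\<^sup>2 < 0"
    using xy by (auto simp: ball2_def)
  have "cmod (s *\<^sub>R fst x + t *\<^sub>R fst y) \<le> s * ?a + t * ?c"
    using st by (intro order_trans[OF norm_triangle_ineq]) simp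
  then have "(cmod (s *\<^sub>R fst x + t *\<^sub>R fst y))\<^sup>2 \<le> (s * ?a + t * ?c)\<^sup>2"
    by (intro power_mono) simp_all
  also have "\<dots> = s * ?a\<^sup>2 + t * ?c\<^sup>2 - s * t * (?a - ?c)\<^sup>2"
  proof -
    have t: "t = 1 - s" using st(3) by simp
    show ?thesis unfolding t by (simp add: power2_eq_square algebra_simps)
  qed
  also have "\<dots> \<le> s * ?a\<^sup>2 + t * ?c\<^sup>2"
    using st by simp
  finally have "2 * Re (s *\<^sub>R snd x + t *\<^sub>R snd y) + (cmod (s *\<^sub>R fst x + t *\<^sub>R fst y))\<^sup>2
      \<le> s * (2 * Re (snd x) + ?a\<^sup>2) + t * (2 * Re (snd y) + ?c\<^sup>2)"
    by (simp add: algebra_simps)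
  also have "\<dots> < 0"
  proof (cases "s = 0")
    case False
    then have "s * (2 * Re (snd x) + ?a\<^sup>2) < 0" using st x by (simp add: mult_pos_neg)
    moreover have "t * (2 * Re (snd y) + ?c\<^sup>2) \<le> 0" using st y by (simp add: mult_nonneg_nonpos)
    ultimately show ?thesis by linarith
  qed (use st y in simp)
  finally show "s *\<^sub>R x + t *\<^sub>R y \<in> ball2"
    by (simp add: ball2_def case_prod_unfold)
qed

lemma zero_on_open_imp_zero:
  assumes "F holomorphic_on Z" "open Z" "connected Z" "ball z0 e \<subseteq> Z" "e > 0"
    and "\<And>z. z \<in> ball z0 e \<Longrightarrow> F z = 0" and "z \<in> Z"
  shows "F z = 0"
  by (rule analytic_continuation[OF assms(1-4), of z0])
    (use assms in \<open>auto simp: islimpt_ball subset_eq\<close>)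

lemma holomorphic_nonzero_ball:
  assumes "F holomorphic_on Z" "open Z" "z0 \<in> Z" "F z0 \<noteq> 0"
  obtains e where "e > 0" "ball z0 e \<subseteq> Z" "\<And>z. z \<in> ball z0 e \<Longrightarrow> F z \<noteq> 0"
proof -
  have "isCont F z0"
    using assms by (meson holomorphic_on_imp_continuous_on continuous_on_eq_continuous_at)
  from continuous_at_avoid[OF this assms(4)] obtain d where
    d: "d > 0" "\<And>y. dist z0 y < d \<Longrightarrow> F y \<noteq> 0" by blast
  obtain e where e: "e > 0" "ball z0 e \<subseteq> Z"
    using assms(2,3) by (meson open_contains_ball)
  show thesis
    by (rule that[of "min d e"]) (use d e in auto)
qed

lemma holomorphic_product_zero:
  assumes "F holomorphic_on Z" "G holomorphic_on Z" "open Z" "connected Z"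
    and "\<And>z. z \<in> Z \<Longrightarrow> F z * G z = 0" and "z0 \<in> Z" "F z0 \<noteq> 0" "z \<in> Z"
  shows "G z = 0"
proof -
  obtain e where e: "e > 0" "ball z0 e \<subseteq> Z" "\<And>z. z \<in> ball z0 e \<Longrightarrow> F z \<noteq> 0"
    using holomorphic_nonzero_ball[OF assms(1,3,6,7)] by blast
  show ?thesis
    by (rule zero_on_open_imp_zero[OF assms(2-4) e(2,1) _ assms(8)]) (use assms(5) e in force)
qed

definition line :: "complex \<times> complex \<Rightarrow> complex \<times> complex \<Rightarrow> complex \<Rightarrow> complex \<times> complex" where
  "line p q z = (fst p + z * (fst q - fst p), snd p + z * (snd q - snd p))"

definition line_dom :: "complex \<times> complex \<Rightarrow> complex \<times> complex \<Rightarrow> complex set" where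
  "line_dom p q = {z. line p q z \<in> ball2}"

lemma line_0 [simp]: "line p q 0 = p" and line_1 [simp]: "line p q 1 = q"
  by (simp_all add: line_def)

lemma open_line_dom: "open (line_dom p q)"
  using open_vimage[OF open_ball2, of "line p q"]
  by (simp add: line_dom_def vimage_def line_def[abs_def] continuous_intros)

lemma connected_line_dom: "connected (line_dom p q)"
proof (rule convex_connected, rule convexI)
  fix x y :: complex and s t :: real
  assume xy: "x \<in> line_dom p q" "y \<in> line_dom p q" and st: "0 \<le> s" "0 \<le> t" "s + t = 1"
  have t: "t = 1 - s" using st by simp
  have "line p q (s *\<^sub>R x + t *\<^sub>R y) = s *\<^sub>R line p q x + t *\<^sub>R line p q y"
    by (auto simp: line_def t algebra_simps scaleR_conv_of_real prod_eq_iff)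
  then show "s *\<^sub>R x + t *\<^sub>R y \<in> line_dom p q"
    using convexD[OF convex_ball2 _ _ st] xy by (simp add: line_dom_def)
qed


lemma holomorphic_on_line:
  assumes "holomorphic2_on f ball2"
  shows "(\<lambda>z. f (line p q z)) holomorphic_on line_dom p q"
proof -
  have "((\<lambda>z. f (line p q z)) has_field_derivative
      grad f (line p q z) $ 1 * (fst q - fst p) + grad f (line p q z) $ 2 * (snd q - snd p)) (at z)"
    if "z \<in> line_dom p q" for z
    using that unfolding line_def line_dom_def
    by (intro holomorphic2_on_compose_curve[OF assms]) (auto intro!: derivative_eq_intros)
  then show ?thesis
    unfolding holomorphic_on_def field_differentiable_def
    by (meson has_field_derivative_at_within)
qed

text \<open>Any two points of the ball lie on a complex line that meets the ball in a connected set,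
  so the one-variable identity theorem along lines suffices.\<close>

lemma holomorphic2_product_zero:
  assumes "holomorphic2_on f ball2" "holomorphic2_on g ball2"
    and "\<And>b. b \<in> ball2 \<Longrightarrow> f b * g b = 0" and "p \<in> ball2" "f p \<noteq> 0" "b \<in> ball2"
  shows "g b = 0"
  using holomorphic_product_zero[OF holomorphic_on_line[OF assms(1), of p b]
      holomorphic_on_line[OF assms(2)] open_line_dom connected_line_dom, of 0 1] assms(3-6)
  by (auto simp: line_dom_def)

lemma proportional_of_proportional_near:
  assumes "F holomorphic_on Z" "G holomorphic_on Z" "open Z" "connected Z"
    and "ball z0 e \<subseteq> Z" "e > 0" "\<And>z. z \<in> ball z0 e \<Longrightarrow> F z = c * G z"
    and "z \<in> Z" "w \<in> Z"
  shows "F z * G w = F w * G z"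
proof -
  have "F z - c * G z = 0" if "z \<in> Z" for z
    by (rule zero_on_open_imp_zero[of "\<lambda>z. F z - c * G z", OF _ assms(3-6) _ that])
      (auto intro!: holomorphic_intros assms)
  then have "F z = c * G z" "F w = c * G w" using assms(8,9) by simp_all
  then show ?thesis by simp
qed

text \<open>Where the denominator does not vanish, the quotient has derivative zero.\<close>

lemma proportional_of_Wronskian_zero:
  assumes "F holomorphic_on Z" "G holomorphic_on Z" "open Z" "connected Z"
    and W: "\<And>z. z \<in> Z \<Longrightarrow> F z * deriv G z = deriv F z * G z"
    and "z \<in> Z" "w \<in> Z"
  shows "F z * G w = F w * G z"
proof (cases "\<forall>z\<in>Z. G z = 0")
  case False
  then obtain z0 where "z0 \<in> Z" "G z0 \<noteq> 0" by blast
  then obtain e where e: "e > 0" "ball z0 e \<subseteq> Z" "\<And>z. z \<in> ball z0 e \<Longrightarrow> G z \<noteq> 0"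
    using holomorphic_nonzero_ball[OF assms(2,3)] by metis
  have "((\<lambda>z. F z / G z) has_field_derivative 0) (at z within ball z0 e)"
    if "z \<in> ball z0 e" for z
  proof -
    have z: "z \<in> Z" "G z \<noteq> 0" using that e by auto
    have "(F has_field_derivative deriv F z) (at z)" "(G has_field_derivative deriv G z) (at z)"
      using assms(1-3) z(1) by (auto intro: holomorphic_derivI)
    from DERIV_divide[OF this z(2)] have "((\<lambda>z. F z / G z) has_field_derivative 0) (at z)"
      using W[OF z(1)] by (simp add: mult.commute)
    then show ?thesis by (rule has_field_derivative_at_within)
  qed
  then obtain c where c: "\<And>z. z \<in> ball z0 e \<Longrightarrow> F z / G z = c"
    using has_field_derivative_zero_constant[of "ball z0 e" "\<lambda>z. F z / G z"] by auto
  show ?thesis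
    by (rule proportional_of_proportional_near[OF assms(1-4) e(2,1) _ assms(6,7), of c])
      (use c e(3) in \<open>force simp: field_simps\<close>)
qed (use assms(6,7) in simp)

text \<open>Two functions that are not proportional take infinitely many ratios, too many for the
  roots of a binary form.\<close>

lemma binary_form_zero_imp_coeffs_zero:
  assumes "F holomorphic_on Z" "G holomorphic_on Z" "open Z" "connected Z"
    and form: "\<And>z. z \<in> Z \<Longrightarrow> (\<Sum>i\<le>d. c i * (F z ^ (d - i) * G z ^ i)) = 0"
    and nprop: "z \<in> Z" "w \<in> Z" "F z * G w \<noteq> F w * G z"
    and "i \<le> d"
  shows "c i = 0"
proof (rule ccontr)
  assume "c i \<noteq> 0"
  then have fin: "finite {x. (\<Sum>i\<le>d. c i * x ^ i) = 0}"
    using polyfun_finite_roots[where c = c and n = d] \<open>i \<le> d\<close> by blast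
  obtain z0 where "z0 \<in> Z" "F z0 \<noteq> 0"
    using nprop by (metis mult_zero_left)
  then obtain e where e: "e > 0" "ball z0 e \<subseteq> Z" "\<And>z. z \<in> ball z0 e \<Longrightarrow> F z \<noteq> 0"
    using holomorphic_nonzero_ball[OF assms(1,3)] by metis
  have "(\<Sum>i\<le>d. c i * (G z / F z) ^ i) = 0" if z: "z \<in> ball z0 e" for z
  proof -
    have nz: "F z \<noteq> 0" and "z \<in> Z" using e z by auto
    have "F z ^ (d - i) * G z ^ i = F z ^ d * (G z / F z) ^ i" if "i \<le> d" for i
    proof -
      have "F z ^ d = F z ^ (d - i) * F z ^ i" using that by (simp flip: power_add)
      then show ?thesis using nz by (simp add: power_divide)
    qed
    then have "(\<Sum>i\<le>d. c i * (F z ^ (d - i) * G z ^ i)) = F z ^ d * (\<Sum>i\<le>d. c i * (G z / F z) ^ i)"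
      unfolding sum_distrib_left by (intro sum.cong) (simp_all add: mult_ac)
    then show ?thesis using form[OF \<open>z \<in> Z\<close>] nz by simp
  qed
  then have "(\<lambda>z. G z / F z) ` ball z0 e \<subseteq> {x. (\<Sum>i\<le>d. c i * x ^ i) = 0}" by auto
  then have "finite ((\<lambda>z. G z / F z) ` ball z0 e)" using fin by (rule finite_subset)
  moreover have "continuous_on (ball z0 e) (\<lambda>z. G z / F z)"
    using assms(1,2) e(2,3)
    by (intro continuous_intros) (auto intro: holomorphic_on_imp_continuous_on holomorphic_on_subset)
  ultimately have "(\<lambda>z. G z / F z) constant_on ball z0 e"
    by (intro continuous_finite_range_constant) simp_all
  then obtain k where k: "\<And>z. z \<in> ball z0 e \<Longrightarrow> G z / F z = k"
    unfolding constant_on_def by blast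
  have "G z * F w = G w * F z"
    by (rule proportional_of_proportional_near[OF assms(2,1,3,4) e(2,1) _ nprop(1,2), of k])
      (use k e(3) in \<open>force simp: field_simps\<close>)
  then show False using nprop(3) by (simp add: mult.commute)
qed

section \<open>Nonvanishing of a Jacobian\<close>

text \<open>The quotient is the mean of the partial derivative over the segment from the mirror.\<close>

lemma divide_by_fst:
  assumes f: "holomorphic2_on f ball2" and 0: "\<And>v. (0, v) \<in> ball2 \<Longrightarrow> f (0, v) = 0"
  obtains e where "holomorphic2_on e ball2" "\<And>u v. (u, v) \<in> ball2 \<Longrightarrow> f (u, v) = u * e (u, v)"
proof
  let ?g = "\<lambda>b. grad f b $ 1"
  let ?e = "\<lambda>b. integral (cbox 0 1) (\<lambda>t::real. ?g (of_real t * fst b, snd b))"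
  have g: "holomorphic2_on ?g ball2" by (rule holomorphic2_on_grad_1[OF open_ball2 f])
  have cg: "continuous_on ball2 ?g"
    and cg1: "continuous_on ball2 (\<lambda>b. grad ?g b $ 1)"
    and cg2: "continuous_on ball2 (\<lambda>b. grad ?g b $ 2)"
    by (auto intro!: holomorphic2_on_imp_continuous_on holomorphic2_on_grad_1
        holomorphic2_on_grad_2 open_ball2 g)
  have seg: "(of_real t * u, v) \<in> ball2" if "(u, v) \<in> ball2" "t \<in> {0..1}" for u v and t :: real
  proof -
    have "(cmod (of_real t * u))\<^sup>2 \<le> (cmod u)\<^sup>2"
      using that(2) by (intro power_mono) (auto simp: norm_mult mult_left_le_one_le)
    moreover have "2 * Re v + (cmod u)\<^sup>2 < 0" using that(1) by (simp add: ball2_def)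
    ultimately have "2 * Re v + (cmod (of_real t * u))\<^sup>2 < 0" by linarith
    then show ?thesis by (simp add: ball2_def)
  qed
  show "f (u, v) = u * ?e (u, v)" if uv: "(u, v) \<in> ball2" for u v
  proof -
    have "((\<lambda>t::real. u * ?g (of_real t * u, v)) has_integral f (of_real 1 * u, v) - f (of_real 0 * u, v)) {0..1}"
    proof (rule fundamental_theorem_of_calculus)
      fix t :: real assume t: "t \<in> {0..1}"
      have "((\<lambda>z. f (z * u, v)) has_field_derivative
          ?g (of_real t * u, v) * u + grad f (of_real t * u, v) $ 2 * 0) (at (of_real t))"
        using seg[OF uv t]
        by (intro holomorphic2_on_compose_curve[OF f]) (auto intro!: derivative_eq_intros)
      then have "((\<lambda>z. f (z * u, v)) has_field_derivative ?g (of_real t * u, v) * u) (at (of_real t))"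
        by simp
      from has_vector_derivative_real_field[OF this]
      show "((\<lambda>t. f (of_real t * u, v)) has_vector_derivative u * ?g (of_real t * u, v)) (at t within {0..1})"
        by (simp add: mult.commute)
    qed simp
    then have "((\<lambda>t::real. u * ?g (of_real t * u, v)) has_integral f (u, v)) {0..1}"
      using 0 seg[OF uv, of 0] by simp
    then have "integral {0..1} (\<lambda>t::real. u * ?g (of_real t * u, v)) = f (u, v)"
      by (rule integral_unique)
    then show ?thesis by (simp add: cbox_interval)
  qed
  show "holomorphic2_on ?e ball2"
  proof (rule separately_holomorphic_imp_holomorphic2_on[OF open_ball2])
    show "continuous_on ball2 ?e"
    proof (rule integral_continuous_on_param)
      show "continuous_on (ball2 \<times> cbox 0 1) (\<lambda>(b, t::real). ?g (of_real t * fst b, snd b))"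
        unfolding case_prod_unfold
        by (rule continuous_on_compose2[OF cg]) (auto intro!: continuous_intros seg)
    qed
    fix u v assume uv: "(u, v) \<in> ball2"
    then obtain U V where UV: "open U" "open V" "u \<in> U" "v \<in> V" "U \<times> V \<subseteq> ball2"
      using open_ball2 by (metis open_prod_elim SigmaE2)
    obtain r where r: "r > 0" "ball u r \<subseteq> U" using UV by (meson open_contains_ball)
    obtain s where s: "s > 0" "ball v s \<subseteq> V" using UV by (meson open_contains_ball)
    have segU: "(of_real t * x, v) \<in> ball2" if "x \<in> ball u r" "t \<in> {0..1}" for x and t :: real
      using that(1) r(2) UV(4,5) by (intro seg that(2)) blast
    have segV: "(of_real t * u, y) \<in> ball2" if "y \<in> ball v s" "t \<in> {0..1}" for y and t :: real
      using that(1) s(2) UV(3,5) by (intro seg that(2)) blast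
    have "(\<lambda>x. ?e (x, v)) holomorphic_on ball u r"
      unfolding fst_conv snd_conv
    proof (rule leibniz_rule_holomorphic)
      fix x and t :: real assume x: "x \<in> ball u r" and t: "t \<in> cbox 0 1"
      have "((\<lambda>x. ?g (of_real t * x, v)) has_field_derivative
          grad ?g (of_real t * x, v) $ 1 * of_real t + grad ?g (of_real t * x, v) $ 2 * 0) (at x)"
        using x t by (intro holomorphic2_on_compose_curve[OF g] segU) (auto intro!: derivative_eq_intros)
      then have "((\<lambda>x. ?g (of_real t * x, v)) has_field_derivative
          grad ?g (of_real t * x, v) $ 1 * of_real t) (at x)"
        by simp
      then show "((\<lambda>x. ?g (of_real t * x, v)) has_field_derivative
          grad ?g (of_real t * x, v) $ 1 * of_real t) (at x within ball u r)"
        by (rule has_field_derivative_at_within)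
    next
      fix x assume x: "x \<in> ball u r"
      show "(\<lambda>t::real. ?g (of_real t * x, v)) integrable_on cbox 0 1"
        using segU[OF x]
        by (intro integrable_continuous continuous_on_compose2[OF cg]) (auto intro!: continuous_intros)
    next
      show "continuous_on (ball u r \<times> cbox 0 1) (\<lambda>(x, t::real). grad ?g (of_real t * x, v) $ 1 * of_real t)"
        unfolding case_prod_unfold
        using segU
        by (intro continuous_intros continuous_on_compose2[OF cg1]) (auto intro!: continuous_intros)
    qed simp
    then show "(\<lambda>x. ?e (x, v)) field_differentiable at u"
      by (rule holomorphic_on_imp_differentiable_at) (use r(1) in simp_all)
    have "(\<lambda>y. ?e (u, y)) holomorphic_on ball v s"
      unfolding fst_conv snd_conv
    proof (rule leibniz_rule_holomorphic)
      fix y and t :: real assume y: "y \<in> ball v s" and t: "t \<in> cbox 0 1"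
      have "((\<lambda>y. ?g (of_real t * u, y)) has_field_derivative
          grad ?g (of_real t * u, y) $ 2) (at y)"
        using y t by (intro holomorphic2_on_slices(2)[OF g] segV) simp_all
      then show "((\<lambda>y. ?g (of_real t * u, y)) has_field_derivative
          grad ?g (of_real t * u, y) $ 2) (at y within ball v s)"
        by (rule has_field_derivative_at_within)
    next
      fix y assume y: "y \<in> ball v s"
      show "(\<lambda>t::real. ?g (of_real t * u, y)) integrable_on cbox 0 1"
        using segV[OF y]
        by (intro integrable_continuous continuous_on_compose2[OF cg]) (auto intro!: continuous_intros)
    next
      show "continuous_on (ball v s \<times> cbox 0 1) (\<lambda>(y, t::real). grad ?g (of_real t * u, y) $ 2)"
        unfolding case_prod_unfold
        using segV
        by (intro continuous_on_compose2[OF cg2]) (auto intro!: continuous_intros)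
    qed simp
    then show "(\<lambda>y. ?e (u, y)) field_differentiable at v"
      by (rule holomorphic_on_imp_differentiable_at) (use s(1) in simp_all)
  qed
qed

lemma grad_cong:
  assumes "holomorphic2_on f S" "open S" "\<And>b. b \<in> S \<Longrightarrow> g b = f b" "b \<in> S"
  shows "grad g b $ 1 = grad f b $ 1" "grad g b $ 2 = grad f b $ 2"
proof -
  have "(g has_derivative (\<lambda>(s, t). grad f b $ 1 * s + grad f b $ 2 * t)) (at b)"
    by (rule has_derivative_transform_within_open
        [OF holomorphic2_on_has_derivative_grad[OF assms(1,4)] assms(2,4)]) (simp add: assms(3))
  from grad_of_has_derivative[of g _ _ "fst b" "snd b", unfolded prod.collapse, OF this]
  show "grad g b $ 1 = grad f b $ 1" "grad g b $ 2 = grad f b $ 2" .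
qed

lemma grad_mult:
  assumes "holomorphic2_on f S" "holomorphic2_on g S" "b \<in> S"
  shows "grad (\<lambda>b. f b * g b) b $ 1 = f b * grad g b $ 1 + grad f b $ 1 * g b"
    and "grad (\<lambda>b. f b * g b) b $ 2 = f b * grad g b $ 2 + grad f b $ 2 * g b"
proof -
  have "((\<lambda>b. f b * g b) has_derivative
      (\<lambda>(s, t). (f b * grad g b $ 1 + grad f b $ 1 * g b) * s
        + (f b * grad g b $ 2 + grad f b $ 2 * g b) * t)) (at b)"
    by (rule has_derivative_eq_rhs[OF has_derivative_mult
          [OF assms(1,2)[THEN holomorphic2_on_has_derivative_grad, OF assms(3)]]])
      (auto simp: algebra_simps)
  from grad_of_has_derivative[of "\<lambda>b. f b * g b" _ _ "fst b" "snd b", unfolded prod.collapse, OF this]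
  show "grad (\<lambda>b. f b * g b) b $ 1 = f b * grad g b $ 1 + grad f b $ 1 * g b"
    "grad (\<lambda>b. f b * g b) b $ 2 = f b * grad g b $ 2 + grad f b $ 2 * g b" .
qed

lemma grad_fst_power:
  "grad (\<lambda>b. fst b ^ Suc n) b $ 1 = of_nat (Suc n) * fst b ^ n"
  "grad (\<lambda>b. fst b ^ Suc n) b $ 2 = 0"
proof -
  have "((\<lambda>b. fst b ^ Suc n) has_derivative (\<lambda>(s, t). of_nat (Suc n) * fst b ^ n * s + 0 * t)) (at b)"
    by (rule has_derivative_eq_rhs[OF has_derivative_power[OF has_derivative_fst[OF has_derivative_ident]]])
      (auto simp: algebra_simps)
  from grad_of_has_derivative[of "\<lambda>b. fst b ^ Suc n" _ _ "fst b" "snd b", unfolded prod.collapse, OF this]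
  show "grad (\<lambda>b. fst b ^ Suc n) b $ 1 = of_nat (Suc n) * fst b ^ n"
    "grad (\<lambda>b. fst b ^ Suc n) b $ 2 = 0" .
qed

definition wedge :: "complex^2 \<Rightarrow> complex^2 \<Rightarrow> complex" where
  "wedge x y = x $ 1 * y $ 2 - x $ 2 * y $ 1"

text \<open>The determinant of the vectors \<open>(f, \<partial>f/\<partial>u, \<partial>f/\<partial>v)\<close> of three functions. For forms of equal
  weight it is the Jacobian of the map to the projective plane in homogeneous coordinates.\<close>

definition jac :: "(complex \<times> complex \<Rightarrow> complex) \<Rightarrow> (complex \<times> complex \<Rightarrow> complex)
    \<Rightarrow> (complex \<times> complex \<Rightarrow> complex) \<Rightarrow> complex \<times> complex \<Rightarrow> complex" where
  "jac f g h b = f b * wedge (grad g b) (grad h b) + g b * wedge (grad h b) (grad f b)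
    + h b * wedge (grad f b) (grad g b)"

lemma holomorphic2_on_jac:
  assumes "holomorphic2_on f ball2" "holomorphic2_on g ball2" "holomorphic2_on h ball2"
  shows "holomorphic2_on (jac f g h) ball2"
  unfolding jac_def[abs_def] wedge_def
  by (intro holomorphic2_intros holomorphic2_on_grad_1 holomorphic2_on_grad_2 open_ball2 assms)

lemma zero_v_in_ball2: "(0, v) \<in> ball2 \<longleftrightarrow> Re v < 0"
  by (simp add: ball2_def)

lemma holomorphic_on_mirror:
  assumes "holomorphic2_on f ball2"
  shows "(\<lambda>v. f (0, v)) holomorphic_on {v. Re v < 0}"
proof -
  have "((\<lambda>v. f (0, v)) has_field_derivative grad f (0, v) $ 2) (at v)" if "Re v < 0" for v
    using that by (intro holomorphic2_on_slices(2)[OF assms]) (simp add: zero_v_in_ball2)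
  then show ?thesis
    unfolding holomorphic_on_def field_differentiable_def
    by (meson has_field_derivative_at_within mem_Collect_eq)
qed

text \<open>The point \<open>(1, -1)\<close> of the ball lies off the mirror.\<close>

lemma fst_power_cancel:
  assumes "holomorphic2_on f ball2" "\<And>b. b \<in> ball2 \<Longrightarrow> fst b ^ n * f b = 0" "b \<in> ball2"
  shows "f b = 0"
proof (rule holomorphic2_product_zero[OF _ assms(1,2) _ _ assms(3), of "(1, -1)"])
  show "holomorphic2_on (\<lambda>b. fst b ^ n) ball2" by (intro holomorphic2_intros)
qed (simp_all add: ball2_def)

text \<open>If \<open>f = u\<^sup>m e\<close> with \<open>m > 0\<close>, then the Jacobian is \<open>u\<^sup>m\<^sup>-\<^sup>1\<close> times a function whose value on the mirror
  \<open>u = 0\<close> is, up to sign, \<open>m e\<close> times the Wronskian of \<open>g\<close> and \<open>h\<close> along the mirror. If the Jacobian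
  vanishes identically, so does \<open>e\<close> on the mirror, and \<open>u\<^sup>m\<^sup>+\<^sup>1\<close> divides \<open>f\<close>. A function divisible by all
  powers of \<open>u\<close> is zero.\<close>

lemma jac_zero_imp_zero:
  assumes hol: "holomorphic2_on f ball2" "holomorphic2_on g ball2" "holomorphic2_on h ball2"
    and jac: "\<And>b. b \<in> ball2 \<Longrightarrow> jac f g h b = 0"
    and mirror: "\<And>v. (0, v) \<in> ball2 \<Longrightarrow> f (0, v) = 0"
    and nprop: "(0, v1) \<in> ball2" "(0, v2) \<in> ball2" "g (0, v1) * h (0, v2) \<noteq> g (0, v2) * h (0, v1)"
    and "b \<in> ball2"
  shows "f b = 0"
proof -
  have divisible: "\<exists>e. holomorphic2_on e ball2 \<and> (\<forall>(u, v)\<in>ball2. f (u, v) = u ^ Suc n * e (u, v))" for n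
  proof (induction n)
    case 0
    obtain e where "holomorphic2_on e ball2" "\<And>u v. (u, v) \<in> ball2 \<Longrightarrow> f (u, v) = u * e (u, v)"
      using divide_by_fst[OF hol(1) mirror] by blast
    then show ?case by (intro exI[of _ e]) auto
  next
    case (Suc n)
    then obtain e where e: "holomorphic2_on e ball2"
      and f_eq: "\<And>b. b \<in> ball2 \<Longrightarrow> f b = fst b ^ Suc n * e b" by fastforce
    have pow: "holomorphic2_on (\<lambda>b. fst b ^ Suc n) ball2" by (intro holomorphic2_intros)
    have grad_f: "grad f b $ 1 = fst b ^ n * (of_nat (Suc n) * e b + fst b * grad e b $ 1)"
      "grad f b $ 2 = fst b ^ n * (fst b * grad e b $ 2)" if "b \<in> ball2" for b
      using grad_cong[OF holomorphic2_on_mult[OF pow e] open_ball2 f_eq that]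
        grad_mult[OF pow e that] grad_fst_power[of n b]
      by (simp_all add: algebra_simps)
    \<comment> \<open>the Jacobian divided by the power of \<open>u\<close>\<close>
    define l where "l = (\<lambda>b. fst b * e b * wedge (grad g b) (grad h b)
      + g b * (grad h b $ 1 * (fst b * grad e b $ 2)
          - grad h b $ 2 * (of_nat (Suc n) * e b + fst b * grad e b $ 1))
      + h b * ((of_nat (Suc n) * e b + fst b * grad e b $ 1) * grad g b $ 2
          - fst b * grad e b $ 2 * grad g b $ 1))"
    have "holomorphic2_on l ball2"
      unfolding l_def wedge_def
      by (intro holomorphic2_intros holomorphic2_on_grad_1 holomorphic2_on_grad_2 open_ball2 hol e)
    moreover have "fst b ^ n * l b = 0" if "b \<in> ball2" for b
      using jac[OF that] unfolding jac_def l_def wedge_def grad_f[OF that] f_eq[OF that]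
      by (simp add: algebra_simps)
    ultimately have l_zero: "l b = 0" if "b \<in> ball2" for b
      using fst_power_cancel that by blast
    define W where "W = (\<lambda>b. h b * grad g b $ 2 - g b * grad h b $ 2)"
    have W: "holomorphic2_on W ball2"
      unfolding W_def by (intro holomorphic2_intros holomorphic2_on_grad_2 open_ball2 hol)
    have We: "W (0, v) * e (0, v) = 0" if "v \<in> {v. Re v < 0}" for v
    proof -
      have "of_nat (Suc n) * (W (0, v) * e (0, v)) = l (0, v)"
        by (simp add: l_def W_def algebra_simps)
      also have "\<dots> = 0" using l_zero that by (simp add: zero_v_in_ball2)
      finally show ?thesis by (simp del: of_nat_Suc)
    qed
    have H: "open {v. Re v < 0}" "connected {v. Re v < 0}"
      by (auto simp: open_halfspace_Re_lt convex_halfspace_Re_lt intro: convex_connected)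
    have "\<exists>v0. Re v0 < 0 \<and> W (0, v0) \<noteq> 0"
    proof (rule ccontr)
      assume "\<not> ?thesis"
      then have W0: "W (0, v) = 0" if "Re v < 0" for v using that by blast
      have "deriv (\<lambda>v. k (0, v)) v = grad k (0, v) $ 2" for k :: "complex \<times> complex \<Rightarrow> complex" and v
        by (simp add: grad_def)
      then have "g (0, v1) * h (0, v2) = g (0, v2) * h (0, v1)"
        using W0 nprop(1,2)
        by (intro proportional_of_Wronskian_zero[OF holomorphic_on_mirror[OF hol(2)]
              holomorphic_on_mirror[OF hol(3)] H])
          (auto simp: W_def zero_v_in_ball2 mult.commute)
      then show False using nprop(3) by simp
    qed
    then obtain v0 where v0: "Re v0 < 0" "W (0, v0) \<noteq> 0" by blast
    have "e (0, v) = 0" if "(0, v) \<in> ball2" for v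
      using holomorphic_product_zero[OF holomorphic_on_mirror[OF W] holomorphic_on_mirror[OF e] H We,
          of v0 v] v0 that by (simp add: zero_v_in_ball2)
    then obtain e' where "holomorphic2_on e' ball2" "\<And>u v. (u, v) \<in> ball2 \<Longrightarrow> e (u, v) = u * e' (u, v)"
      using divide_by_fst[OF e] by blast
    then show ?case using f_eq by (intro exI[of _ e']) (auto simp: mult_ac)
  qed
  obtain u v where b: "b = (u, v)" by (cases b)
  show ?thesis
  proof (rule ccontr)
    assume nz: "f b \<noteq> 0"
    let ?Z = "line_dom (0, v) (1, v)"
    have line: "line (0, v) (1, v) z = (z, v)" for z by (simp add: line_def)
    have "2 * Re v + (cmod u)\<^sup>2 < 0" using \<open>b \<in> ball2\<close> by (simp add: b ball2_def)
    moreover have "(cmod u)\<^sup>2 \<ge> 0" by simp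
    ultimately have "Re v < 0" by linarith
    then have "(0, v) \<in> ball2" by (simp add: zero_v_in_ball2)
    then have Z: "0 \<in> ?Z" "u \<in> ?Z" using \<open>b \<in> ball2\<close> by (simp_all add: line_dom_def line b)
    let ?F = "\<lambda>z. f (z, v)"
    have F: "?F holomorphic_on ?Z" "?F 0 = 0"
      using holomorphic_on_line[OF hol(1), of "(0, v)" "(1, v)"] mirror \<open>(0, v) \<in> ball2\<close>
      by (simp_all add: line)
    have "\<not> ?F constant_on ?Z"
      using F(2) nz Z unfolding constant_on_def b by metis
    then obtain g r n where g: "0 < n" "0 < r" "ball 0 r \<subseteq> ?Z" "g holomorphic_on ball 0 r"
        "\<And>w. w \<in> ball 0 r \<Longrightarrow> ?F w = (w - 0) ^ n * g w" "\<And>w. w \<in> ball 0 r \<Longrightarrow> g w \<noteq> 0"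
      using holomorphic_factor_zero_nonconstant[OF F(1) open_line_dom connected_line_dom Z(1) F(2)]
      by metis
    from divisible[of n] obtain e where e: "holomorphic2_on e ball2"
      "\<And>u v. (u, v) \<in> ball2 \<Longrightarrow> f (u, v) = u ^ Suc n * e (u, v)" by fast
    have e_hol: "(\<lambda>z. e (z, v)) holomorphic_on ball 0 r"
      using holomorphic_on_line[OF e(1), of "(0, v)" "(1, v)"] g(3)
      by (auto simp: line intro: holomorphic_on_subset)
    have "g 0 - 0 * e (0, v) = 0"
    proof (rule holomorphic_product_zero[of "\<lambda>w. w ^ n" "ball 0 r" "\<lambda>w. g w - w * e (w, v)"
          "of_real (r / 2)" 0])
      show "w ^ n * (g w - w * e (w, v)) = 0" if "w \<in> ball 0 r" for w
      proof -
        have "(w, v) \<in> ball2" using that g(3) by (auto simp: line_dom_def line)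
        then show ?thesis using g(5)[OF that] e(2)[of w v] by (auto simp: algebra_simps)
      qed
    qed (use g(2) in \<open>auto intro!: holomorphic_intros g(4) e_hol\<close>)
    then show False using g(2,6) by simp
  qed
qed

section \<open>Linear algebra of binary cubic forms\<close>

text \<open>The row \<open>i\<close> lists the coefficients of the binary form \<open>(a x + b y)\<^sup>3\<^sup>-\<^sup>i (c x + d y)\<^sup>i\<close>. The explicit
  entries show that the symmetric cube depends polynomially on the matrix.\<close>

definition sym3 :: "complex^2^2 \<Rightarrow> nat \<Rightarrow> nat \<Rightarrow> complex" where
  "sym3 A i m = (let a = A$1$1; b = A$1$2; c = A$2$1; d = A$2$2 in
     if i \<le> 3 \<and> m \<le> 3 then
       [[a^3, 3 * a^2 * b, 3 * a * b^2, b^3],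
        [a^2 * c, a^2 * d + 2 * a * b * c, 2 * a * b * d + b^2 * c, b^2 * d],
        [a * c^2, 2 * a * c * d + b * c^2, a * d^2 + 2 * b * c * d, b * d^2],
        [c^3, 3 * c^2 * d, 3 * c * d^2, d^3]] ! i ! m
     else 0)"

lemma sum_atMost_3: "(\<Sum>m\<le>(3::nat). f m) = f 0 + f 1 + f 2 + f 3"
  by (simp add: eval_nat_numeral)

lemma nat_le_3_cases:
  assumes "i \<le> (3::nat)"
  obtains "i = 0" | "i = 1" | "i = 2" | "i = 3"
proof -
  have "i = 0 \<or> i = 1 \<or> i = 2 \<or> i = 3" using assms by presburger
  then show thesis using that by blast
qed

lemma symm_3_eq: "symm 3 A = sym3 A"
proof -
  have "(\<Sum>m\<le>3. sym3 A i m * symv 3 x m) = symv 3 (A *v x) i" for x i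
  proof (cases "i \<le> 3")
    case True
    define a b c d s t where "a = A$1$1" and "b = A$1$2" and "c = A$2$1" and "d = A$2$2"
      and "s = x$1" and "t = x$2"
    note abcd = this
    have x: "symv 3 x 0 = s^3" "symv 3 x 1 = s^2 * t" "symv 3 x 2 = s * t^2" "symv 3 x 3 = t^3"
      by (simp_all add: symv_def s_def t_def)
    have Ax: "symv 3 (A *v x) 0 = (a * s + b * t)^3" "symv 3 (A *v x) 1 = (a * s + b * t)^2 * (c * s + d * t)"
      "symv 3 (A *v x) 2 = (a * s + b * t) * (c * s + d * t)^2" "symv 3 (A *v x) 3 = (c * s + d * t)^3"
      by (simp_all add: symv_def matrix_vector_mult_def sum_2 abcd)
    from True show ?thesis
      by (cases rule: nat_le_3_cases; hypsubst; unfold sum_atMost_3 x Ax sym3_def Let_def)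
        (simp_all add: power2_eq_square power3_eq_cube algebra_simps flip: abcd)
  next
    case False
    then show ?thesis by (simp add: sym3_def symv_def)
  qed
  then have "is_symm 3 A (sym3 A)"
    by (auto simp: is_symm_def sym3_def)
  then show ?thesis
    unfolding symm_def by (rule the1_equality[OF ex1_symm])
qed

lemma symm_symv: "(\<Sum>m\<le>j. symm j A i m * symv j x m) = symv j (A *v x) i"
  using is_symm_symm[of j A] by (simp add: is_symm_def)

lemma symv_scale: "symv j (c *s x) i = c ^ j * symv j x i"
proof (cases "i \<le> j")
  case True
  then have "c ^ j = c ^ (j - i) * c ^ i" by (simp flip: power_add)
  then show ?thesis by (simp add: symv_def power_mult_distrib)
qed (simp add: symv_def)

text \<open>The Laplace expansion along the first two of four vectors with the entries \<open>0, 1, 2, 3\<close>.\<close>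

definition det4 :: "(nat \<Rightarrow> complex) \<Rightarrow> (nat \<Rightarrow> complex) \<Rightarrow> (nat \<Rightarrow> complex) \<Rightarrow> (nat \<Rightarrow> complex) \<Rightarrow> complex"
  where
  "det4 F G H K = (let m = (\<lambda>i j. F i * G j - F j * G i); n = (\<lambda>i j. H i * K j - H j * K i) in
     m 0 1 * n 2 3 - m 0 2 * n 1 3 + m 0 3 * n 1 2 + m 1 2 * n 0 3 - m 1 3 * n 0 2 + m 2 3 * n 0 1)"

lemma det4_cramer:
  assumes "i \<le> 3"
  shows "det4 A B C D * F i = det4 F B C D * A i + det4 A F C D * B i
    + det4 A B F D * C i + det4 A B C F * D i"
proof -
  from assms show ?thesis
  proof (cases rule: nat_le_3_cases)
    case 1
    show ?thesis unfolding 1 det4_def Let_def by (simp add: algebra_simps)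
  next
    case 2
    show ?thesis unfolding 2 det4_def Let_def by (simp add: algebra_simps)
  next
    case 3
    show ?thesis unfolding 3 det4_def Let_def by (simp add: algebra_simps)
  next
    case 4
    show ?thesis unfolding 4 det4_def Let_def by (simp add: algebra_simps)
  qed
qed

text \<open>The homogeneous Vandermonde determinant.\<close>

lemma det4_symv:
  "det4 (symv 3 w) (symv 3 x) (symv 3 y) (symv 3 z) =
    wedge w x * wedge w y * wedge w z * wedge x y * wedge x z * wedge y z"
  by (simp add: det4_def Let_def symv_def wedge_def power2_eq_square power3_eq_cube algebra_simps)

lemma det4_scale:
  "det4 (\<lambda>i. a * F i) (\<lambda>i. b * G i) (\<lambda>i. c * H i) (\<lambda>i. d * K i) = a * b * c * d * det4 F G H K"
  by (simp add: det4_def Let_def algebra_simps)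

text \<open>By Cramer's rule four independent vectors fixed by a linear map span everything.\<close>

lemma fixed_imp_identity_or_det4_zero:
  assumes fixed: "\<And>V i. V \<in> {A, B, C, D} \<Longrightarrow> i \<le> 3 \<Longrightarrow> (\<Sum>m\<le>3. S i m * V m) = V i"
    and "det4 A B C D \<noteq> 0" and "i \<le> 3"
  shows "(\<Sum>m\<le>3. S i m * F m) = F i"
proof -
  have "det4 A B C D * (\<Sum>m\<le>3. S i m * F m) = (\<Sum>m\<le>3. S i m * (det4 A B C D * F m))"
    by (simp add: sum_distrib_left mult_ac)
  also have "\<dots> = (\<Sum>m\<le>3. S i m * (det4 F B C D * A m + det4 A F C D * B m
    + det4 A B F D * C m + det4 A B C F * D m))"
    by (intro sum.cong refl, subst det4_cramer) auto
  also have "\<dots> = det4 F B C D * (\<Sum>m\<le>3. S i m * A m) + det4 A F C D * (\<Sum>m\<le>3. S i m * B m)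
    + det4 A B F D * (\<Sum>m\<le>3. S i m * C m) + det4 A B C F * (\<Sum>m\<le>3. S i m * D m)"
    by (simp add: sum_distrib_left sum.distrib algebra_simps)
  also have "\<dots> = det4 A B C D * F i"
    unfolding det4_cramer[OF assms(3), of A B C D F] using assms(3) by (simp add: fixed)
  finally show ?thesis using assms(2) by simp
qed

text \<open>A symmetric cube can be the identity only for a scalar matrix.\<close>

lemma det4_fixed_by_symm:
  assumes fixed: "\<And>V i. V \<in> {F, G, H, K} \<Longrightarrow> i \<le> 3 \<Longrightarrow> (\<Sum>m\<le>3. symm 3 A i m * V m) = V i"
    and A: "\<And>p. A \<noteq> mat p"
  shows "det4 F G H K = 0"
proof (rule ccontr)
  assume nz: "det4 F G H K \<noteq> 0"
  have eq: "symv 3 (A *v x) i = symv 3 x i" if "i \<le> 3" for x i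
    using fixed_imp_identity_or_det4_zero[OF fixed nz that, of "symv 3 x"]
    by (simp add: symm_symv)
  define a b c d where "a = A$1$1" and "b = A$1$2" and "c = A$2$1" and "d = A$2$2"
  have ex: "A *v vector [x, y] = vector [a * x + b * y, c * x + d * y]" for x y
    by (simp add: vec_eq_iff forall_2 matrix_vector_mult_def sum_2 a_def b_def c_def d_def)
  from eq[of 0 "vector [1, 0]"] eq[of 1 "vector [1, 0]"] have "a ^ 3 = 1" "a\<^sup>2 * c = 0"
    by (simp_all add: ex symv_def)
  then have c: "c = 0" "a \<noteq> 0" by auto
  from eq[of 3 "vector [0, 1]"] eq[of 2 "vector [0, 1]"] have "d ^ 3 = 1" "b * d\<^sup>2 = 0"
    by (simp_all add: ex symv_def)
  then have b: "b = 0" by auto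
  from eq[of 1 "vector [1, 1]"] have "a\<^sup>2 * d = 1"
    by (simp add: ex symv_def b c)
  then have "a\<^sup>2 * (d - a) = 0"
    using \<open>a ^ 3 = 1\<close> by (simp add: algebra_simps power2_eq_square power3_eq_cube)
  then have "d = a" using c by simp
  then have "A = mat a"
    using b c by (simp add: vec_eq_iff forall_2 mat_def a_def b_def c_def d_def)
  then show False using A by blast
qed

lemma matrix_inv_eq:
  fixes A B :: "complex^'n^'n"
  assumes "A ** B = mat 1" "B ** A = mat 1"
  shows "matrix_inv A = B"
proof -
  have "A ** matrix_inv A = mat 1 \<and> matrix_inv A ** A = mat 1"
    unfolding matrix_inv_def by (rule someI[of _ B]) (use assms in blast)
  then show ?thesis
    using assms(2) by (metis matrix_mul_assoc matrix_mul_lid matrix_mul_rid)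
qed

lemma matrix_inv_2:
  fixes A :: "complex^2^2"
  assumes "det A \<noteq> 0"
  shows "matrix_inv A = vector [vector [A$2$2 / det A, - A$1$2 / det A], vector [- A$2$1 / det A, A$1$1 / det A]]"
    (is "_ = ?B")
proof -
  have "?B ** A = mat 1"
    using assms
    by (simp add: vec_eq_iff forall_2 matrix_matrix_mult_def sum_2 mat_def divide_simps)
      (simp add: det_2 algebra_simps)
  moreover have "A ** ?B = mat 1"
    using assms
    by (simp add: vec_eq_iff forall_2 matrix_matrix_mult_def sum_2 mat_def divide_simps)
      (simp add: det_2 algebra_simps)
  ultimately show ?thesis by (rule matrix_inv_eq[rotated])
qed

section \<open>Eisenstein integers and the group\<close>

lemma Re_rho: "Re rho = - 1 / 2" and Im_rho: "Im rho = sqrt 3 / 2"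
  by (simp_all add: rho_def)

lemma rho_sq: "rho * rho = - 1 - rho"
  by (simp add: complex_eq_iff Re_rho Im_rho)

lemma cnj_rho: "cnj rho = - 1 - rho"
  by (simp add: complex_eq_iff Re_rho Im_rho)

lemma rho_cubed: "rho ^ 3 = 1"
proof -
  have "rho ^ 3 = rho * (rho * rho)" by (simp add: power3_eq_cube)
  also have "\<dots> = rho * (- 1 - rho)" unfolding rho_sq ..
  also have "\<dots> = - rho - rho * rho" by (simp only: right_diff_distrib) simp
  also have "\<dots> = 1" unfolding rho_sq by simp
  finally show ?thesis .
qed

lemma rho_neq_1: "rho \<noteq> 1"
  by (simp add: complex_eq_iff Re_rho)

lemma sqrt_m3_eq: "sqrt_m3 = 1 + 2 * rho"
  by (simp add: complex_eq_iff Re_rho Im_rho sqrt_m3_def)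

lemma O_F_of_int: "of_int n \<in> O_F"
  unfolding O_F_def by (rule CollectI, rule exI[of _ n], rule exI[of _ 0]) simp

lemma O_F_rho: "rho \<in> O_F"
  unfolding O_F_def by (rule CollectI, rule exI[of _ 0], rule exI[of _ 1]) simp

lemma O_F_add: "x \<in> O_F \<Longrightarrow> y \<in> O_F \<Longrightarrow> x + y \<in> O_F"
proof -
  assume "x \<in> O_F" "y \<in> O_F"
  then obtain a b c d where "x = of_int a + of_int b * rho" "y = of_int c + of_int d * rho"
    by (auto simp: O_F_def)
  then have "x + y = of_int (a + c) + of_int (b + d) * rho" by (simp add: algebra_simps)
  then show ?thesis unfolding O_F_def by blast
qed

lemma O_F_mult: "x \<in> O_F \<Longrightarrow> y \<in> O_F \<Longrightarrow> x * y \<in> O_F"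
proof -
  assume "x \<in> O_F" "y \<in> O_F"
  then obtain a b c d where xy: "x = of_int a + of_int b * rho" "y = of_int c + of_int d * rho"
    by (auto simp: O_F_def)
  have "x * y = of_int a * of_int c + (of_int a * of_int d + of_int b * of_int c) * rho
      + of_int b * of_int d * (rho * rho)"
    by (simp add: xy algebra_simps)
  also have "\<dots> = of_int (a * c - b * d) + of_int (a * d + b * c - b * d) * rho"
    unfolding rho_sq by (simp add: algebra_simps)
  finally show ?thesis unfolding O_F_def by blast
qed

lemma O_F_numerals: "0 \<in> O_F" "1 \<in> O_F" "numeral n \<in> O_F"
  using O_F_of_int[of 0] O_F_of_int[of 1] O_F_of_int[of "numeral n"] by simp_all

lemma O_F_minus: "x \<in> O_F \<Longrightarrow> - x \<in> O_F"
  using O_F_mult[OF O_F_of_int[of "-1"]] by simp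

lemma O_F_diff: "x \<in> O_F \<Longrightarrow> y \<in> O_F \<Longrightarrow> x - y \<in> O_F"
  using O_F_add[OF _ O_F_minus] by simp

lemma O_F_cnj: "x \<in> O_F \<Longrightarrow> cnj x \<in> O_F"
proof -
  assume "x \<in> O_F"
  then obtain a b where "x = of_int a + of_int b * rho" by (auto simp: O_F_def)
  then have "cnj x = of_int (a - b) + of_int (- b) * rho" by (simp add: cnj_rho algebra_simps)
  then show ?thesis unfolding O_F_def by blast
qed

lemmas O_F_intros = O_F_add O_F_mult O_F_minus O_F_diff O_F_numerals O_F_rho O_F_cnj O_F_of_int

text \<open>A unit of \<open>O_F\<close> has norm \<open>1\<close>, so it is a sixth root of unity.\<close>

lemma O_F_unit_power_6:
  assumes "x \<in> O_F" "y \<in> O_F" "x * y = 1"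
  shows "x ^ 6 = 1"
proof -
  obtain a b where x: "x = of_int a + of_int b * rho" using assms(1) by (auto simp: O_F_def)
  obtain c d where y: "y = of_int c + of_int d * rho" using assms(2) by (auto simp: O_F_def)
  have norm: "(of_int s + of_int t * rho) * cnj (of_int s + of_int t * rho)
      = of_int (s * s - s * t + t * t)" for s t
  proof -
    have "(of_int s + of_int t * rho) * cnj (of_int s + of_int t * rho)
        = of_int s * of_int s - of_int s * of_int t - of_int t * of_int t * (rho * rho + rho)"
      by (simp add: cnj_rho algebra_simps)
    then show ?thesis unfolding rho_sq by simp
  qed
  have "of_int ((a * a - a * b + b * b) * (c * c - c * d + d * d)) = (x * y) * cnj (x * y)"
    unfolding of_int_mult[of "a * a - a * b + b * b"] norm[symmetric] x y by simp
  then have "(a * a - a * b + b * b) * (c * c - c * d + d * d) = 1"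
    unfolding assms(3) by (metis complex_cnj_one mult_1 of_int_1 of_int_eq_iff)
  moreover have "0 \<le> a * a - a * b + b * b"
  proof -
    have "0 \<le> (2 * a - b) * (2 * a - b) + 3 * (b * b)" by simp
    then show ?thesis by (simp add: algebra_simps)
  qed
  ultimately have n: "a * a - a * b + b * b = 1"
    by (metis abs_of_nonneg dvd_triv_left zdvd1_eq)
  have le1: "t \<in> {-1, 0, 1}" if "s * s - s * t + t * t = 1" for s t :: int
  proof -
    have "3 * (t * t) = 4 - (2 * s - t) * (2 * s - t)"
      using that by (simp add: algebra_simps)
    also have "\<dots> \<le> 4" by simp
    finally have "t * t \<le> 1" by simp
    then have "\<bar>t\<bar> * \<bar>t\<bar> \<le> 1" by simp
    then have "\<not> \<bar>t\<bar> \<ge> 2"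
      using mult_mono[of 2 "\<bar>t\<bar>" 2 "\<bar>t\<bar>"] by auto
    then show ?thesis by auto
  qed
  have "a \<in> {-1, 0, 1}" "b \<in> {-1, 0, 1}"
    using le1[of a b] le1[of b a] n by (simp_all add: algebra_simps)
  moreover have z: "rho + (1 + rho * rho) = 0" by (simp add: rho_sq)
  ultimately consider "x * x = 1" | "x * x = rho * rho" | "x * x = rho"
    using n x rho_sq by (auto simp: algebra_simps) (use z in blast)+
  then show ?thesis
  proof cases
    case 1
    then show ?thesis by (simp add: eval_nat_numeral)
  next
    case 2
    have "x ^ 6 = (x * x) ^ 3" by (simp add: eval_nat_numeral)
    also have "\<dots> = rho ^ 3 * rho ^ 3" unfolding 2 by (simp add: power_mult_distrib)
    finally show ?thesis by (simp add: rho_cubed)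
  next
    case 3
    have "x ^ 6 = (x * x) ^ 3" by (simp add: eval_nat_numeral)
    then show ?thesis unfolding 3 by (simp add: rho_cubed)
  qed
qed

lemma O_F_det: "(\<And>i j. g$i$j \<in> O_F) \<Longrightarrow> det g \<in> O_F" for g :: "complex^3^3"
  unfolding det_3 by (intro O_F_intros)

lemma det_Gam:
  assumes "g \<in> Gam"
  shows "det g ^ 6 = 1" "det g \<noteq> 0"
proof -
  obtain g' where g: "\<And>i j. g$i$j \<in> O_F" and g': "\<And>i j. g'$i$j \<in> O_F" "g ** g' = mat 1"
    using assms by (auto simp: Gam_def GL3_OF_def)
  have "det g * det g' = 1"
    using g'(2) by (metis det_I det_mul)
  then show "det g ^ 6 = 1"
    using O_F_unit_power_6[OF O_F_det[OF g] O_F_det[OF g'(1)]] by blast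
  then show "det g \<noteq> 0" by auto
qed

section \<open>The action on the ball\<close>

definition homog :: "complex \<times> complex \<Rightarrow> complex^3" where
  "homog b = vector [snd b, 1, fst b]"

lemma homog_nth [simp]: "homog b $ 1 = snd b" "homog b $ 2 = 1" "homog b $ 3 = fst b"
  by (simp_all add: homog_def)

lemma homog_eq_iff: "homog b = homog c \<longleftrightarrow> b = c"
  by (auto simp: vec_eq_iff forall_3 prod_eq_iff)

lemma ball2_iff_herm: "b \<in> ball2 \<longleftrightarrow> Re (herm (homog b) (homog b)) < 0"
  by (cases b) (simp add: ball2_def herm_def cmod_power2 flip: power2_eq_square)

lemma mult_homog_2: "(g *v homog b) $ 2 = j1 g b"
  by (cases b) (simp add: j1_def matrix_vector_mult_def sum_3)

lemma j1_eq: "j1 g b = g$2$1 * snd b + g$2$2 + g$2$3 * fst b"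
  by (cases b) (simp add: j1_def)

lemma act_eq:
  "fst (act g b) = (g$3$1 * snd b + g$3$2 + g$3$3 * fst b) / j1 g b"
  "snd (act g b) = (g$1$1 * snd b + g$1$2 + g$1$3 * fst b) / j1 g b"
  by (cases b; simp add: act_def)+

lemma homog_act:
  assumes "g \<in> Gam" "b \<in> ball2"
  shows "g *v homog b = j1 g b *s homog (act g b)"
  using j1_neq_0[OF assms]
  by (simp add: vec_eq_iff forall_3 mult_homog_2 act_eq) (simp add: matrix_vector_mult_def sum_3)

lemma herm_Gam: "g \<in> Gam \<Longrightarrow> herm (g *v z) (g *v w) = herm z w"
  by (simp add: Gam_def)

lemma herm_scale: "herm (c *s z) (d *s w) = c * cnj d * herm z w"
  by (simp add: herm_def algebra_simps)

lemma act_in_ball2: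
  assumes "g \<in> Gam" "b \<in> ball2"
  shows "act g b \<in> ball2"
proof -
  have "herm (homog b) (homog b) = j1 g b * cnj (j1 g b) * herm (homog (act g b)) (homog (act g b))"
    using herm_Gam[OF assms(1), of "homog b" "homog b"] by (simp add: homog_act[OF assms] herm_scale)
  then have "herm (homog b) (homog b) = of_real ((cmod (j1 g b))\<^sup>2) * herm (homog (act g b)) (homog (act g b))"
    by (simp add: complex_norm_square del: of_real_power)
  then have "Re (herm (homog b) (homog b)) = (cmod (j1 g b))\<^sup>2 * Re (herm (homog (act g b)) (homog (act g b)))"
    by simp
  then have "(cmod (j1 g b))\<^sup>2 * Re (herm (homog (act g b)) (homog (act g b))) < 0"
    using assms(2) by (simp add: ball2_iff_herm)
  then show ?thesis by (simp add: ball2_iff_herm mult_less_0_iff not_less[symmetric])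
qed

lemma act_inverse:
  assumes "g \<in> Gam" "h \<in> Gam" "h ** g = mat 1" "b \<in> ball2"
  shows "act h (act g b) = b" "j1 h (act g b) * j1 g b = 1"
proof -
  have "homog b = h *v (g *v homog b)"
    using assms(3) by (simp add: matrix_vector_mul_assoc)
  also have "\<dots> = (j1 g b * j1 h (act g b)) *s homog (act h (act g b))"
    by (simp add: homog_act assms act_in_ball2 matrix_vector_mult_scaleR vector_scalar_commute
        vector_smult_assoc)
  finally have *: "homog b = (j1 g b * j1 h (act g b)) *s homog (act h (act g b))" .
  from arg_cong[OF this, of "\<lambda>x. x $ 2"] show 1: "j1 h (act g b) * j1 g b = 1"
    by (simp add: mult.commute)
  with * have "homog b = homog (act h (act g b))"
    by (simp add: mult.commute)
  then show "act h (act g b) = b" by (simp add: homog_eq_iff)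
qed

lemma holomorphic2_on_j1: "holomorphic2_on (j1 g) S"
  unfolding j1_eq[abs_def] by (intro holomorphic2_intros)

lemma holomorphic2_on_act:
  assumes "g \<in> Gam"
  shows "holomorphic2_on (\<lambda>b. fst (act g b)) ball2" "holomorphic2_on (\<lambda>b. snd (act g b)) ball2"
  unfolding act_eq by (intro holomorphic2_intros holomorphic2_on_j1; use j1_neq_0[OF assms] in blast)+

lemma holomorphic2_on_compose_act:
  assumes "g \<in> Gam" "holomorphic2_on f ball2"
  shows "holomorphic2_on (\<lambda>b. f (act g b)) ball2"
  using holomorphic2_on_compose[OF assms(2) holomorphic2_on_act[OF assms(1)]]
  by (simp add: act_in_ball2[OF assms(1)])

section \<open>Factors of automorphy and transformation of brackets\<close>

lemma minor3_eqs:
  "minor3 g 3 2 = g$1$1 * g$2$3 - g$1$3 * g$2$1"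
  "minor3 g 3 3 = g$1$1 * g$2$2 - g$1$2 * g$2$1"
  "minor3 g 3 1 = g$1$2 * g$2$3 - g$1$3 * g$2$2"
  "minor3 g 1 2 = g$2$1 * g$3$3 - g$2$3 * g$3$1"
  "minor3 g 1 3 = g$2$1 * g$3$2 - g$2$2 * g$3$1"
  "minor3 g 1 1 = g$2$2 * g$3$3 - g$2$3 * g$3$2"
  by (simp_all add: minor3_def other_indices_def)

lemma j2_nth:
  "j2 g b $ 1 $ 1 = (minor3 g 3 2 * fst b + minor3 g 3 3) / det g"
  "j2 g b $ 1 $ 2 = (minor3 g 3 2 * snd b + minor3 g 3 1) / det g"
  "j2 g b $ 2 $ 1 = (minor3 g 1 2 * fst b + minor3 g 1 3) / det g"
  "j2 g b $ 2 $ 2 = (minor3 g 1 2 * snd b + minor3 g 1 1) / det g"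
  by (cases b; simp add: j2_def)+

text \<open>Up to powers of \<open>j1\<close> this evaluates the Jacobian determinant of the action.\<close>

lemma det_j2_identity:
  "(minor3 g 1 2 * v + minor3 g 1 1) * (minor3 g 3 2 * u + minor3 g 3 3)
    - (minor3 g 1 2 * u + minor3 g 1 3) * (minor3 g 3 2 * v + minor3 g 3 1)
    = (g$2$1 * v + g$2$2 + g$2$3 * u) * det g"
  unfolding minor3_eqs det_3 by (simp add: algebra_simps)

lemma det_j2:
  assumes "g \<in> Gam"
  shows "det (j2 g b) = j1 g b / det g"
proof -
  have "det (j2 g b) = ((minor3 g 1 2 * snd b + minor3 g 1 1) * (minor3 g 3 2 * fst b + minor3 g 3 3)
      - (minor3 g 1 2 * fst b + minor3 g 1 3) * (minor3 g 3 2 * snd b + minor3 g 3 1)) / (det g * det g)"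
    by (simp add: det_2 j2_nth diff_divide_distrib mult.commute)
  also have "\<dots> = j1 g b * det g / (det g * det g)"
    unfolding det_j2_identity j1_eq ..
  finally show ?thesis using det_Gam(2)[OF assms] by simp
qed

lemma det_j2_nonzero:
  assumes "g \<in> Gam" "b \<in> ball2"
  shows "det (j2 g b) \<noteq> 0"
  using j1_neq_0[OF assms] det_Gam(2)[OF assms(1)] by (simp add: det_j2[OF assms(1)])

lemma holomorphic2_on_symm_j2:
  assumes "g \<in> Gam"
  shows "holomorphic2_on (\<lambda>b. symm 3 (matrix_inv (j2 g b)) i m) ball2"
proof -
  have entry: "holomorphic2_on (\<lambda>b. matrix_inv (j2 g b) $ r $ s) ball2" for r s
  proof -
    have j2: "holomorphic2_on (\<lambda>b. j2 g b $ r $ s) ball2" for r s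
      using exhaust_2[of r] exhaust_2[of s] det_Gam(2)[OF assms]
      by (elim disjE) (simp_all only: j2_nth, (intro holomorphic2_intros; assumption)+)
    have det: "holomorphic2_on (\<lambda>b. det (j2 g b)) ball2"
      unfolding det_2 by (intro holomorphic2_intros j2)
    have "holomorphic2_on (\<lambda>b. (vector [vector [j2 g b $2$2 / det (j2 g b), - j2 g b $1$2 / det (j2 g b)],
        vector [- j2 g b $2$1 / det (j2 g b), j2 g b $1$1 / det (j2 g b)]] :: complex^2^2) $ r $ s) ball2"
      using exhaust_2[of r] exhaust_2[of s]
      by (elim disjE) (simp_all, (intro holomorphic2_intros det j2; use det_j2_nonzero[OF assms] in blast)+)
    then show ?thesis
      by (rule holomorphic2_on_cong[OF _ open_ball2])
        (simp add: matrix_inv_2[OF det_j2_nonzero[OF assms]])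
  qed
  show ?thesis
  proof (cases "i \<le> 3 \<and> m \<le> 3")
    case True
    then have "i \<le> 3" "m \<le> 3" by auto
    then show ?thesis
      unfolding symm_3_eq sym3_def Let_def
      by (elim nat_le_3_cases) (simp_all, (intro holomorphic2_intros entry)+)
  next
    case False
    then show ?thesis
      unfolding symm_3_eq sym3_def Let_def by (auto simp: holomorphic2_on_const)
  qed
qed

lemma j1_nonzero: "g \<in> Gam_sqrt \<Longrightarrow> b \<in> ball2 \<Longrightarrow> j1 g b \<noteq> 0"
  by (simp add: Gam_sqrt_def j1_neq_0)

lemma scalar_formD:
  assumes "f \<in> scalar_forms k"
  shows "holomorphic2_on f ball2" "b \<notin> ball2 \<Longrightarrow> f b = 0"
    and "g \<in> Gam_sqrt \<Longrightarrow> b \<in> ball2 \<Longrightarrow> f (act g b) = j1 g b powi k * f b"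
proof -
  have f: "scal f \<in> modular_forms 0 k" using assms by (simp add: scalar_forms_def)
  then have "holomorphic2_on (\<lambda>b. scal f b 0) ball2"
    unfolding modular_forms_def holo_maps_def by blast
  then show "holomorphic2_on f ball2" by (simp add: scal_def)
  show "f b = 0" if "b \<notin> ball2"
    using modular_forms_outside[OF f that, of 0] by (simp add: scal_def)
  show "f (act g b) = j1 g b powi k * f b" if g: "g \<in> Gam_sqrt" and b: "b \<in> ball2"
  proof -
    have "slash 0 k g (scal f) b 0 = scal f b 0"
      using f g by (simp add: modular_forms_def)
    then have "j1 g b powi (- k) * f (act g b) = f b"
      using b by (simp add: slash_def scal_def symm_0)
    moreover have "j1 g b \<noteq> 0"
      using g b by (rule j1_nonzero)
    ultimately show ?thesis by (simp add: power_int_minus field_simps)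
  qed
qed

lemma scalar_formI:
  assumes "holomorphic2_on f ball2" "\<And>b. b \<notin> ball2 \<Longrightarrow> f b = 0"
    and "\<And>g b. g \<in> Gam_sqrt \<Longrightarrow> b \<in> ball2 \<Longrightarrow> f (act g b) = j1 g b powi k * f b"
  shows "f \<in> scalar_forms k"
proof -
  have "slash 0 k g (scal f) = scal f" if g: "g \<in> Gam_sqrt" for g
  proof (intro ext)
    fix b i
    show "slash 0 k g (scal f) b i = scal f b i"
    proof (cases "b \<in> ball2")
      case True
      then have "j1 g b \<noteq> 0" using g by (intro j1_nonzero)
      then show ?thesis
        using True assms(3)[OF g True] by (simp add: slash_def scal_def symm_0 power_int_minus)
    qed (simp add: slash_def scal_def assms(2))
  qed
  moreover have "scal f \<in> holo_maps 0"
    using assms(1,2) by (auto simp: holo_maps_def scal_def)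
  ultimately show ?thesis by (simp add: scalar_forms_def modular_forms_def)
qed

lemma modular_formD:
  assumes "F \<in> modular_forms j k"
  shows "i \<le> j \<Longrightarrow> holomorphic2_on (\<lambda>b. F b i) ball2" "j < i \<Longrightarrow> F b i = 0"
    and "g \<in> Gam_sqrt \<Longrightarrow> b \<in> ball2 \<Longrightarrow>
      (\<Sum>m\<le>j. symm j (matrix_inv (j2 g b)) i m * F (act g b) m) = j1 g b powi k * F b i"
proof -
  show "holomorphic2_on (\<lambda>b. F b i) ball2" if "i \<le> j"
    using assms that by (simp add: modular_forms_def holo_maps_def)
  show "F b i = 0" if "j < i"
    using assms that unfolding modular_forms_def holo_maps_def by blast
  show "(\<Sum>m\<le>j. symm j (matrix_inv (j2 g b)) i m * F (act g b) m) = j1 g b powi k * F b i"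
    if g: "g \<in> Gam_sqrt" and b: "b \<in> ball2"
  proof -
    have "slash j k g F b i = F b i"
      using assms g by (simp add: modular_forms_def)
    then have "j1 g b powi (- k) * (\<Sum>m\<le>j. symm j (matrix_inv (j2 g b)) i m * F (act g b) m) = F b i"
      using b by (simp add: slash_def)
    moreover have "j1 g b \<noteq> 0"
      using g b by (rule j1_nonzero)
    ultimately show ?thesis by (simp add: power_int_minus field_simps)
  qed
qed

lemma grad_compose:
  assumes "holomorphic2_on f T" "holomorphic2_on x S" "holomorphic2_on y S" "b \<in> S" "(x b, y b) \<in> T"
  shows "grad (\<lambda>b. f (x b, y b)) b $ 1
      = grad f (x b, y b) $ 1 * grad x b $ 1 + grad f (x b, y b) $ 2 * grad y b $ 1"
    and "grad (\<lambda>b. f (x b, y b)) b $ 2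
      = grad f (x b, y b) $ 1 * grad x b $ 2 + grad f (x b, y b) $ 2 * grad y b $ 2"
proof -
  obtain u v where b: "b = (u, v)" by (cases b)
  note S = assms(2,3)[THEN holomorphic2_on_slices(1), of u v]
    assms(2,3)[THEN holomorphic2_on_slices(2), of u v]
  show "grad (\<lambda>b. f (x b, y b)) b $ 1
      = grad f (x b, y b) $ 1 * grad x b $ 1 + grad f (x b, y b) $ 2 * grad y b $ 1"
    unfolding b grad_def[of "\<lambda>b. f (x b, y b)"]
    using holomorphic2_on_compose_curve[OF assms(1), of "\<lambda>s. x (s, v)" u "\<lambda>s. y (s, v)"] S assms(4,5)
    by (auto simp: b intro!: DERIV_imp_deriv)
  show "grad (\<lambda>b. f (x b, y b)) b $ 2
      = grad f (x b, y b) $ 1 * grad x b $ 2 + grad f (x b, y b) $ 2 * grad y b $ 2"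
    unfolding b grad_def[of "\<lambda>b. f (x b, y b)"]
    using holomorphic2_on_compose_curve[OF assms(1), of "\<lambda>t. x (u, t)" v "\<lambda>t. y (u, t)"] S assms(4,5)
    by (auto simp: b intro!: DERIV_imp_deriv)
qed

lemma deriv_Moebius:
  fixes a b c d :: complex
  assumes "c * s + d \<noteq> 0"
  shows "deriv (\<lambda>s. (a * s + b) / (c * s + d)) s = (a * d - b * c) / (c * s + d)\<^sup>2"
  by (rule DERIV_imp_deriv)
    (use assms in \<open>auto intro!: derivative_eq_intros simp: power2_eq_square algebra_simps\<close>)

lemma grad_act:
  assumes "g \<in> Gam" "b \<in> ball2"
  shows "grad (\<lambda>b. fst (act g b)) b $ 1 = (minor3 g 1 2 * snd b + minor3 g 1 1) / (j1 g b)\<^sup>2"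
    "grad (\<lambda>b. fst (act g b)) b $ 2 = - (minor3 g 1 2 * fst b + minor3 g 1 3) / (j1 g b)\<^sup>2"
    "grad (\<lambda>b. snd (act g b)) b $ 1 = - (minor3 g 3 2 * snd b + minor3 g 3 1) / (j1 g b)\<^sup>2"
    "grad (\<lambda>b. snd (act g b)) b $ 2 = (minor3 g 3 2 * fst b + minor3 g 3 3) / (j1 g b)\<^sup>2"
proof -
  obtain u v where b: "b = (u, v)" by (cases b)
  have nz: "g$2$3 * u + (g$2$1 * v + g$2$2) \<noteq> 0" "g$2$1 * v + (g$2$2 + g$2$3 * u) \<noteq> 0"
    using j1_neq_0[OF assms] by (simp_all add: j1_eq b algebra_simps)
  have u: "(\<lambda>s. fst (act g (s, v))) = (\<lambda>s. (g$3$3 * s + (g$3$1 * v + g$3$2)) / (g$2$3 * s + (g$2$1 * v + g$2$2)))"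
    "(\<lambda>s. snd (act g (s, v))) = (\<lambda>s. (g$1$3 * s + (g$1$1 * v + g$1$2)) / (g$2$3 * s + (g$2$1 * v + g$2$2)))"
    and v: "(\<lambda>t. fst (act g (u, t))) = (\<lambda>t. (g$3$1 * t + (g$3$2 + g$3$3 * u)) / (g$2$1 * t + (g$2$2 + g$2$3 * u)))"
    "(\<lambda>t. snd (act g (u, t))) = (\<lambda>t. (g$1$1 * t + (g$1$2 + g$1$3 * u)) / (g$2$1 * t + (g$2$2 + g$2$3 * u)))"
    by (simp_all add: act_eq j1_eq add_ac)
  have j: "j1 g (u, v) = g$2$3 * u + (g$2$1 * v + g$2$2)" "j1 g (u, v) = g$2$1 * v + (g$2$2 + g$2$3 * u)"
    by (simp_all add: j1_eq)
  show "grad (\<lambda>b. fst (act g b)) b $ 1 = (minor3 g 1 2 * snd b + minor3 g 1 1) / (j1 g b)\<^sup>2"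
    "grad (\<lambda>b. snd (act g b)) b $ 1 = - (minor3 g 3 2 * snd b + minor3 g 3 1) / (j1 g b)\<^sup>2"
    unfolding b j(1) grad_def
    by (simp_all add: u deriv_Moebius[OF nz(1)] minor3_eqs) (simp_all add: algebra_simps)
  show "grad (\<lambda>b. fst (act g b)) b $ 2 = - (minor3 g 1 2 * fst b + minor3 g 1 3) / (j1 g b)\<^sup>2"
    "grad (\<lambda>b. snd (act g b)) b $ 2 = (minor3 g 3 2 * fst b + minor3 g 3 3) / (j1 g b)\<^sup>2"
    unfolding b j(2) grad_def
    by (simp_all add: v deriv_Moebius[OF nz(2)] minor3_eqs) (simp_all add: algebra_simps)
qed

text \<open>Differentiating \<open>f (g b) = j1\<^sup>3 f b\<close> produces a term with the derivative of \<open>j1\<close>, which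
  cancels in the bracket; what remains is the transposed Jacobian matrix, the inverse of
  \<open>j1 \<cdot> j2\<close>.\<close>

lemma bracket_act:
  assumes "f \<in> scalar_forms 3" "h \<in> scalar_forms 3" "g \<in> Gam_sqrt" "b \<in> ball2"
  shows "bracket 3 3 f h (act g b) = (j1 g b ^ 7) *s (j2 g b *v bracket 3 3 f h b)"
proof -
  have g: "g \<in> Gam" using assms(3) by (simp add: Gam_sqrt_def)
  define j where "j = j1 g b"
  define xu xv yu yv where "xu = grad (\<lambda>b. fst (act g b)) b $ 1" and "xv = grad (\<lambda>b. fst (act g b)) b $ 2"
    and "yu = grad (\<lambda>b. snd (act g b)) b $ 1" and "yv = grad (\<lambda>b. snd (act g b)) b $ 2"
  have j: "j \<noteq> 0" unfolding j_def by (rule j1_neq_0[OF g assms(4)])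
  have d: "det g \<noteq> 0" by (rule det_Gam(2)[OF g])
  have j3: "holomorphic2_on (\<lambda>b. j1 g b ^ 3) ball2" by (intro holomorphic2_intros holomorphic2_on_j1)
  define cu cv where "cu = grad (\<lambda>b. j1 g b ^ 3) b $ 1" and "cv = grad (\<lambda>b. j1 g b ^ 3) b $ 2"
  have chain: "grad k (act g b) $ 1 * xu + grad k (act g b) $ 2 * yu = j ^ 3 * grad k b $ 1 + cu * k b"
    "grad k (act g b) $ 1 * xv + grad k (act g b) $ 2 * yv = j ^ 3 * grad k b $ 2 + cv * k b"
    if k: "k \<in> scalar_forms 3" for k
  proof -
    have eq: "k (fst (act g b), snd (act g b)) = j1 g b ^ 3 * k b" if "b \<in> ball2" for b
      using scalar_formD(3)[OF k assms(3) that] by simp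
    note hol = scalar_formD(1)[OF k]
    have "(fst (act g b), snd (act g b)) \<in> ball2" using act_in_ball2[OF g assms(4)] by simp
    from grad_compose[OF hol holomorphic2_on_act[OF g] assms(4) this]
      grad_cong[OF holomorphic2_on_mult[OF j3 hol] open_ball2 eq assms(4)]
      grad_mult[OF j3 hol assms(4)]
    show "grad k (act g b) $ 1 * xu + grad k (act g b) $ 2 * yu = j ^ 3 * grad k b $ 1 + cu * k b"
      "grad k (act g b) $ 1 * xv + grad k (act g b) $ 2 * yv = j ^ 3 * grad k b $ 2 + cv * k b"
      by (simp_all add: xu_def xv_def yu_def yv_def cu_def cv_def j_def)
  qed
  let ?P = "bracket 3 3 f h (act g b)" and ?p = "bracket 3 3 f h b"
  have val: "f (act g b) = j ^ 3 * f b" "h (act g b) = j ^ 3 * h b"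
    using scalar_formD(3)[OF assms(1,3,4)] scalar_formD(3)[OF assms(2,3,4)] by (simp_all add: j_def)
  have "3 * (?P $ 1 * xu + ?P $ 2 * yu) = f (act g b) * (grad h (act g b) $ 1 * xu + grad h (act g b) $ 2 * yu)
      - h (act g b) * (grad f (act g b) $ 1 * xu + grad f (act g b) $ 2 * yu)"
    by (simp add: bracket_def field_simps)
  also have "\<dots> = 3 * (j ^ 6 * ?p $ 1)"
    unfolding chain(1)[OF assms(1)] chain(1)[OF assms(2)] val
    by (simp add: bracket_def field_simps eval_nat_numeral)
  finally have 1: "?P $ 1 * xu + ?P $ 2 * yu = j ^ 6 * ?p $ 1"
    unfolding mult_cancel_left by simp
  have "3 * (?P $ 1 * xv + ?P $ 2 * yv) = f (act g b) * (grad h (act g b) $ 1 * xv + grad h (act g b) $ 2 * yv)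
      - h (act g b) * (grad f (act g b) $ 1 * xv + grad f (act g b) $ 2 * yv)"
    by (simp add: bracket_def field_simps)
  also have "\<dots> = 3 * (j ^ 6 * ?p $ 2)"
    unfolding chain(2)[OF assms(1)] chain(2)[OF assms(2)] val
    by (simp add: bracket_def field_simps eval_nat_numeral)
  finally have 2: "?P $ 1 * xv + ?P $ 2 * yv = j ^ 6 * ?p $ 2"
    unfolding mult_cancel_left by simp
  have ga: "xu * j\<^sup>2 = minor3 g 1 2 * snd b + minor3 g 1 1" "- xv * j\<^sup>2 = minor3 g 1 2 * fst b + minor3 g 1 3"
    "- yu * j\<^sup>2 = minor3 g 3 2 * snd b + minor3 g 3 1" "yv * j\<^sup>2 = minor3 g 3 2 * fst b + minor3 g 3 3"
    using j by (simp_all add: xu_def xv_def yu_def yv_def grad_act[OF g assms(4)] j_def field_simps)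
  have j2: "j2 g b $ 1 $ 1 = yv * j\<^sup>2 / det g" "j2 g b $ 1 $ 2 = - yu * j\<^sup>2 / det g"
    "j2 g b $ 2 $ 1 = - xv * j\<^sup>2 / det g" "j2 g b $ 2 $ 2 = xu * j\<^sup>2 / det g"
    unfolding ga by (simp_all add: j2_nth)
  have "(xu * j\<^sup>2) * (yv * j\<^sup>2) - (- xv * j\<^sup>2) * (- yu * j\<^sup>2) = j * det g"
    unfolding ga det_j2_identity by (simp add: j_def j1_eq)
  then have "j * (j ^ 3 * (xu * yv - xv * yu)) = j * det g"
    by (simp add: algebra_simps eval_nat_numeral)
  then have jac: "j ^ 3 * (xu * yv - xv * yu) = det g" using j by simp
  have "j ^ 7 * (yv * j\<^sup>2 / det g * ?p $ 1 + - yu * j\<^sup>2 / det g * ?p $ 2)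
      = j ^ 3 * (yv * (j ^ 6 * ?p $ 1) - yu * (j ^ 6 * ?p $ 2)) / det g"
    using d by (simp add: field_simps eval_nat_numeral)
  also have "\<dots> = j ^ 3 * (xu * yv - xv * yu) * ?P $ 1 / det g"
    unfolding 1[symmetric] 2[symmetric] by (simp add: algebra_simps)
  also have "\<dots> = ?P $ 1" unfolding jac using d by simp
  finally have r1: "?P $ 1 = j ^ 7 * (j2 g b *v ?p) $ 1"
    by (simp add: matrix_vector_mult_def sum_2 j2)
  have "j ^ 7 * (- xv * j\<^sup>2 / det g * ?p $ 1 + xu * j\<^sup>2 / det g * ?p $ 2)
      = j ^ 3 * (- xv * (j ^ 6 * ?p $ 1) + xu * (j ^ 6 * ?p $ 2)) / det g"
    using d by (simp add: field_simps eval_nat_numeral)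
  also have "\<dots> = j ^ 3 * (xu * yv - xv * yu) * ?P $ 2 / det g"
    unfolding 1[symmetric] 2[symmetric] by (simp add: algebra_simps)
  also have "\<dots> = ?P $ 2" unfolding jac using d by simp
  finally have r2: "?P $ 2 = j ^ 7 * (j2 g b *v ?p) $ 2"
    by (simp add: matrix_vector_mult_def sum_2 j2)
  show ?thesis
    using r1 r2 by (simp add: vec_eq_iff forall_2 j_def)
qed

section \<open>The ring of scalar forms modulo a linear form\<close>

lemma scalar_forms_add: "f \<in> scalar_forms k \<Longrightarrow> g \<in> scalar_forms k \<Longrightarrow> (\<lambda>b. f b + g b) \<in> scalar_forms k"
proof -
  have "scal (\<lambda>b. f b + g b) = scal f + scal g" by (auto simp: scal_def fun_eq_iff)
  then show "f \<in> scalar_forms k \<Longrightarrow> g \<in> scalar_forms k \<Longrightarrow> (\<lambda>b. f b + g b) \<in> scalar_forms k"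
    by (simp add: scalar_forms_def modular_forms_add)
qed

lemma scalar_forms_mult:
  assumes "f \<in> scalar_forms k" "g \<in> scalar_forms l"
  shows "(\<lambda>b. f b * g b) \<in> scalar_forms (k + l)"
proof (rule scalar_formI)
  fix g' b assume "g' \<in> Gam_sqrt" "b \<in> ball2"
  then show "f (act g' b) * g (act g' b) = j1 g' b powi (k + l) * (f b * g b)"
    using scalar_formD(3)[OF assms(1)] scalar_formD(3)[OF assms(2)] j1_nonzero
    by (simp add: power_int_add)
qed (use assms in \<open>auto intro: holomorphic2_on_mult scalar_formD\<close>)

lemma scalar_forms_scale: "f \<in> scalar_forms k \<Longrightarrow> (\<lambda>b. c * f b) \<in> scalar_forms k"
proof -
  assume f: "f \<in> scalar_forms k"
  have "(\<lambda>b. (c * indicator ball2 b) * f b) = (\<lambda>b. c * f b)"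
    using scalar_formD(2)[OF f] by (auto simp: fun_eq_iff indicator_def)
  then show ?thesis using scalar_forms_mult[OF const_scalar_form f, of c] by simp
qed

lemma scalar_forms_diff: "f \<in> scalar_forms k \<Longrightarrow> g \<in> scalar_forms k \<Longrightarrow> (\<lambda>b. f b - g b) \<in> scalar_forms k"
  using scalar_forms_add[of f k "\<lambda>b. - 1 * g b"] scalar_forms_scale[of g k "- 1"] by simp

lemma scalar_forms_0: "(\<lambda>_. 0) \<in> scalar_forms k"
  by (rule scalar_formI) (simp_all add: holomorphic2_on_const)

text \<open>Modulo the linear form \<open>l\<close>, a form of weight \<open>3 d\<close> is a binary form of degree \<open>d\<close> in two
  complementary generators. The first alternative also covers the weights that are not of this
  kind, in which every form is zero.\<close>

definition binary_mod :: "(complex \<times> complex \<Rightarrow> complex) \<Rightarrow> (complex \<times> complex \<Rightarrow> complex)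
    \<Rightarrow> (complex \<times> complex \<Rightarrow> complex) \<Rightarrow> int \<Rightarrow> (complex \<times> complex \<Rightarrow> complex) \<Rightarrow> bool" where
  "binary_mod l y z k f \<longleftrightarrow> f \<in> scalar_forms k \<and> ((\<forall>b\<in>ball2. f b = 0) \<or>
     (\<exists>d f' c. k = 3 * int d \<and> f' \<in> scalar_forms (k - 3) \<and>
       (\<forall>b\<in>ball2. f b = l b * f' b + (\<Sum>i\<le>d. c i * (y b ^ (d - i) * z b ^ i)))))"

lemma binary_mod_0: "binary_mod l y z k (\<lambda>_. 0)"
  by (simp add: binary_mod_def scalar_forms_0)

lemma binary_mod_add:
  assumes "binary_mod l y z k f" "binary_mod l y z k g"
  shows "binary_mod l y z k (\<lambda>b. f b + g b)"
proof -
  have sf: "(\<lambda>b. f b + g b) \<in> scalar_forms k"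
    using assms by (simp add: binary_mod_def scalar_forms_add)
  consider (f) "\<forall>b\<in>ball2. f b = 0" | (g) "\<forall>b\<in>ball2. g b = 0" |
    (fg) d f' c d2 g' c2 where "k = 3 * int d" "f' \<in> scalar_forms (k - 3)"
      "\<forall>b\<in>ball2. f b = l b * f' b + (\<Sum>i\<le>d. c i * (y b ^ (d - i) * z b ^ i))"
      "k = 3 * int d2" "g' \<in> scalar_forms (k - 3)"
      "\<forall>b\<in>ball2. g b = l b * g' b + (\<Sum>i\<le>d2. c2 i * (y b ^ (d2 - i) * z b ^ i))"
    using assms unfolding binary_mod_def by blast
  then show ?thesis
  proof cases
    case f
    then show ?thesis using assms(2) sf by (simp add: binary_mod_def cong: ball_cong)
  next
    case g
    then show ?thesis using assms(1) sf by (simp add: binary_mod_def cong: ball_cong)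
  next
    case fg
    have "d2 = d" using fg(1,4) by simp
    have "\<forall>b\<in>ball2. f b + g b = l b * (f' b + g' b) + (\<Sum>i\<le>d. (c i + c2 i) * (y b ^ (d - i) * z b ^ i))"
      using fg(3,6) \<open>d2 = d\<close> by (simp add: algebra_simps sum.distrib)
    moreover have "(\<lambda>b. f' b + g' b) \<in> scalar_forms (k - 3)" using fg(2,5) by (rule scalar_forms_add)
    ultimately show ?thesis using fg(1) sf unfolding binary_mod_def
      by (intro conjI disjI2 exI[of _ d] exI[of _ "\<lambda>b. f' b + g' b"] exI[of _ "\<lambda>i. c i + c2 i"]) auto
  qed
qed

lemma binary_mod_times_generator:
  assumes f: "binary_mod l y z k f" and l: "l \<in> scalar_forms 3" and h: "h \<in> scalar_forms 3"
    and comb: "\<And>b. b \<in> ball2 \<Longrightarrow> h b = \<alpha> * l b + \<beta> * y b + \<gamma> * z b"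
  shows "binary_mod l y z (k + 3) (\<lambda>b. f b * h b)"
proof -
  have f_form: "f \<in> scalar_forms k" using f by (simp add: binary_mod_def)
  have sf: "(\<lambda>b. f b * h b) \<in> scalar_forms (k + 3)"
    using scalar_forms_mult[OF f_form h] .
  show ?thesis
  proof (cases "\<forall>b\<in>ball2. f b = 0")
    case True
    then show ?thesis using sf by (simp add: binary_mod_def)
  next
    case False
    then obtain d f' c where dc: "k = 3 * int d" "f' \<in> scalar_forms (k - 3)"
      "\<And>b. b \<in> ball2 \<Longrightarrow> f b = l b * f' b + (\<Sum>i\<le>d. c i * (y b ^ (d - i) * z b ^ i))"
      using f unfolding binary_mod_def by blast
    obtain c' where c': "\<And>a b. (\<beta> * a + \<gamma> * b) * (\<Sum>i\<le>d. c i * (a ^ (d - i) * b ^ i)) =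
        (\<Sum>i\<le>Suc d. c' i * (a ^ (Suc d - i) * b ^ i))"
      using binary_form_times_linear[of \<beta> \<gamma> c d] by blast
    let ?g = "\<lambda>b. f' b * h b + \<alpha> * (f b - l b * f' b)"
    have "(\<lambda>b. l b * f' b) \<in> scalar_forms k" "(\<lambda>b. f' b * h b) \<in> scalar_forms k"
      using scalar_forms_mult[OF l dc(2)] scalar_forms_mult[OF dc(2) h] by simp_all
    then have g: "?g \<in> scalar_forms (k + 3 - 3)"
      using f_form by (simp add: scalar_forms_add scalar_forms_scale scalar_forms_diff)
    have "f b * h b = l b * ?g b + (\<Sum>i\<le>Suc d. c' i * (y b ^ (Suc d - i) * z b ^ i))"
      if "b \<in> ball2" for b
    proof -
      define s where "s = (\<Sum>i\<le>d. c i * (y b ^ (d - i) * z b ^ i))"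
      have fb: "f b = l b * f' b + s" using dc(3)[OF that] by (simp add: s_def)
      show ?thesis
        unfolding c'[symmetric] s_def[symmetric] unfolding fb comb[OF that]
        by (simp add: algebra_simps)
    qed
    then show ?thesis using g dc(1) sf unfolding binary_mod_def
      by (intro conjI disjI2 exI[of _ "Suc d"] exI[of _ ?g] exI[of _ c']) auto
  qed
qed

lemma binary_mod_const: "binary_mod l y z 0 (\<lambda>b. c * indicator ball2 b)"
  unfolding binary_mod_def
  by (intro conjI disjI2 const_scalar_form exI[of _ 0] exI[of _ "\<lambda>_. 0"] exI[of _ "\<lambda>_. c"])
    (auto simp: scalar_forms_0)

lemma lookup_times_single:
  "Poly_Mapping.lookup (e * Poly_Mapping.single m h) n b =
    Poly_Mapping.lookup e (n - m) b * h b"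
  for e :: "int \<Rightarrow>\<^sub>0 (complex \<times> complex \<Rightarrow> complex)"
proof -
  have "Poly_Mapping.lookup (Poly_Mapping.single m h * e) n b =
      (\<Sum>k\<in>Poly_Mapping.keys (Poly_Mapping.single m h).
        (Poly_Mapping.lookup (Poly_Mapping.single m h) k * Poly_Mapping.lookup e (n - k)) b)"
    by (simp only: lookup_times_eq_sum sum_fun_apply)
  also have "\<dots> = h b * Poly_Mapping.lookup e (n - m) b"
    by (cases "h = 0") auto
  finally show ?thesis by (simp add: mult.commute)
qed

text \<open>The monomials in the generators arise from constants by successive multiplication, and this
  operation preserves the description modulo \<open>l\<close>.\<close>

lemma scalar_form_binary_mod:
  assumes gen: "polynomial_generators \<phi>" and phi: "\<And>i. i < 3 \<Longrightarrow> \<phi> i \<in> scalar_forms 3"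
    and l: "l \<in> scalar_forms 3"
    and comb: "\<And>i. i < 3 \<Longrightarrow> \<exists>\<alpha> \<beta> \<gamma>. \<forall>b\<in>ball2. \<phi> i b = \<alpha> * l b + \<beta> * y b + \<gamma> * z b"
    and f: "f \<in> scalar_forms k"
  shows "binary_mod l y z k f"
proof -
  interpret R: cring form_ring by (rule cring_form_ring)
  define good where "good = (\<lambda>e. e \<in> carrier form_ring \<and> (\<forall>n. binary_mod l y z n (Poly_Mapping.lookup e n)))"
  have single: "Poly_Mapping.single m h \<in> carrier form_ring" if "h \<in> scalar_forms m" for m h
    using that scalar_forms_0 by (auto simp: form_ring_def lookup_single when_def zero_fun_def)
  have good_times: "good (e \<otimes>\<^bsub>form_ring\<^esub> Poly_Mapping.single 3 (\<phi> i))" if e: "good e" and i: "i < 3" for e i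
  proof -
    obtain \<alpha> \<beta> \<gamma> where c: "\<And>b. b \<in> ball2 \<Longrightarrow> \<phi> i b = \<alpha> * l b + \<beta> * y b + \<gamma> * z b"
      using comb[OF i] by blast
    have "binary_mod l y z (n - 3 + 3) (\<lambda>b. Poly_Mapping.lookup e (n - 3) b * \<phi> i b)" for n
      using e by (intro binary_mod_times_generator[OF _ l phi[OF i] c]) (auto simp: good_def)
    moreover have "e \<otimes>\<^bsub>form_ring\<^esub> Poly_Mapping.single 3 (\<phi> i) \<in> carrier form_ring"
      using e by (intro R.m_closed single phi i) (simp add: good_def)
    moreover have "Poly_Mapping.lookup (e \<otimes>\<^bsub>form_ring\<^esub> Poly_Mapping.single 3 (\<phi> i)) n
        = (\<lambda>b. Poly_Mapping.lookup e (n - 3) b * \<phi> i b)" for n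
      by (rule ext) (simp add: form_ring_def lookup_times_single)
    ultimately show ?thesis
      unfolding good_def by simp
  qed
  have good_pow: "good (e \<otimes>\<^bsub>form_ring\<^esub> Poly_Mapping.single 3 (\<phi> i) [^]\<^bsub>form_ring\<^esub> p)"
    if e: "good e" and i: "i < 3" for e i and p :: nat
  proof (induction p)
    case 0
    then show ?case using e by (simp add: good_def)
  next
    case (Suc p)
    have "e \<otimes>\<^bsub>form_ring\<^esub> Poly_Mapping.single 3 (\<phi> i) [^]\<^bsub>form_ring\<^esub> Suc p
        = (e \<otimes>\<^bsub>form_ring\<^esub> Poly_Mapping.single 3 (\<phi> i) [^]\<^bsub>form_ring\<^esub> p) \<otimes>\<^bsub>form_ring\<^esub> Poly_Mapping.single 3 (\<phi> i)"
      using e single[OF phi[OF i]] by (simp add: good_def R.m_assoc)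
    then show ?case using good_times[OF Suc i] by simp
  qed
  have good_const: "good (Poly_Mapping.single 0 (\<lambda>b. c * indicator ball2 b))" for c
    using single[OF const_scalar_form] binary_mod_const binary_mod_0
    by (auto simp: good_def lookup_single when_def zero_fun_def)
  have good_sum: "good (finsum form_ring t A)" if "finite A" "\<And>x. x \<in> A \<Longrightarrow> good (t x)" for t and A :: "'x set"
    using that
  proof (induction A)
    case empty
    show ?case using binary_mod_0 R.zero_closed
      by (simp add: good_def) (simp add: form_ring_def zero_fun_def)
  next
    case (insert x A)
    have "finsum form_ring t (insert x A) = t x \<oplus>\<^bsub>form_ring\<^esub> finsum form_ring t A"
      using insert by (intro R.finsum_insert) (auto simp: good_def)
    moreover have "good (t x)" "good (finsum form_ring t A)" using insert by auto
    ultimately show ?case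
      using binary_mod_add R.add.m_closed
      by (simp add: good_def) (simp add: form_ring_def lookup_add plus_fun_def)
  qed
  have "bij_betw (eval_poly3 \<phi>) UNIV (carrier form_ring)"
    using gen by (simp add: polynomial_generators_def)
  then obtain P where P: "eval_poly3 \<phi> P = Poly_Mapping.single k f"
    using single[OF f] by (metis bij_betw_imp_surj_on imageE)
  have "good (eval_poly3 \<phi> P)"
    unfolding eval_poly3_def
    by (rule good_sum) (auto intro!: good_pow good_const)
  then have "binary_mod l y z k (Poly_Mapping.lookup (eval_poly3 \<phi> P) k)"
    by (simp add: good_def)
  then show ?thesis by (simp add: P)
qed

lemma holomorphic_prod_list_cancel:
  assumes "\<And>F. F \<in> set Fs \<Longrightarrow> F holomorphic_on Z \<and> (\<exists>z\<in>Z. F z \<noteq> 0)"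
    and "G holomorphic_on Z" "open Z" "connected Z"
    and "\<And>z. z \<in> Z \<Longrightarrow> (\<Prod>F\<leftarrow>Fs. F z) * G z = 0" "z \<in> Z"
  shows "G z = 0"
  using assms(1,5)
proof (induction Fs)
  case Nil
  then show ?case using assms(6) by simp
next
  case (Cons F Fs)
  have hol: "(\<lambda>z. (\<Prod>F\<leftarrow>Fs. F z) * G z) holomorphic_on Z"
    using Cons.prems(1)
  proof (induction Fs)
    case (Cons F' Fs)
    have "F' holomorphic_on Z" using Cons.prems by simp
    moreover have "(\<lambda>z. (\<Prod>F\<leftarrow>Fs. F z) * G z) holomorphic_on Z"
      using Cons.prems by (intro Cons.IH) auto
    ultimately show ?case by (simp add: mult.assoc holomorphic_on_mult)
  qed (simp add: assms(2))
  obtain z0 where z0: "F holomorphic_on Z" "z0 \<in> Z" "F z0 \<noteq> 0" using Cons.prems(1) by auto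
  have "(\<Prod>F\<leftarrow>Fs. F z) * G z = 0" if "z \<in> Z" for z
    by (rule holomorphic_product_zero[OF z0(1) hol assms(3,4) _ z0(2,3) that])
      (use Cons.prems(2) in \<open>simp add: mult.assoc\<close>)
  then show ?case using Cons.prems(1) by (intro Cons.IH) auto
qed

section \<open>Reflections and their mirrors\<close>

lemma GamI:
  assumes "\<And>i j. g$i$j \<in> O_F" "\<And>i j. h$i$j \<in> O_F" "g ** h = mat 1" "h ** g = mat 1"
    and "\<And>z w. herm (g *v z) (g *v w) = herm z w"
  shows "g \<in> Gam"
  using assms unfolding Gam_def GL3_OF_def by blast

text \<open>The centers of the reflections of order three in the congruence subgroup.\<close>

definition root :: "complex^3 \<Rightarrow> bool" where
  "root r \<longleftrightarrow> (\<forall>i. r$i \<in> O_F) \<and> herm r r = 1"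

definition mirror :: "complex^3 \<Rightarrow> (complex \<times> complex) set" where
  "mirror r = {b \<in> ball2. herm (homog b) r = 0}"

definition dual :: "complex^3 \<Rightarrow> complex^3" where
  "dual r = vector [cnj (r$2), cnj (r$1), cnj (r$3)]"

text \<open>The map \<open>z \<mapsto> z - c h(z, r) r\<close>. It preserves \<open>h\<close> when \<open>r\<close> has norm \<open>1\<close> and \<open>c c\<^sup>* = c + c\<^sup>*\<close>, in
  particular for \<open>c = 1 - \<rho>\<close>, which is a multiple of \<open>sqrt_m3\<close>.\<close>

definition refl_mat :: "complex \<Rightarrow> complex^3 \<Rightarrow> complex^3^3" where
  "refl_mat c r = (\<chi> i j. (if i = j then 1 else 0) - c * (r$i * dual r$j))"

lemma dual_nth [simp]: "dual r $ 1 = cnj (r$2)" "dual r $ 2 = cnj (r$1)" "dual r $ 3 = cnj (r$3)"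
  by (simp_all add: dual_def)

lemma herm_dual: "herm z r = dual r $ 1 * z$1 + dual r $ 2 * z$2 + dual r $ 3 * z$3"
  by (simp add: herm_def mult.commute)

lemma refl_mat_nth: "refl_mat c r $ i $ j = (if i = j then 1 else 0) - c * (r$i * dual r$j)"
  by (simp add: refl_mat_def)

lemma refl_mat_mult_vec: "refl_mat c r *v z = z - (c * herm z r) *s r"
  by (simp add: vec_eq_iff forall_3 matrix_vector_mult_def sum_3 refl_mat_nth herm_def algebra_simps)

lemma herm_diff_scale:
  "herm (z - a *s r) (w - d *s r) =
    herm z w - a * herm r w - cnj d * herm z r + a * cnj d * herm r r"
  by (simp add: herm_def algebra_simps)

lemma herm_cnj: "herm w z = cnj (herm z w)"
  by (simp add: herm_def algebra_simps)

lemma one_minus_rho: "(1 - rho) * cnj (1 - rho) = (1 - rho) + cnj (1 - rho)"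
proof -
  have "(1 - rho) * cnj (1 - rho) = 2 + (- rho - rho * rho)"
    by (simp add: cnj_rho algebra_simps)
  then show ?thesis unfolding rho_sq by (simp add: cnj_rho)
qed

lemma refl_mat_inverse:
  assumes "c + d = c * d" "herm r r = 1"
  shows "refl_mat c r ** refl_mat d r = mat 1"
proof -
  have "(refl_mat c r ** refl_mat d r) *v z = mat 1 *v z" for z
  proof -
    have "herm (z - (d * herm z r) *s r) r = herm z r - d * herm z r"
      using herm_diff_scale[of z "d * herm z r" r r 0] assms(2) by simp
    then have "(refl_mat c r ** refl_mat d r) *v z
        = z - (d * herm z r) *s r - (c * (herm z r - d * herm z r)) *s r"
      by (simp add: refl_mat_mult_vec flip: matrix_vector_mul_assoc)
    also have "\<dots> = z - ((c + d - c * d) * herm z r) *s r"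
      by (simp add: vec_eq_iff algebra_simps)
    finally show ?thesis using assms(1) by simp
  qed
  then show ?thesis by (simp add: matrix_eq)
qed

lemma refl_mat_in_Gam_sqrt:
  assumes "root r"
  shows "refl_mat (1 - rho) r \<in> Gam_sqrt"
proof -
  have r: "\<And>i. r$i \<in> O_F" "herm r r = 1" using assms by (auto simp: root_def)
  have dual: "dual r $ j \<in> O_F" for j
    using exhaust_3[of j] r(1) by (auto intro!: O_F_cnj)
  have entry: "refl_mat c r $ i $ j \<in> O_F" if "c \<in> O_F" for c i j
    unfolding refl_mat_nth using that by (auto intro!: O_F_intros r(1) dual)
  have Gam: "refl_mat (1 - rho) r \<in> Gam"
  proof (rule GamI)
    show "refl_mat (1 - rho) r $ i $ j \<in> O_F" "refl_mat (cnj (1 - rho)) r $ i $ j \<in> O_F" for i j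
      by (intro entry O_F_intros)+
    show "refl_mat (1 - rho) r ** refl_mat (cnj (1 - rho)) r = mat 1"
      "refl_mat (cnj (1 - rho)) r ** refl_mat (1 - rho) r = mat 1"
      using one_minus_rho r(2) by (intro refl_mat_inverse; simp add: mult.commute add.commute)+
    fix z w
    define c where "c = 1 - rho"
    have "herm (refl_mat c r *v z) (refl_mat c r *v w) = herm z w
        - (c + cnj c - c * cnj c) * (herm z r * cnj (herm w r))"
      unfolding refl_mat_mult_vec herm_diff_scale herm_cnj[of r w] r(2)
      by (simp add: algebra_simps)
    then show "herm (refl_mat (1 - rho) r *v z) (refl_mat (1 - rho) r *v w) = herm z w"
      using one_minus_rho by (simp add: c_def)
  qed
  have sqrt: "1 - rho = sqrt_m3 * (- 1 - rho)"
  proof -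
    have "sqrt_m3 * (- 1 - rho) = - 1 - 3 * rho - 2 * (rho * rho)"
      by (simp add: sqrt_m3_eq algebra_simps)
    then show ?thesis unfolding rho_sq by simp
  qed
  have "refl_mat (1 - rho) r $ i $ j - mat 1 $ i $ j = sqrt_m3 * ((1 + rho) * (r$i * dual r$j))" for i j
  proof -
    have "refl_mat (1 - rho) r $ i $ j - mat 1 $ i $ j = - ((1 - rho) * (r$i * dual r$j))"
      by (simp add: refl_mat_nth mat_def)
    also have "\<dots> = sqrt_m3 * ((1 + rho) * (r$i * dual r$j))"
      unfolding sqrt by (simp add: algebra_simps)
    finally show ?thesis .
  qed
  then have "congr_one (refl_mat (1 - rho) r)"
    unfolding congr_one_def by (metis O_F_add O_F_mult O_F_numerals(2) O_F_rho r(1) dual)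
  then show ?thesis using Gam by (simp add: Gam_sqrt_def)
qed

text \<open>On the mirror, \<open>det \<cdot> j2\<close> is a scalar matrix plus \<open>1 - \<rho>\<close> times a matrix of rank one and trace \<open>1\<close>;
  the latter is not scalar.\<close>

lemma j2_refl_mat_not_scalar:
  assumes "root r" "b \<in> mirror r"
  shows "j2 (refl_mat (1 - rho) r) b \<noteq> mat p"
proof
  assume scalar: "j2 (refl_mat (1 - rho) r) b = mat p"
  define c where "c = 1 - rho"
  let ?g = "refl_mat c r"
  define s1 s2 s3 where "s1 = dual r $ 1" and "s2 = dual r $ 2" and "s3 = dual r $ 3"
  define x y where "x = r$1 - r$2 * snd b" and "y = r$3 - r$2 * fst b"
  have c: "c \<noteq> 0" using rho_neq_1 by (simp add: c_def)
  have d: "det ?g \<noteq> 0"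
    using refl_mat_in_Gam_sqrt[OF assms(1)] det_Gam(2) by (simp add: Gam_sqrt_def c_def)
  have norm: "s1 * r$1 + s2 * r$2 + s3 * r$3 = 1"
    using assms(1) unfolding root_def herm_dual s1_def s2_def s3_def by simp
  have mir: "s2 = - (s1 * snd b + s3 * fst b)"
  proof -
    have "s1 * snd b + s2 + s3 * fst b = 0"
      using assms(2) unfolding mirror_def herm_dual s1_def s2_def s3_def by simp
    then show ?thesis by (simp add: algebra_simps eq_neg_iff_add_eq_0)
  qed
  have trace: "s1 * x + s3 * y = 1"
    using norm unfolding mir x_def y_def by (simp add: algebra_simps)
  note g = refl_mat_nth minor3_eqs s1_def[symmetric] s2_def[symmetric] s3_def[symmetric]
  have m: "minor3 ?g 3 2 * fst b + minor3 ?g 3 3 = 1 - c * (s1 * r$1 + s2 * r$2 + s3 * r$3) + c * (s3 * y)"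
    "minor3 ?g 3 2 * snd b + minor3 ?g 3 1 = c * (s3 * x)"
    "minor3 ?g 1 2 * fst b + minor3 ?g 1 3 = c * (s1 * y)"
    "minor3 ?g 1 2 * snd b + minor3 ?g 1 1 = 1 - c * (s1 * r$1 + s2 * r$2 + s3 * r$3) + c * (s1 * x)"
    unfolding g x_def y_def by (simp_all add: algebra_simps)
  have "j2 ?g b = mat p" using scalar by (simp add: c_def)
  then have "j2 ?g b $ 1 $ 2 = 0" "j2 ?g b $ 2 $ 1 = 0" "j2 ?g b $ 1 $ 1 = j2 ?g b $ 2 $ 2"
    by (simp_all add: mat_def)
  then have "s3 * x = 0" "s1 * y = 0" "s3 * y = s1 * x"
    unfolding j2_nth m using c d by simp_all
  then show False using trace by auto
qed

text \<open>The reflection fixes \<open>b\<close> with the factor \<open>j1 = 1\<close>, so the values of all forms at \<open>b\<close> are fixed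
  vectors of the symmetric cube of one matrix that is not scalar.\<close>

lemma det4_zero_on_mirror:
  assumes r: "root r" "b \<in> mirror r"
    and "F \<in> modular_forms 3 k1" "G \<in> modular_forms 3 k2" "H \<in> modular_forms 3 k3" "K \<in> modular_forms 3 k4"
  shows "det4 (F b) (G b) (H b) (K b) = 0"
proof -
  let ?g = "refl_mat (1 - rho) r"
  have g: "?g \<in> Gam_sqrt" "?g \<in> Gam"
    using refl_mat_in_Gam_sqrt[OF r(1)] by (simp_all add: Gam_sqrt_def)
  have b: "b \<in> ball2" and "herm (homog b) r = 0" using r(2) by (auto simp: mirror_def)
  then have fixed: "?g *v homog b = homog b" by (simp add: refl_mat_mult_vec)
  then have j1: "j1 ?g b = 1" by (simp flip: mult_homog_2)
  then have act: "act ?g b = b" using fixed homog_act[OF g(2) b] by (simp add: homog_eq_iff)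
  have V: "(\<Sum>m\<le>3. symm 3 (matrix_inv (j2 ?g b)) i m * V b m) = V b i" if "V \<in> modular_forms 3 k" for V k i
    using modular_formD(3)[OF that g(1) b, of i] by (simp add: j1 act)
  show ?thesis
  proof (rule det4_fixed_by_symm)
    fix p
    show "matrix_inv (j2 ?g b) \<noteq> mat p"
    proof
      assume inv: "matrix_inv (j2 ?g b) = mat p"
      define A where "A = j2 ?g b"
      have dA: "det A \<noteq> 0" using det_j2_nonzero[OF g(2) b] by (simp add: A_def)
      have "A = mat (p * det A)"
        using inv dA unfolding A_def[symmetric] matrix_inv_2[OF dA]
        by (auto simp: vec_eq_iff forall_2 mat_def field_simps)
      then show False using j2_refl_mat_not_scalar[OF r] A_def by metis
    qed
  qed (use assms(3-6) V in auto)
qed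

section \<open>The symmetric group permutes the mirrors\<close>

lemma nat_1_4_cases:
  assumes "i \<in> {1..4::nat}"
  obtains "i = 1" | "i = 2" | "i = 3" | "i = 4"
proof -
  have "i = 1 \<or> i = 2 \<or> i = 3 \<or> i = 4" using assms unfolding atLeastAtMost_iff by presburger
  then show thesis using that by blast
qed

text \<open>The unipotent elements that fix the cusp \<open>(1 : 0 : 0)\<close>; they act by \<open>u \<mapsto> u + a\<close> on the first
  coordinate.\<close>

definition heis :: "complex \<Rightarrow> complex \<Rightarrow> complex^3^3" where
  "heis a \<beta> = vector [vector [1, \<beta>, - cnj a], vector [0, 1, 0], vector [0, a, 1]]"

lemma heis_nth [simp]:
  "heis a \<beta> $ 1 $ 1 = 1" "heis a \<beta> $ 1 $ 2 = \<beta>" "heis a \<beta> $ 1 $ 3 = - cnj a"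
  "heis a \<beta> $ 2 $ 1 = 0" "heis a \<beta> $ 2 $ 2 = 1" "heis a \<beta> $ 2 $ 3 = 0"
  "heis a \<beta> $ 3 $ 1 = 0" "heis a \<beta> $ 3 $ 2 = a" "heis a \<beta> $ 3 $ 3 = 1"
  by (simp_all add: heis_def)

lemma heis_inverse:
  assumes "cnj \<beta> = - \<beta> - a * cnj a"
  shows "heis a \<beta> ** heis (- a) (cnj \<beta>) = mat 1" "heis (- a) (cnj \<beta>) ** heis a \<beta> = mat 1"
  unfolding assms by (simp_all add: vec_eq_iff forall_3 matrix_matrix_mult_def sum_3 mat_def algebra_simps)

lemma heis_in_Gam1:
  assumes "a \<in> O_F" "\<beta> \<in> O_F" and \<beta>: "cnj \<beta> = - \<beta> - a * cnj a"
  shows "heis a \<beta> \<in> Gam1"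
proof -
  have "heis a \<beta> \<in> Gam"
  proof (rule GamI)
    show "heis a \<beta> $ i $ j \<in> O_F" "heis (- a) (cnj \<beta>) $ i $ j \<in> O_F" for i j
      using exhaust_3[of i] exhaust_3[of j] assms(1,2) by (auto intro!: O_F_intros)
    show "heis a \<beta> ** heis (- a) (cnj \<beta>) = mat 1" "heis (- a) (cnj \<beta>) ** heis a \<beta> = mat 1"
      by (rule heis_inverse[OF \<beta>])+
    show "herm (heis a \<beta> *v z) (heis a \<beta> *v w) = herm z w" for z w
      by (simp add: herm_def matrix_vector_mult_def sum_3 \<beta> algebra_simps)
  qed
  moreover have "det (heis a \<beta>) = 1" by (simp add: det_3)
  ultimately show ?thesis by (simp add: Gam1_def)
qed

lemma cnj_sqrt_m3: "cnj sqrt_m3 = - sqrt_m3"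
  by (simp add: sqrt_m3_def)

lemma sqrt_m3_in_O_F: "sqrt_m3 \<in> O_F"
  unfolding sqrt_m3_eq by (intro O_F_intros)

text \<open>Isotropic vectors that are congruent modulo \<open>sqrt_m3\<close> are related by a translation.\<close>

lemma same_cusp_congruent:
  assumes u: "u' - u = sqrt_m3 * x" and s: "s' - s = sqrt_m3 * y"
    and O: "x \<in> O_F" "y \<in> O_F" "u \<in> O_F"
    and iso: "cnj s = - s - u * cnj u" "cnj s' = - s' - u' * cnj u'" and "k \<noteq> 0"
  shows "same_cusp (k *s vector [s, 1, u]) (vector [s', 1, u'])"
proof -
  define a where "a = u' - u"
  define \<beta> where "\<beta> = s' - s + cnj a * u"
  have a: "a = sqrt_m3 * x" using u by (simp add: a_def)
  have \<beta>_eq: "\<beta> = sqrt_m3 * (y - cnj x * u)"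
    unfolding \<beta>_def s a by (simp add: cnj_sqrt_m3 algebra_simps)
  have \<beta>: "cnj \<beta> = - \<beta> - a * cnj a"
    unfolding \<beta>_def a_def by (simp add: iso algebra_simps)
  have aO: "a \<in> O_F" "\<beta> \<in> O_F"
    unfolding a \<beta>_eq by (intro O_F_intros sqrt_m3_in_O_F O)+
  have "congr_one (heis a \<beta>)"
    unfolding congr_one_def
  proof (intro allI)
    fix i j :: 3
    have "- cnj a = sqrt_m3 * cnj x" by (simp add: a cnj_sqrt_m3)
    then have "heis a \<beta> $ i $ j - mat 1 $ i $ j \<in> {sqrt_m3 * 0, sqrt_m3 * x, sqrt_m3 * cnj x, sqrt_m3 * (y - cnj x * u)}"
      using exhaust_3[of i] exhaust_3[of j] a \<beta>_eq by (auto simp: mat_def)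
    moreover have "y - cnj x * u \<in> O_F" "cnj x \<in> O_F" "0 \<in> O_F" by (intro O_F_intros O)+
    ultimately show "\<exists>x\<in>O_F. heis a \<beta> $ i $ j - mat 1 $ i $ j = sqrt_m3 * x"
      using O(1) by blast
  qed
  then have "heis a \<beta> \<in> Gam1_sqrt"
    using heis_in_Gam1[OF aO \<beta>] by (simp add: Gam1_sqrt_def Gam_sqrt_def Gam1_def)
  moreover have "heis a \<beta> *v (k *s vector [s, 1, u]) = k *s vector [s', 1, u']"
    by (simp add: vec_eq_iff forall_3 matrix_vector_mult_def sum_3 \<beta>_def a_def algebra_simps)
  ultimately show ?thesis using \<open>k \<noteq> 0\<close> unfolding same_cusp_def by blast
qed

lemma same_cusp_scale:
  assumes "k \<noteq> 0"
  shows "same_cusp (k *s w) w"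
proof -
  have "mat 1 = heis 0 0"
    by (simp add: vec_eq_iff forall_3 mat_def)
  then have "mat 1 \<in> Gam1" using heis_in_Gam1[of 0 0] by (simp add: O_F_numerals)
  moreover have "congr_one (mat 1)"
    unfolding congr_one_def using O_F_numerals(1) by force
  ultimately have "mat 1 \<in> Gam1_sqrt" by (simp add: Gam1_sqrt_def Gam_sqrt_def Gam1_def)
  then show ?thesis using assms unfolding same_cusp_def
    by (intro bexI[of _ "mat 1"] exI[of _ k]) auto
qed

definition gen_R :: "complex^3^3" where
  "gen_R = vector [vector [- 1, 0, 0], vector [0, - 1, 0], vector [0, 0, 1]]"

definition gen_S :: "complex^3^3" where
  "gen_S = vector [vector [0, 1, 0], vector [1, 0, 0], vector [0, 0, - 1]]"

lemma gen_nth [simp]: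
  "gen_R $ 1 $ 1 = - 1" "gen_R $ 1 $ 2 = 0" "gen_R $ 1 $ 3 = 0"
  "gen_R $ 2 $ 1 = 0" "gen_R $ 2 $ 2 = - 1" "gen_R $ 2 $ 3 = 0"
  "gen_R $ 3 $ 1 = 0" "gen_R $ 3 $ 2 = 0" "gen_R $ 3 $ 3 = 1"
  "gen_S $ 1 $ 1 = 0" "gen_S $ 1 $ 2 = 1" "gen_S $ 1 $ 3 = 0"
  "gen_S $ 2 $ 1 = 1" "gen_S $ 2 $ 2 = 0" "gen_S $ 2 $ 3 = 0"
  "gen_S $ 3 $ 1 = 0" "gen_S $ 3 $ 2 = 0" "gen_S $ 3 $ 3 = - 1"
  by (simp_all add: gen_R_def gen_S_def)

lemma gen_involution: "gen_R ** gen_R = mat 1" "gen_S ** gen_S = mat 1"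
  by (simp_all add: vec_eq_iff forall_3 matrix_matrix_mult_def sum_3 mat_def)

lemma gen_in_Gam1: "gen_R \<in> Gam1" "gen_S \<in> Gam1"
proof -
  have "gen_R $ i $ j \<in> O_F" "gen_S $ i $ j \<in> O_F" for i j
    using exhaust_3[of i] exhaust_3[of j] by (auto intro!: O_F_intros)
  note entries = this
  have "gen_R \<in> Gam"
    by (rule GamI[OF entries(1) entries(1) gen_involution(1) gen_involution(1)])
      (simp add: herm_def matrix_vector_mult_def sum_3)
  moreover have "gen_S \<in> Gam"
    by (rule GamI[OF entries(2) entries(2) gen_involution(2) gen_involution(2)])
      (simp add: herm_def matrix_vector_mult_def sum_3)
  moreover have "det gen_R = 1" "det gen_S = 1" by (simp_all add: det_3)
  ultimately show "gen_R \<in> Gam1" "gen_S \<in> Gam1" by (simp_all add: Gam1_def)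
qed

lemma mult_vector_3:
  "(g :: complex^3^3) *v vector [a, b, c] = vector [g$1$1 * a + g$1$2 * b + g$1$3 * c,
    g$2$1 * a + g$2$2 * b + g$2$3 * c, g$3$1 * a + g$3$2 * b + g$3$3 * c]"
  by (simp add: vec_eq_iff forall_3 matrix_vector_mult_def sum_3)

lemma scale_vector_3: "k *s (vector [a, b, c] :: complex^3) = vector [k * a, k * b, k * c]"
  by (simp add: vec_eq_iff forall_3)

text \<open>The unqualified name of a transposition also denotes the transposed matrix.\<close>

abbreviation swap :: "nat \<Rightarrow> nat \<Rightarrow> nat \<Rightarrow> nat" where
  "swap \<equiv> Transposition.transpose"

lemma induces_gen_R: "induces eps gen_R (swap 3 4)"
  unfolding induces_def
proof
  fix i :: nat assume "i \<in> {1..4}"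
  then have "gen_R *v cusp eps i = (- 1) *s cusp eps (swap 3 4 i)"
    by (cases rule: nat_1_4_cases)
      (simp_all add: cusp_def mult_vector_3 scale_vector_3 transpose_def)
  then show "same_cusp (gen_R *v cusp eps i) (cusp eps (swap 3 4 i))"
    using same_cusp_scale[of "- 1"] by simp
qed

lemma sqrt_m3_multiples:
  "rho * rho - 1 = sqrt_m3 * rho" "rho - rho * rho = sqrt_m3" "sqrt_m3 * sqrt_m3 = - 3"
  "1 - rho = sqrt_m3 * (rho * rho)"
proof -
  have e: "sqrt_m3 * rho = rho + 2 * (rho * rho)" "sqrt_m3 * sqrt_m3 = 1 + 4 * rho + 4 * (rho * rho)"
    by (simp_all add: sqrt_m3_eq algebra_simps)
  show 1: "rho * rho - 1 = sqrt_m3 * rho" unfolding e rho_sq by simp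
  show "rho - rho * rho = sqrt_m3" unfolding rho_sq sqrt_m3_eq by simp
  show "sqrt_m3 * sqrt_m3 = - 3" unfolding e rho_sq by simp
  have "sqrt_m3 * (rho * rho) = - sqrt_m3 - sqrt_m3 * rho" unfolding rho_sq by (simp add: algebra_simps)
  also have "\<dots> = 1 - rho" unfolding 1[symmetric] rho_sq by (simp add: sqrt_m3_eq)
  finally show "1 - rho = sqrt_m3 * (rho * rho)" ..
qed

text \<open>The images of the last two cusps are congruent to cusps after division by the unit \<open>\<rho>\<close>.\<close>

lemma induces_gen_S:
  assumes "eps = 1 \<or> eps = - 1"
  shows "induces eps gen_S (swap 1 2 \<circ> swap 3 4)"
  unfolding induces_def
proof
  have main: "same_cusp (vector [1, rho, - e]) (vector [rho, 1, - e])" if e: "e = 1 \<or> e = - 1" for e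
  proof -
    have r3: "rho * (rho * rho) = 1" using rho_cubed by (simp add: power3_eq_cube mult.assoc)
    have e': "e \<in> O_F" "cnj e = e" "e * e = 1" using e by (auto intro!: O_F_intros)
    have "vector [1, rho, - e] = rho *s (vector [rho * rho, 1, - e * (rho * rho)] :: complex^3)"
    proof -
      have e3: "rho * (e * (rho * rho)) = e"
        by (simp only: mult.left_commute[of rho e] r3 mult_1_right)
      show ?thesis by (simp add: scale_vector_3 r3 e3)
    qed
    moreover have "same_cusp (rho *s vector [rho * rho, 1, - e * (rho * rho)]) (vector [rho, 1, - e])"
    proof (rule same_cusp_congruent)
      show "- e - - e * (rho * rho) = sqrt_m3 * (e * rho)"
        using sqrt_m3_multiples(1) by (simp add: algebra_simps)
      show "rho - rho * rho = sqrt_m3 * 1" using sqrt_m3_multiples(2) by simp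
      have r4: "(rho * rho) * (rho * rho) = rho" by (simp only: mult.assoc r3 mult_1_right)
      have cr: "cnj rho = rho * rho" by (simp add: cnj_rho rho_sq)
      have c2: "cnj (rho * rho) = rho" by (simp add: cr r4)
      have cu: "cnj (- e * (rho * rho)) = - e * rho" by (simp add: e' cr r4)
      have "(- e * (rho * rho)) * cnj (- e * (rho * rho)) = (e * e) * (rho * (rho * rho))"
        unfolding cu by (simp only: minus_mult_minus mult_minus_left mult_minus_right minus_minus mult_ac)
      then have n: "(- e * (rho * rho)) * cnj (- e * (rho * rho)) = 1"
        by (simp only: e' r3 mult_1_right)
      show "cnj (rho * rho) = - (rho * rho) - (- e * (rho * rho)) * cnj (- e * (rho * rho))"
        unfolding n c2 by (simp add: rho_sq)
      show "cnj rho = - rho - - e * cnj (- e)"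
        by (simp add: cnj_rho e')
      show "rho \<noteq> 0" using r3 by auto
    qed (auto intro!: O_F_intros e')
    ultimately show ?thesis by simp
  qed
  fix i :: nat assume "i \<in> {1..4}"
  then show "same_cusp (gen_S *v cusp eps i) (cusp eps ((swap 1 2 \<circ> swap 3 4) i))"
  proof (cases rule: nat_1_4_cases)
    case 1
    then have "gen_S *v cusp eps i = 1 *s cusp eps ((swap 1 2 \<circ> swap 3 4) i)"
      by (simp add: cusp_def mult_vector_3 transpose_def)
    then show ?thesis using same_cusp_scale[of 1] by simp
  next
    case 2
    then have "gen_S *v cusp eps i = 1 *s cusp eps ((swap 1 2 \<circ> swap 3 4) i)"
      by (simp add: cusp_def mult_vector_3 transpose_def)
    then show ?thesis using same_cusp_scale[of 1] by simp
  next
    case 3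
    then show ?thesis using main[of eps] assms
      by (simp add: cusp_def mult_vector_3 transpose_def)
  next
    case 4
    then show ?thesis using main[of "- eps"] assms
      by (auto simp: cusp_def mult_vector_3 transpose_def)
  qed
qed

lemma induces_heis:
  assumes "eps = 1 \<or> eps = - 1"
  shows "induces eps (heis eps rho) (swap 2 3 \<circ> swap 3 4)"
  unfolding induces_def
proof
  have e: "eps \<in> O_F" "cnj eps = eps" "eps * eps = 1" using assms by (auto intro!: O_F_intros)
  fix i :: nat assume "i \<in> {1..4}"
  then show "same_cusp (heis eps rho *v cusp eps i) (cusp eps ((swap 2 3 \<circ> swap 3 4) i))"
  proof (cases rule: nat_1_4_cases)
    case 1
    then have "heis eps rho *v cusp eps i = 1 *s cusp eps ((swap 2 3 \<circ> swap 3 4) i)"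
      by (simp add: cusp_def mult_vector_3 transpose_def)
    then show ?thesis using same_cusp_scale[of 1] by simp
  next
    case 2
    then have "heis eps rho *v cusp eps i = 1 *s cusp eps ((swap 2 3 \<circ> swap 3 4) i)"
      by (simp add: cusp_def mult_vector_3 transpose_def)
    then show ?thesis using same_cusp_scale[of 1] by simp
  next
    case 3
    have "same_cusp (1 *s vector [2 * rho - 1, 1, 2 * eps]) (vector [rho, 1, - eps])"
    proof (rule same_cusp_congruent)
      have "- eps - 2 * eps = - 3 * eps" by simp
      then show "- eps - 2 * eps = sqrt_m3 * (sqrt_m3 * eps)"
        unfolding sqrt_m3_multiples(3)[symmetric] by simp
      show "rho - (2 * rho - 1) = sqrt_m3 * (rho * rho)"
        using sqrt_m3_multiples(4) by simp
      show "cnj (2 * rho - 1) = - (2 * rho - 1) - 2 * eps * cnj (2 * eps)"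
        by (simp add: cnj_rho e)
      show "cnj rho = - rho - - eps * cnj (- eps)" by (simp add: cnj_rho e)
    qed (auto intro!: O_F_intros sqrt_m3_in_O_F e)
    then show ?thesis using 3 e by (simp add: cusp_def mult_vector_3 transpose_def)
  next
    case 4
    have "same_cusp (1 *s vector [2 * rho + 1, 1, 0]) (vector [0, 1, 0])"
    proof (rule same_cusp_congruent)
      show "0 - (2 * rho + 1) = sqrt_m3 * (- 1)" by (simp add: sqrt_m3_eq)
      show "0 - 0 = sqrt_m3 * 0" by simp
      show "cnj (2 * rho + 1) = - (2 * rho + 1) - 0 * cnj 0" by (simp add: cnj_rho)
    qed (auto intro!: O_F_intros)
    then show ?thesis using 4 e by (simp add: cusp_def mult_vector_3 transpose_def)
  qed
qed

definition sgn_equivariant :: "complex \<Rightarrow> (nat \<Rightarrow> complex \<times> complex \<Rightarrow> complex) \<Rightarrow> bool" where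
  "sgn_equivariant eps \<phi> \<longleftrightarrow> (\<forall>g\<in>Gam1. \<forall>\<sigma>. \<sigma> permutes {1..4} \<and> induces eps g \<sigma> \<longrightarrow>
     (\<forall>i\<in>{1..4}. slash 0 3 (matrix_inv g) (scal (x_form \<phi> i)) =
       scal (\<lambda>b. of_int (sign \<sigma>) * x_form \<phi> (\<sigma> i) b)))"

lemma x_form_act:
  assumes "sgn_equivariant eps \<phi>" "g \<in> Gam1" "\<sigma> permutes {1..4}" "induces eps g \<sigma>"
    and h: "g ** h = mat 1" "h ** g = mat 1" "h \<in> Gam" and "i \<in> {1..4}" "b \<in> ball2"
  shows "x_form \<phi> i (act h b) = of_int (sign \<sigma>) * j1 h b ^ 3 * x_form \<phi> (\<sigma> i) b"
proof -
  have "matrix_inv g = h" using h by (intro matrix_inv_eq)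
  then have "slash 0 3 h (scal (x_form \<phi> i)) b 0 = scal (\<lambda>b. of_int (sign \<sigma>) * x_form \<phi> (\<sigma> i) b) b 0"
    using assms unfolding sgn_equivariant_def by metis
  then have "x_form \<phi> i (act h b) / j1 h b ^ 3 = of_int (sign \<sigma>) * x_form \<phi> (\<sigma> i) b"
    using \<open>b \<in> ball2\<close> by (simp add: slash_def scal_def symm_0 power_int_minus divide_inverse mult.commute)
  then show ?thesis
    using j1_neq_0[OF h(3) \<open>b \<in> ball2\<close>] by (simp add: field_simps)
qed

text \<open>The points \<open>p\<close> and \<open>q\<close> witness that the four forms are not all proportional on the mirror. Restriction
  to the line through them reduces questions about the mirror to one variable.\<close>

definition mirror_of :: "(nat \<Rightarrow> complex \<times> complex \<Rightarrow> complex) \<Rightarrow> nat \<Rightarrow> nat \<Rightarrow> complex^3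
    \<Rightarrow> complex \<times> complex \<Rightarrow> complex \<times> complex \<Rightarrow> bool" where
  "mirror_of \<phi> a b r p q \<longleftrightarrow> root r \<and> p \<in> mirror r \<and> q \<in> mirror r \<and>
     (\<forall>z\<in>mirror r. x_form \<phi> a z = x_form \<phi> b z) \<and>
     (\<exists>i\<in>{1..4}. \<exists>j\<in>{1..4}. x_form \<phi> i p * x_form \<phi> j q \<noteq> x_form \<phi> j p * x_form \<phi> i q)"

lemma mirror_of_commute: "mirror_of \<phi> a b r p q \<Longrightarrow> mirror_of \<phi> b a r p q"
  by (auto simp: mirror_of_def)

text \<open>If \<open>h\<close> is the inverse of \<open>g\<close>, then \<open>x\<^sub>i \<circ> h\<close> is \<open>x (\<sigma> i)\<close> up to a factor without zeros, and \<open>h\<close> maps the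
  mirror of \<open>g r\<close> to that of \<open>r\<close>.\<close>

lemma mirror_of_transport:
  assumes equiv: "sgn_equivariant eps \<phi>" and g: "g \<in> Gam1" "\<sigma> permutes {1..4}" "induces eps g \<sigma>"
    and h: "g ** h = mat 1" "h ** g = mat 1" "h \<in> Gam"
    and m: "mirror_of \<phi> a b r p q" and ab: "a \<in> {1..4}" "b \<in> {1..4}"
  shows "mirror_of \<phi> (\<sigma> a) (\<sigma> b) (g *v r) (act g p) (act g q)"
proof -
  have gG: "g \<in> Gam" using g(1) by (simp add: Gam1_def)
  have r: "root r" "p \<in> mirror r" "q \<in> mirror r" "\<And>z. z \<in> mirror r \<Longrightarrow> x_form \<phi> a z = x_form \<phi> b z"
    using m by (auto simp: mirror_of_def)
  have pq: "p \<in> ball2" "q \<in> ball2" using r(2,3) by (auto simp: mirror_def)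
  have rO: "r$i \<in> O_F" for i using r(1) by (simp add: root_def)
  have gO: "g$i$j \<in> O_F" for i j using gG by (simp add: Gam_def GL3_OF_def)
  have "(g *v r) $ i \<in> O_F" for i
    unfolding matrix_vector_mult_def by (simp add: sum_3) (intro O_F_intros rO gO)
  moreover have "herm (g *v r) (g *v r) = 1"
    using r(1) by (simp add: herm_Gam[OF gG] root_def)
  ultimately have "root (g *v r)" by (simp add: root_def)
  have image: "act g z \<in> mirror (g *v r)" if "z \<in> mirror r" for z
  proof -
    have z: "z \<in> ball2" "herm (homog z) r = 0" using that by (auto simp: mirror_def)
    have "j1 g z * herm (homog (act g z)) (g *v r) = herm (g *v homog z) (g *v r)"
      using herm_scale[of "j1 g z" "homog (act g z)" 1 "g *v r"] by (simp add: homog_act[OF gG z(1)])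
    also have "\<dots> = 0" using z(2) by (simp add: herm_Gam[OF gG])
    finally show ?thesis
      using j1_neq_0[OF gG z(1)] act_in_ball2[OF gG z(1)] by (simp add: mirror_def)
  qed
  have preimage: "act h z \<in> mirror r" if "z \<in> mirror (g *v r)" for z
  proof -
    have z: "z \<in> ball2" "herm (homog z) (g *v r) = 0" using that by (auto simp: mirror_def)
    have "j1 h z * herm (homog (act h z)) r = herm (h *v homog z) (h *v (g *v r))"
      using herm_scale[of "j1 h z" "homog (act h z)" 1 r] h(2)
      by (simp add: homog_act[OF h(3) z(1)] matrix_vector_mul_assoc)
    also have "\<dots> = 0" using z(2) by (simp add: herm_Gam[OF h(3)])
    finally show ?thesis
      using j1_neq_0[OF h(3) z(1)] act_in_ball2[OF h(3) z(1)] by (simp add: mirror_def)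
  qed
  note x = x_form_act[OF equiv g h]
  have s: "complex_of_int (sign \<sigma>) \<noteq> 0" by (auto simp: sign_def)
  have agree: "x_form \<phi> (\<sigma> a) z = x_form \<phi> (\<sigma> b) z" if z: "z \<in> mirror (g *v r)" for z
  proof -
    have zB: "z \<in> ball2" using z by (simp add: mirror_def)
    have "of_int (sign \<sigma>) * j1 h z ^ 3 * x_form \<phi> (\<sigma> a) z = of_int (sign \<sigma>) * j1 h z ^ 3 * x_form \<phi> (\<sigma> b) z"
      using r(4)[OF preimage[OF z]] x[OF ab(1) zB] x[OF ab(2) zB] by simp
    then show ?thesis using s j1_neq_0[OF h(3) zB] by simp
  qed
  obtain i j where ij: "i \<in> {1..4}" "j \<in> {1..4}" "x_form \<phi> i p * x_form \<phi> j q \<noteq> x_form \<phi> j p * x_form \<phi> i q"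
    using m by (auto simp: mirror_of_def)
  have pull: "x_form \<phi> i z = of_int (sign \<sigma>) * j1 h (act g z) ^ 3 * x_form \<phi> (\<sigma> i) (act g z)"
    if "i \<in> {1..4}" "z \<in> ball2" for i z
    using x[OF that(1) act_in_ball2[OF gG that(2)]] act_inverse(1)[OF gG h(3,2) that(2)] by simp
  have "x_form \<phi> (\<sigma> i) (act g p) * x_form \<phi> (\<sigma> j) (act g q) \<noteq> x_form \<phi> (\<sigma> j) (act g p) * x_form \<phi> (\<sigma> i) (act g q)"
    using ij(3) unfolding pull[OF ij(1) pq(1)] pull[OF ij(1) pq(2)] pull[OF ij(2) pq(1)] pull[OF ij(2) pq(2)]
    by (auto simp: mult_ac)
  moreover have "\<sigma> i \<in> {1..4}" "\<sigma> j \<in> {1..4}"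
    using ij(1,2) permutes_in_image[OF g(2)] by blast+
  ultimately show ?thesis
    using \<open>root (g *v r)\<close> image[OF r(2)] image[OF r(3)] agree unfolding mirror_of_def by blast
qed

text \<open>As \<open>v\<close> tends to minus infinity, the variable \<open>w\<close> of the expansion tends to \<open>0\<close>, where a power
  series is continuous.\<close>

lemma FJ_limit:
  assumes "FJ_constant_term_one f"
  shows "(\<lambda>n. f (0, - of_nat (Suc n))) \<longlonglongrightarrow> 1"
proof -
  obtain c where c: "FJ_expansion f c" "\<And>u. c 0 u = 1"
    using assms by (auto simp: FJ_constant_term_one_def)
  define w where "w = (\<lambda>n::nat. exp (complex_of_real (2 * pi) * (- of_nat (Suc n)) / complex_of_real (sqrt 3)))"
  have sums: "(\<lambda>m. c m 0 * w n ^ m) sums f (0, - of_nat (Suc n))" for n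
  proof -
    have "(0, - of_nat (Suc n)) \<in> ball2" by (simp add: zero_v_in_ball2)
    then show ?thesis using c(1) unfolding FJ_expansion_def w_def by force
  qed
  define G where "G = (\<lambda>x. suminf (\<lambda>m. c m 0 * x ^ m))"
  have "summable (\<lambda>m. c m 0 * w 0 ^ m)" using sums sums_summable by blast
  then have "isCont G 0"
    unfolding G_def by (rule isCont_powser) (simp add: w_def)
  moreover have "w \<longlonglongrightarrow> 0"
  proof (rule tendsto_norm_zero_cancel)
    have "(\<lambda>n. cmod (w n)) = (\<lambda>n. exp (2 * pi * (- real (Suc n)) / sqrt 3))"
      by (simp add: w_def norm_exp_eq_Re)
    also have "\<dots> = (\<lambda>n. exp (- (2 * pi / sqrt 3)) ^ Suc n)"
    proof
      fix n
      have "2 * pi * (- real (Suc n)) / sqrt 3 = real (Suc n) * (- (2 * pi / sqrt 3))"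
        by (simp add: field_simps)
      then show "exp (2 * pi * (- real (Suc n)) / sqrt 3) = exp (- (2 * pi / sqrt 3)) ^ Suc n"
        by (simp only: exp_of_nat_mult)
    qed
    also have "\<dots> \<longlonglongrightarrow> 0"
      by (intro LIMSEQ_Suc LIMSEQ_realpow_zero) simp_all
    finally show "(\<lambda>n. cmod (w n)) \<longlonglongrightarrow> 0" .
  qed
  ultimately have "(\<lambda>n. G (w n)) \<longlonglongrightarrow> G 0"
    by (rule isCont_tendsto_compose)
  moreover have "G (w n) = f (0, - of_nat (Suc n))" for n
    unfolding G_def by (rule sums_unique[symmetric, OF sums])
  moreover have "G 0 = 1"
    using powser_zero[of "\<lambda>m. c m 0"] c(2) by (simp add: G_def)
  ultimately show ?thesis by simp
qed

text \<open>The element \<open>gen_R\<close> fixes the mirror \<open>u = 0\<close> pointwise and exchanges \<open>x\<^sub>3\<close> and \<open>x\<^sub>4\<close>. If all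
  \<open>x\<^sub>i\<close> were proportional on this mirror, then \<open>x\<^sub>1 = -3 x\<^sub>2\<close> there by the constant terms, and \<open>gen_S\<close>,
  which exchanges \<open>x\<^sub>1\<close> and \<open>x\<^sub>2\<close>, would give \<open>x\<^sub>2 = -3 x\<^sub>1\<close> as well.\<close>

lemma mirror_of_3_4:
  assumes eps: "eps = 1 \<or> eps = - 1" and equiv: "sgn_equivariant eps \<phi>"
    and FJ: "\<And>i. i < 3 \<Longrightarrow> FJ_constant_term_one (\<phi> i)"
  obtains p q where "mirror_of \<phi> 3 4 (vector [0, 0, 1]) p q"
proof -
  let ?r = "vector [0, 0, 1] :: complex^3"
  have Gam: "gen_R \<in> Gam" "gen_S \<in> Gam" using gen_in_Gam1 by (simp_all add: Gam1_def)
  have perm: "swap 3 4 permutes {1..4}" "swap 1 2 \<circ> swap 3 4 permutes {1..4}"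
    by (auto intro!: permutes_swap_id permutes_compose)
  have mirror: "z \<in> mirror ?r \<longleftrightarrow> fst z = 0 \<and> Re (snd z) < 0" for z
    by (cases z) (auto simp: mirror_def herm_def ball2_def)
  have root: "root ?r"
  proof -
    have "?r $ i \<in> O_F" for i using exhaust_3[of i] by (auto intro: O_F_numerals)
    then show ?thesis by (simp add: root_def herm_def)
  qed
  have agree: "x_form \<phi> 3 z = x_form \<phi> 4 z" if "z \<in> mirror ?r" for z
  proof -
    have z: "fst z = 0" "z \<in> ball2" using that mirror_def mirror by blast+
    have "act gen_R z = z" "j1 gen_R z = - 1" using z(1) by (auto simp: prod_eq_iff act_eq j1_eq)
    then show ?thesis
      using x_form_act[OF equiv gen_in_Gam1(1) perm(1) induces_gen_R gen_involution(1,1) Gam(1) _ z(2), of 3]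
      by (simp add: sign_swap_id transpose_def)
  qed
  have "\<exists>p\<in>mirror ?r. \<exists>q\<in>mirror ?r. x_form \<phi> 1 p * x_form \<phi> 2 q \<noteq> x_form \<phi> 2 p * x_form \<phi> 1 q"
  proof (rule ccontr)
    assume "\<not> ?thesis"
    then have ratio: "x_form \<phi> 1 p * x_form \<phi> 2 q = x_form \<phi> 2 p * x_form \<phi> 1 q"
      if "p \<in> mirror ?r" "q \<in> mirror ?r" for p q using that by blast
    define pt where "pt = (\<lambda>n::nat. (0::complex, - of_nat (Suc n) :: complex))"
    have pt: "pt n \<in> mirror ?r" for n by (simp add: mirror pt_def)
    have lim: "(\<lambda>n. \<phi> i (pt n)) \<longlonglongrightarrow> 1" if "i < 3" for i
      unfolding pt_def by (rule FJ_limit[OF FJ[OF that]])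
    have "(\<lambda>n. \<phi> 0 (pt n) + \<phi> 1 (pt n) + \<phi> 2 (pt n)) \<longlonglongrightarrow> 1 + 1 + 1"
      "(\<lambda>n. - 3 * \<phi> 0 (pt n) + \<phi> 1 (pt n) + \<phi> 2 (pt n)) \<longlonglongrightarrow> - 3 * 1 + 1 + 1"
      by (intro tendsto_intros lim; simp)+
    then have x: "(\<lambda>n. x_form \<phi> 1 (pt n)) \<longlonglongrightarrow> 3" "(\<lambda>n. x_form \<phi> 2 (pt n)) \<longlonglongrightarrow> - 1"
      by (simp_all add: x_form_def)
    have rel: "x_form \<phi> 1 p = - 3 * x_form \<phi> 2 p" if p: "p \<in> mirror ?r" for p
    proof -
      have "(\<lambda>n. x_form \<phi> 1 p * x_form \<phi> 2 (pt n)) \<longlonglongrightarrow> x_form \<phi> 1 p * - 1"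
        by (intro tendsto_intros x)
      moreover have "(\<lambda>n. x_form \<phi> 1 p * x_form \<phi> 2 (pt n)) \<longlonglongrightarrow> x_form \<phi> 2 p * 3"
        unfolding ratio[OF p pt] by (intro tendsto_intros x)
      ultimately have "x_form \<phi> 1 p * - 1 = x_form \<phi> 2 p * 3"
        by (rule LIMSEQ_unique)
      then have "- (x_form \<phi> 1 p * - 1) = - (x_form \<phi> 2 p * 3)" by (simp only:)
      then show ?thesis by simp
    qed
    have "x_form \<phi> 1 z = 0" if "z \<in> mirror ?r" for z
    proof -
      have z: "z \<in> ball2" "fst z = 0" "Re (snd z) < 0" using that mirror_def mirror by blast+
      define k where "k = complex_of_int (sign (swap 1 2 \<circ> swap 3 4)) * j1 gen_S z ^ 3"
      have k: "k \<noteq> 0" using j1_neq_0[OF Gam(2) z(1)] by (auto simp: k_def sign_def)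
      have "act gen_S z \<in> mirror ?r"
        using act_in_ball2[OF Gam(2) z(1)] z(2)
        by (cases "act gen_S z") (auto simp: mirror_def herm_def act_eq dest: arg_cong[of _ _ fst])
      note X = x_form_act[OF equiv gen_in_Gam1(2) perm(2) induces_gen_S[OF eps] gen_involution(2,2) Gam(2) _ z(1)]
      have kx: "x_form \<phi> 1 (act gen_S z) = k * x_form \<phi> 2 z" "x_form \<phi> 2 (act gen_S z) = k * x_form \<phi> 1 z"
        using X[of 1] X[of 2] by (simp_all add: k_def transpose_def)
      have "k * x_form \<phi> 2 z = - 3 * x_form \<phi> 2 (act gen_S z)"
        unfolding kx(1)[symmetric] by (rule rel[OF \<open>act gen_S z \<in> mirror ?r\<close>])
      also have "\<dots> = k * (- 3 * x_form \<phi> 1 z)" unfolding kx(2) by simp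
      finally have "k * x_form \<phi> 2 z = k * (- 3 * x_form \<phi> 1 z)" .
      then have "x_form \<phi> 2 z = - 3 * x_form \<phi> 1 z" using k by (simp only: mult_cancel_left) simp
      then show ?thesis using rel[OF that] by simp
    qed
    then have "(\<lambda>n. x_form \<phi> 1 (pt n)) = (\<lambda>_. 0)" using pt by auto
    then show False using x(1) LIMSEQ_unique[of "\<lambda>_. 0::complex" 0 3] by simp
  qed
  then obtain p q where "p \<in> mirror ?r" "q \<in> mirror ?r"
      "x_form \<phi> 1 p * x_form \<phi> 2 q \<noteq> x_form \<phi> 2 p * x_form \<phi> 1 q" by blast
  then have "mirror_of \<phi> 3 4 ?r p q"
    unfolding mirror_of_def using root agree
    by (intro conjI ballI bexI[of _ 1] bexI[of _ 2]) auto
  then show thesis by (rule that)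
qed

text \<open>The permutations induced by \<open>heis eps \<rho>\<close> and \<open>gen_S\<close> lead from the pair \<open>{3, 4}\<close> to all others:
  \<open>34, 42, 23\<close> by the former, then \<open>31\<close> and \<open>14\<close> by the latter, and \<open>12\<close> by the former again.\<close>

lemma mirror_of_exists:
  assumes eps: "eps = 1 \<or> eps = - 1" and equiv: "sgn_equivariant eps \<phi>"
    and FJ: "\<And>i. i < 3 \<Longrightarrow> FJ_constant_term_one (\<phi> i)"
    and ab: "a \<in> {1..4}" "b \<in> {1..4}" "a \<noteq> b"
  shows "\<exists>r p q. mirror_of \<phi> a b r p q"
proof -
  define M where "M = (\<lambda>a b. \<exists>r p q. mirror_of \<phi> a b r p q)"
  have sym: "M b a" if "M a b" for a b
    using that mirror_of_commute unfolding M_def by blast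
  have e: "eps \<in> O_F" "cnj rho = - rho - eps * cnj eps" "cnj eps = eps" "eps * eps = 1"
    using eps by (auto intro!: O_F_intros simp: cnj_rho)
  have S: "M ((swap 1 2 \<circ> swap 3 4) a) ((swap 1 2 \<circ> swap 3 4) b)" if "M a b" "a \<in> {1..4}" "b \<in> {1..4}" for a b
  proof -
    have "swap 1 2 \<circ> swap 3 4 permutes {1..4}" by (auto intro!: permutes_swap_id permutes_compose)
    moreover have "gen_S \<in> Gam" using gen_in_Gam1 by (simp add: Gam1_def)
    ultimately show ?thesis
      using that mirror_of_transport[OF equiv gen_in_Gam1(2) _ induces_gen_S[OF eps] gen_involution(2,2)]
      unfolding M_def by blast
  qed
  have T: "M ((swap 2 3 \<circ> swap 3 4) a) ((swap 2 3 \<circ> swap 3 4) b)" if "M a b" "a \<in> {1..4}" "b \<in> {1..4}" for a b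
  proof -
    have "swap 2 3 \<circ> swap 3 4 permutes {1..4}" by (auto intro!: permutes_swap_id permutes_compose)
    moreover have g: "heis eps rho \<in> Gam1" by (rule heis_in_Gam1[OF e(1) O_F_rho e(2)])
    moreover have "heis (- eps) (cnj rho) \<in> Gam1"
      by (rule heis_in_Gam1) (use e in \<open>auto intro!: O_F_intros simp: cnj_rho\<close>)
    then have "heis (- eps) (cnj rho) \<in> Gam" by (simp add: Gam1_def)
    ultimately show ?thesis
      using that mirror_of_transport[OF equiv g _ induces_heis[OF eps] heis_inverse[OF e(2)]]
      unfolding M_def by blast
  qed
  have m34: "M 3 4" using mirror_of_3_4[OF eps equiv FJ] unfolding M_def by blast
  have m42: "M 4 2" using T[OF m34] by (simp add: transpose_def)
  have m23: "M 2 3" using T[OF m42] by (simp add: transpose_def)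
  have m31: "M 3 1" using S[OF m42] by (simp add: transpose_def)
  have m14: "M 1 4" using S[OF m23] by (simp add: transpose_def)
  have m12: "M 1 2" using T[OF m14] by (simp add: transpose_def)
  have "M a b"
    using ab(1)
  proof (cases rule: nat_1_4_cases)
    case 1
    from ab(2) show ?thesis by (cases rule: nat_1_4_cases) (use 1 ab(3) m12 m31 m14 sym in auto)
  next
    case 2
    from ab(2) show ?thesis by (cases rule: nat_1_4_cases) (use 2 ab(3) m12 m23 m42 sym in auto)
  next
    case 3
    from ab(2) show ?thesis by (cases rule: nat_1_4_cases) (use 3 ab(3) m31 m23 m34 sym in auto)
  next
    case 4
    from ab(2) show ?thesis by (cases rule: nat_1_4_cases) (use 4 ab(3) m14 m42 m34 sym in auto)
  qed
  then show ?thesis by (simp add: M_def)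
qed

section \<open>Division by the discriminant\<close>

lemma x_form_sum: "x_form \<phi> 1 b + x_form \<phi> 2 b + x_form \<phi> 3 b + x_form \<phi> 4 b = 0"
  by (simp add: x_form_def)

lemma phi_eq_x_form: "i < 3 \<Longrightarrow> \<phi> i b = (x_form \<phi> 1 b - x_form \<phi> (i + 2) b) / 4"
proof -
  assume "i < 3"
  then have "i = 0 \<or> i = 1 \<or> i = 2" by presburger
  then show ?thesis by (elim disjE) (simp_all add: x_form_def)
qed

lemma x_form_scalar_form:
  assumes "\<And>i. i < 3 \<Longrightarrow> \<phi> i \<in> scalar_forms 3"
  shows "x_form \<phi> i \<in> scalar_forms 3"
proof -
  have phi: "\<phi> 0 \<in> scalar_forms 3" "\<phi> 1 \<in> scalar_forms 3" "\<phi> 2 \<in> scalar_forms 3"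
    using assms by simp_all
  have "(\<lambda>b. \<alpha> * \<phi> 0 b + \<beta> * \<phi> 1 b + \<gamma> * \<phi> 2 b) \<in> scalar_forms 3" for \<alpha> \<beta> \<gamma>
    by (intro scalar_forms_add scalar_forms_scale phi)
  from this[of 1 1 1] this[of "- 3" 1 1] this[of 1 "- 3" 1] this[of 1 1 "- 3"]
  show ?thesis
    by (cases "i = 1"; cases "i = 2"; cases "i = 3") (simp_all add: x_form_def[abs_def])
qed

text \<open>On the mirror of \<open>(a, b)\<close> the four forms are combinations of \<open>x\<^sub>a\<close> and \<open>x\<^sub>c\<close>.\<close>

lemma mirror_of_coordinates:
  assumes m: "mirror_of \<phi> a b r p q" and ab: "a \<in> {1..4}" "b \<in> {1..4}" "a \<noteq> b"
  obtains c d where "{1..4} = {a, b, c, d}"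
    "\<And>z. x_form \<phi> d z = (x_form \<phi> a z - x_form \<phi> b z) - 2 * x_form \<phi> a z - x_form \<phi> c z"
    "x_form \<phi> a p * x_form \<phi> c q \<noteq> x_form \<phi> c p * x_form \<phi> a q"
proof -
  let ?x = "x_form \<phi>"
  have "card ({1..4} - {a, b}) = 2" using ab by (simp add: card_Diff_subset)
  then obtain c d where cd: "{1..4} - {a, b} = {c, d}" "c \<noteq> d" by (auto simp: card_2_iff)
  then have set: "{1..4} = {a, b, c, d}" using ab by blast
  have "c \<notin> {a, b}" "d \<notin> {a, b}" using cd by blast+
  then have distinct: "a \<notin> {b, c, d}" "b \<notin> {c, d}" "c \<notin> {d}" using ab(3) cd(2) by auto
  have d: "?x d z = (?x a z - ?x b z) - 2 * ?x a z - ?x c z" for z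
  proof -
    have sum: "(\<Sum>i\<in>{1..4}. ?x i z) = ?x 1 z + ?x 2 z + ?x 3 z + ?x 4 z"
      by (simp add: eval_nat_numeral)
    have "?x a z + (?x b z + (?x c z + ?x d z)) = (\<Sum>i\<in>{1..4}. ?x i z)"
      unfolding set using distinct by (simp del: insert_iff)
    also have "\<dots> = 0" unfolding sum by (rule x_form_sum)
    finally have "?x a z + (?x b z + (?x c z + ?x d z)) = 0" .
    moreover have "?x d z = (?x a z + (?x b z + (?x c z + ?x d z))) - (?x a z + ?x b z + ?x c z)"
      by simp
    ultimately show ?thesis by simp
  qed
  have eq: "?x b p = ?x a p" "?x b q = ?x a q" using m by (simp_all add: mirror_of_def)
  have "?x a p * ?x c q \<noteq> ?x c p * ?x a q"
  proof
    assume pr: "?x a p * ?x c q = ?x c p * ?x a q"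
    have comb: "\<exists>\<beta> \<gamma>. ?x i p = \<beta> * ?x a p + \<gamma> * ?x c p \<and> ?x i q = \<beta> * ?x a q + \<gamma> * ?x c q"
      if i: "i \<in> {1..4}" for i
    proof -
      consider "i = a" | "i = b" | "i = c" | "i = d" using i unfolding set by blast
      then show ?thesis
      proof cases
        case 1 then show ?thesis by (intro exI[of _ 1] exI[of _ 0]) simp
      next
        case 2 then show ?thesis using eq by (intro exI[of _ 1] exI[of _ 0]) simp
      next
        case 3 then show ?thesis by (intro exI[of _ 0] exI[of _ 1]) simp
      next
        case 4 then show ?thesis using d eq by (intro exI[of _ "- 2"] exI[of _ "- 1"]) simp
      qed
    qed
    obtain i j where ij: "i \<in> {1..4}" "j \<in> {1..4}" "?x i p * ?x j q \<noteq> ?x j p * ?x i q"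
      using m by (auto simp: mirror_of_def)
    obtain \<beta> \<gamma> where i: "?x i p = \<beta> * ?x a p + \<gamma> * ?x c p" "?x i q = \<beta> * ?x a q + \<gamma> * ?x c q"
      using comb[OF ij(1)] by blast
    obtain \<beta>' \<gamma>' where j: "?x j p = \<beta>' * ?x a p + \<gamma>' * ?x c p" "?x j q = \<beta>' * ?x a q + \<gamma>' * ?x c q"
      using comb[OF ij(2)] by blast
    have "?x i p * ?x j q - ?x j p * ?x i q
        = (\<beta> * \<gamma>' - \<gamma> * \<beta>') * (?x a p * ?x c q - ?x c p * ?x a q)"
      unfolding i j by (simp add: algebra_simps)
    also have "\<dots> = 0" using pr by simp
    finally show False using ij(3) by simp
  qed
  then show thesis using set d that by blast
qed

lemma line_in_mirror:
  assumes "p \<in> mirror r" "q \<in> mirror r" "z \<in> line_dom p q"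
  shows "line p q z \<in> mirror r"
proof -
  have "herm (homog (line p q z)) r = (1 - z) * herm (homog p) r + z * herm (homog q) r"
    by (simp add: herm_def line_def algebra_simps)
  then show ?thesis using assms by (simp add: mirror_def line_dom_def)
qed

text \<open>A form that vanishes on the mirror of \<open>(a, b)\<close> is divisible by \<open>x\<^sub>a - x\<^sub>b\<close>: its remainder
  is a binary form in \<open>x\<^sub>a\<close> and \<open>x\<^sub>c\<close>, which are not proportional on the mirror.\<close>

lemma divide_by_difference:
  assumes gen: "polynomial_generators \<phi>" and phi: "\<And>i. i < 3 \<Longrightarrow> \<phi> i \<in> scalar_forms 3"
    and m: "mirror_of \<phi> a b r p q" and ab: "a \<in> {1..4}" "b \<in> {1..4}" "a \<noteq> b"
    and N: "N \<in> scalar_forms k" and zero: "\<And>z. z \<in> line_dom p q \<Longrightarrow> N (line p q z) = 0"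
  shows "\<exists>N'\<in>scalar_forms (k - 3). \<forall>z\<in>ball2. N z = (x_form \<phi> a z - x_form \<phi> b z) * N' z"
proof -
  let ?x = "x_form \<phi>"
  obtain c d where cd: "{1..4} = {a, b, c, d}" "\<And>z. ?x d z = (?x a z - ?x b z) - 2 * ?x a z - ?x c z"
    "?x a p * ?x c q \<noteq> ?x c p * ?x a q"
    using mirror_of_coordinates[OF m ab] by blast
  have xs: "?x i \<in> scalar_forms 3" for i by (rule x_form_scalar_form[OF phi])
  let ?l = "\<lambda>z. ?x a z - ?x b z"
  have l: "?l \<in> scalar_forms 3" by (intro scalar_forms_diff xs)
  have comb: "\<exists>\<alpha> \<beta> \<gamma>. \<forall>z. ?x i z = \<alpha> * ?l z + \<beta> * ?x a z + \<gamma> * ?x c z" if i: "i \<in> {1..4}" for i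
  proof -
    consider "i = a" | "i = b" | "i = c" | "i = d" using i unfolding cd(1) by blast
    then show ?thesis
    proof cases
      case 1 then show ?thesis by (intro exI[of _ 0] exI[of _ 1] exI[of _ 0]) simp
    next
      case 2 then show ?thesis by (intro exI[of _ "- 1"] exI[of _ 1] exI[of _ 0]) simp
    next
      case 3 then show ?thesis by (intro exI[of _ 0] exI[of _ 0] exI[of _ 1]) simp
    next
      case 4 then show ?thesis using cd(2) by (intro exI[of _ 1] exI[of _ "- 2"] exI[of _ "- 1"]) simp
    qed
  qed
  have "binary_mod ?l (?x a) (?x c) k N"
  proof (rule scalar_form_binary_mod[OF gen phi l _ N])
    fix i :: nat assume i: "i < 3"
    obtain \<alpha> \<beta> \<gamma> where 1: "\<And>z. ?x 1 z = \<alpha> * ?l z + \<beta> * ?x a z + \<gamma> * ?x c z"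
      using comb[of 1] by auto
    obtain \<alpha>' \<beta>' \<gamma>' where 2: "\<And>z. ?x (i + 2) z = \<alpha>' * ?l z + \<beta>' * ?x a z + \<gamma>' * ?x c z"
      using comb[of "i + 2"] i by auto
    have "\<phi> i z = (\<alpha> - \<alpha>') / 4 * ?l z + (\<beta> - \<beta>') / 4 * ?x a z + (\<gamma> - \<gamma>') / 4 * ?x c z" for z
      unfolding phi_eq_x_form[OF i] 1 2 by (simp add: field_simps)
    then show "\<exists>\<alpha> \<beta> \<gamma>. \<forall>b\<in>ball2. \<phi> i b = \<alpha> * ?l b + \<beta> * ?x a b + \<gamma> * ?x c b" by blast
  qed
  then consider "\<forall>z\<in>ball2. N z = 0" | (form) e N' c' where "k = 3 * int e" "N' \<in> scalar_forms (k - 3)"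
      "\<forall>z\<in>ball2. N z = ?l z * N' z + (\<Sum>i\<le>e. c' i * (?x a z ^ (e - i) * ?x c z ^ i))"
    unfolding binary_mod_def by blast
  then show ?thesis
  proof cases
    case 1
    then show ?thesis by (intro bexI[of _ "\<lambda>_. 0"]) (auto simp: scalar_forms_0)
  next
    case form
    have pq: "p \<in> mirror r" "q \<in> mirror r" "0 \<in> line_dom p q" "1 \<in> line_dom p q"
      using m by (auto simp: mirror_of_def mirror_def line_dom_def)
    have "c' i = 0" if "i \<le> e" for i
    proof (rule binary_form_zero_imp_coeffs_zero[OF
          holomorphic_on_line[OF scalar_formD(1)[OF xs[of a]]] holomorphic_on_line[OF scalar_formD(1)[OF xs[of c]]]
          open_line_dom connected_line_dom _ pq(3,4) _ that])
      fix z assume z: "z \<in> line_dom p q"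
      have "?l (line p q z) = 0" using m line_in_mirror[OF pq(1,2) z] by (simp add: mirror_of_def)
      moreover have "line p q z \<in> ball2" using z by (simp add: line_dom_def)
      ultimately show "(\<Sum>i\<le>e. c' i * (?x a (line p q z) ^ (e - i) * ?x c (line p q z) ^ i)) = 0"
        using form(3) zero[OF z] by auto
    qed (use cd(3) in \<open>simp add: mult.commute\<close>)
    then have "\<forall>z\<in>ball2. N z = ?l z * N' z" using form(3) by simp
    then show ?thesis using form(2) by blast
  qed
qed

text \<open>If a second difference vanished at both points, the vectors \<open>(x\<^sub>1, x\<^sub>2, x\<^sub>3, x\<^sub>4)\<close>, whose entries add
  up to zero, would be proportional.\<close>

lemma difference_nonzero_on_mirror:
  assumes m: "mirror_of \<phi> a b r p q" and ab: "a \<in> {1..4}" "b \<in> {1..4}" "a \<noteq> b"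
    and ij: "i \<in> {1..4}" "j \<in> {1..4}" "i \<noteq> j" "{i, j} \<noteq> {a, b}"
  shows "x_form \<phi> i p \<noteq> x_form \<phi> j p \<or> x_form \<phi> i q \<noteq> x_form \<phi> j q"
proof (rule ccontr)
  let ?x = "x_form \<phi>"
  assume "\<not> ?thesis"
  then have eq: "?x i p = ?x j p" "?x i q = ?x j q" by auto
  obtain c d where cd: "{1..4} = {a, b, c, d}" "\<And>z. ?x d z = (?x a z - ?x b z) - 2 * ?x a z - ?x c z"
    "?x a p * ?x c q \<noteq> ?x c p * ?x a q"
    using mirror_of_coordinates[OF m ab] by blast
  have ba: "?x b p = ?x a p" "?x b q = ?x a q" using m by (simp_all add: mirror_of_def)
  have d: "?x d p = - 2 * ?x a p - ?x c p" "?x d q = - 2 * ?x a q - ?x c q"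
    using cd(2)[of p] cd(2)[of q] ba by simp_all
  have "\<exists>\<kappa>. ?x c p = \<kappa> * ?x a p \<and> ?x c q = \<kappa> * ?x a q"
  proof -
    consider "{i, j} = {a, c}" | "{i, j} = {b, c}" | "{i, j} = {a, d}" | "{i, j} = {b, d}" | "{i, j} = {c, d}"
      using ij unfolding cd(1) by blast
    then show ?thesis
    proof cases
      case 1
      then have "?x c p = ?x a p \<and> ?x c q = ?x a q" using eq by (auto simp: doubleton_eq_iff)
      then show ?thesis by (intro exI[of _ 1]) simp
    next
      case 2
      then have "?x c p = ?x a p \<and> ?x c q = ?x a q" using eq ba by (auto simp: doubleton_eq_iff)
      then show ?thesis by (intro exI[of _ 1]) simp
    next
      case 3
      then have "?x d p = ?x a p \<and> ?x d q = ?x a q" using eq by (auto simp: doubleton_eq_iff)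
      then show ?thesis unfolding d by (intro exI[of _ "- 3"]) (auto simp: algebra_simps eq_neg_iff_add_eq_0)
    next
      case 4
      then have "?x d p = ?x a p \<and> ?x d q = ?x a q" using eq ba by (auto simp: doubleton_eq_iff)
      then show ?thesis unfolding d by (intro exI[of _ "- 3"]) (auto simp: algebra_simps eq_neg_iff_add_eq_0)
    next
      case 5
      then have "?x d p = ?x c p \<and> ?x d q = ?x c q" using eq by (auto simp: doubleton_eq_iff)
      then have "2 * ?x c p = 2 * (- ?x a p) \<and> 2 * ?x c q = 2 * (- ?x a q)"
        unfolding d by (auto simp: algebra_simps)
      then show ?thesis unfolding mult_cancel_left by (intro exI[of _ "- 1"]) simp
    qed
  qed
  then show False using cd(3) by auto
qed

definition pairs :: "(nat \<times> nat) list" where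
  "pairs = [(1, 2), (1, 3), (1, 4), (2, 3), (2, 4), (3, 4)]"

definition discr :: "(nat \<Rightarrow> complex \<times> complex \<Rightarrow> complex) \<Rightarrow> complex \<times> complex \<Rightarrow> complex" where
  "discr \<phi> z = (\<Prod>(i, j)\<leftarrow>pairs. x_form \<phi> i z - x_form \<phi> j z)"

lemma pairs_props:
  "distinct pairs" "length pairs = 6"
  "(i, j) \<in> set pairs \<Longrightarrow> i \<in> {1..4} \<and> j \<in> {1..4} \<and> i < j"
  by (auto simp: pairs_def)

text \<open>After division by the differences for other pairs, the quotient still vanishes on the mirror of
  the next pair, since those differences do not vanish identically on it.\<close>

lemma divide_by_differences:
  assumes gen: "polynomial_generators \<phi>" and phi: "\<And>i. i < 3 \<Longrightarrow> \<phi> i \<in> scalar_forms 3"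
    and mirrors: "\<And>a b. a \<in> {1..4} \<Longrightarrow> b \<in> {1..4} \<Longrightarrow> a \<noteq> b \<Longrightarrow> \<exists>r p q. mirror_of \<phi> a b r p q"
    and N: "N \<in> scalar_forms k" and zero: "\<And>r z. root r \<Longrightarrow> z \<in> mirror r \<Longrightarrow> N z = 0"
    and ps: "distinct ps" "\<And>i j. (i, j) \<in> set ps \<Longrightarrow> i \<in> {1..4} \<and> j \<in> {1..4} \<and> i < j"
  shows "\<exists>N'\<in>scalar_forms (k - 3 * int (length ps)).
    \<forall>z\<in>ball2. N z = (\<Prod>(i, j)\<leftarrow>ps. x_form \<phi> i z - x_form \<phi> j z) * N' z"
  using ps
proof (induction ps)
  case Nil
  then show ?case using N by auto
next
  case (Cons ac ps)
  let ?x = "x_form \<phi>"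
  obtain a c where ac: "ac = (a, c)" by (cases ac)
  have ac_in: "a \<in> {1..4}" "c \<in> {1..4}" "a < c" using Cons.prems(2)[of a c] by (simp_all add: ac)
  have ps: "distinct ps" "\<And>i j. (i, j) \<in> set ps \<Longrightarrow> i \<in> {1..4} \<and> j \<in> {1..4} \<and> i < j"
    using Cons.prems(1) Cons.prems(2)[OF list.set_intros(2)] by simp_all
  obtain N' where N': "N' \<in> scalar_forms (k - 3 * int (length ps))"
    "\<And>z. z \<in> ball2 \<Longrightarrow> N z = (\<Prod>(i, j)\<leftarrow>ps. ?x i z - ?x j z) * N' z"
    using Cons.IH[OF ps] by blast
  obtain r p q where m: "mirror_of \<phi> a c r p q" using mirrors[of a c] ac_in by auto
  have xs: "?x i \<in> scalar_forms 3" for i by (rule x_form_scalar_form[OF phi])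
  have pq: "p \<in> mirror r" "q \<in> mirror r" "root r" "0 \<in> line_dom p q" "1 \<in> line_dom p q"
    using m by (auto simp: mirror_of_def mirror_def line_dom_def)
  let ?Fs = "map (\<lambda>(i, j) z. ?x i (line p q z) - ?x j (line p q z)) ps"
  have "N' (line p q z) = 0" if z: "z \<in> line_dom p q" for z
  proof (rule holomorphic_prod_list_cancel[of ?Fs "line_dom p q" "\<lambda>z. N' (line p q z)"])
    fix F assume "F \<in> set ?Fs"
    then obtain i j where ij: "(i, j) \<in> set ps" "F = (\<lambda>z. ?x i (line p q z) - ?x j (line p q z))" by auto
    have ij': "i \<in> {1..4}" "j \<in> {1..4}" "i < j" using Cons.prems(2)[of i j] ij(1) by simp_all
    have "(i, j) \<noteq> (a, c)" using Cons.prems(1) ij(1) by (auto simp: ac)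
    then have "{i, j} \<noteq> {a, c}" using ij'(3) ac_in(3) by (auto simp: doubleton_eq_iff)
    then have "?x i p \<noteq> ?x j p \<or> ?x i q \<noteq> ?x j q"
      using difference_nonzero_on_mirror[OF m] ac_in ij' by blast
    then have "\<exists>z\<in>line_dom p q. F z \<noteq> 0"
      using pq(4,5) by (auto simp: ij(2) intro: bexI[of _ 0] bexI[of _ 1])
    moreover have "F holomorphic_on line_dom p q"
      unfolding ij(2) by (intro holomorphic_intros holomorphic_on_line scalar_formD(1)[OF xs])
    ultimately show "F holomorphic_on line_dom p q \<and> (\<exists>z\<in>line_dom p q. F z \<noteq> 0)" by blast
  next
    fix z assume z: "z \<in> line_dom p q"
    have "N (line p q z) = 0" using zero[OF pq(3)] line_in_mirror[OF pq(1,2) z] by blast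
    then show "(\<Prod>F\<leftarrow>?Fs. F z) * N' (line p q z) = 0"
      using N'(2)[of "line p q z"] z by (simp add: line_dom_def comp_def case_prod_unfold)
  qed (use z N'(1) in \<open>auto intro: holomorphic_on_line scalar_formD(1) open_line_dom connected_line_dom\<close>)
  from divide_by_difference[OF gen phi m ac_in(1,2) _ N'(1) this] ac_in(3)
  obtain N'' where N'': "N'' \<in> scalar_forms (k - 3 * int (length ps) - 3)"
    "\<And>z. z \<in> ball2 \<Longrightarrow> N' z = (?x a z - ?x c z) * N'' z" by auto
  show ?case
    by (rule bexI[of _ N'']) (use N' N'' in \<open>auto simp: ac algebra_simps\<close>)
qed

lemma discr_cancel:
  assumes phi: "\<And>i. i < 3 \<Longrightarrow> \<phi> i \<in> scalar_forms 3"
    and mirrors: "\<And>a b. a \<in> {1..4} \<Longrightarrow> b \<in> {1..4} \<Longrightarrow> a \<noteq> b \<Longrightarrow> \<exists>r p q. mirror_of \<phi> a b r p q"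
    and G: "holomorphic2_on G ball2" "\<And>z. z \<in> ball2 \<Longrightarrow> discr \<phi> z * G z = 0" and "z \<in> ball2"
  shows "G z = 0"
proof -
  let ?x = "x_form \<phi>"
  have hol: "holomorphic2_on (\<lambda>z. ?x i z - ?x j z) ball2" for i j
    by (intro holomorphic2_on_diff scalar_formD(1)[OF x_form_scalar_form[OF phi]])
  have ne: "\<exists>z\<in>ball2. ?x i z - ?x j z \<noteq> 0" if ij: "i \<in> {1..4}" "j \<in> {1..4}" "i \<noteq> j" for i j
  proof -
    have "card ({1..4} - {i, j}) = 2" using ij by (simp add: card_Diff_subset)
    then have "{1..4} - {i, j} \<noteq> {}" by (metis card.empty zero_neq_numeral)
    then obtain b where b: "b \<in> {1..4}" "b \<noteq> i" "b \<noteq> j" by blast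
    then obtain r p q where m: "mirror_of \<phi> i b r p q" using mirrors[OF ij(1) b(1)] by auto
    have "?x i p \<noteq> ?x j p \<or> ?x i q \<noteq> ?x j q"
      using difference_nonzero_on_mirror[OF m ij(1) b(1) _ ij] b by (auto simp: doubleton_eq_iff)
    moreover have "p \<in> ball2" "q \<in> ball2" using m by (auto simp: mirror_of_def mirror_def)
    ultimately show ?thesis by auto
  qed
  have "G z = 0" if "\<And>z. z \<in> ball2 \<Longrightarrow> (\<Prod>(i, j)\<leftarrow>ps. ?x i z - ?x j z) * G z = 0"
      "\<And>i j. (i, j) \<in> set ps \<Longrightarrow> i \<in> {1..4} \<and> j \<in> {1..4} \<and> i < j" "z \<in> ball2" for ps z
    using that
  proof (induction ps arbitrary: z)
    case (Cons ij ps)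
    obtain i j where ij: "ij = (i, j)" by (cases ij)
    have P: "holomorphic2_on (\<lambda>z. \<Prod>(i, j)\<leftarrow>ps. ?x i z - ?x j z) ball2" for ps
    proof (induction ps)
      case (Cons ij ps)
      then show ?case by (cases ij) (simp add: holomorphic2_on_mult hol)
    qed (simp add: holomorphic2_on_const)
    obtain z0 where z0: "z0 \<in> ball2" "?x i z0 - ?x j z0 \<noteq> 0"
      using ne[of i j] Cons.prems(2)[of i j] by (auto simp: ij)
    have "(\<Prod>(i, j)\<leftarrow>ps. ?x i z - ?x j z) * G z = 0" if "z \<in> ball2" for z
      by (rule holomorphic2_product_zero[OF hol[of i j] holomorphic2_on_mult[OF P G(1)] _ z0 that])
        (use Cons.prems(1) in \<open>simp add: ij mult.assoc\<close>)
    then show ?case by (rule Cons.IH[OF _ Cons.prems(2)[OF list.set_intros(2)] Cons.prems(3)])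
  qed simp
  then show ?thesis using G(2) pairs_props(3) assms(5) unfolding discr_def by blast
qed

text \<open>The quotient by \<open>\<phi>\<^sub>0\<close> would have negative weight, hence be zero; a binary form of degree \<open>0\<close> remains.\<close>

lemma weight_0_const:
  assumes gen: "polynomial_generators \<phi>" and phi: "\<And>i. i < 3 \<Longrightarrow> \<phi> i \<in> scalar_forms 3"
    and f: "f \<in> scalar_forms 0"
  shows "\<exists>c. \<forall>z\<in>ball2. f z = c"
proof -
  have bm: "binary_mod (\<phi> 0) (\<phi> 1) (\<phi> 2) k g" if g: "g \<in> scalar_forms k" for k g
  proof (rule scalar_form_binary_mod[OF gen phi _ _ g])
    show "\<phi> 0 \<in> scalar_forms 3" using phi by simp
    fix i :: nat assume "i < 3"
    then have "i = 0 \<or> i = 1 \<or> i = 2" by presburger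
    then have "\<exists>\<alpha> \<beta> \<gamma>. \<forall>b. \<phi> i b = \<alpha> * \<phi> 0 b + \<beta> * \<phi> 1 b + \<gamma> * \<phi> 2 b"
    proof (elim disjE)
      show "i = 0 \<Longrightarrow> ?thesis" by (intro exI[of _ 1] exI[of _ 0] exI[of _ 0]) simp
      show "i = 1 \<Longrightarrow> ?thesis" by (intro exI[of _ 0] exI[of _ 1] exI[of _ 0]) simp
      show "i = 2 \<Longrightarrow> ?thesis" by (intro exI[of _ 0] exI[of _ 0] exI[of _ 1]) simp
    qed
    then show "\<exists>\<alpha> \<beta> \<gamma>. \<forall>b\<in>ball2. \<phi> i b = \<alpha> * \<phi> 0 b + \<beta> * \<phi> 1 b + \<gamma> * \<phi> 2 b" by blast
  qed
  consider "\<forall>z\<in>ball2. f z = 0" | d f' c where "(0::int) = 3 * int d" "f' \<in> scalar_forms (0 - 3)"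
      "\<forall>z\<in>ball2. f z = \<phi> 0 z * f' z + (\<Sum>i\<le>d. c i * (\<phi> 1 z ^ (d - i) * \<phi> 2 z ^ i))"
    using bm[OF f] unfolding binary_mod_def by blast
  then show ?thesis
  proof cases
    case 2
    have "\<not> (\<exists>d. (0 - 3 :: int) = 3 * int d)" by presburger
    then have "\<forall>z\<in>ball2. f' z = 0"
      using bm[OF 2(2)] unfolding binary_mod_def by blast
    moreover have "d = 0" using 2(1) by simp
    ultimately show ?thesis using 2(3) by auto
  qed blast
qed

section \<open>The determinant of the Eisenstein series\<close>

lemma grad_diff:
  assumes "holomorphic2_on f S" "holomorphic2_on g S" "b \<in> S"
  shows "grad (\<lambda>b. f b - g b) b = grad f b - grad g b"
proof -
  have "((\<lambda>b. f b - g b) has_derivative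
      (\<lambda>(s, t). (grad f b $ 1 - grad g b $ 1) * s + (grad f b $ 2 - grad g b $ 2) * t)) (at b)"
    by (rule has_derivative_eq_rhs[OF has_derivative_diff
          [OF assms(1,2)[THEN holomorphic2_on_has_derivative_grad, OF assms(3)]]])
      (auto simp: algebra_simps)
  from grad_of_has_derivative[of "\<lambda>b. f b - g b" _ _ "fst b" "snd b", unfolded prod.collapse, OF this]
  show ?thesis by (simp add: vec_eq_iff forall_2)
qed

text \<open>The difference of \<open>\<phi>\<^sub>1\<close> and \<open>\<phi>\<^sub>2\<close> vanishes on the mirror \<open>u = 0\<close>, where \<open>\<phi>\<^sub>0\<close> and \<open>\<phi>\<^sub>2\<close> are not
  proportional, but it is not identically zero.\<close>

lemma jac_phi_nonzero:
  assumes eps: "eps = 1 \<or> eps = - 1" and equiv: "sgn_equivariant eps \<phi>"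
    and FJ: "\<And>i. i < 3 \<Longrightarrow> FJ_constant_term_one (\<phi> i)" and phi: "\<And>i. i < 3 \<Longrightarrow> \<phi> i \<in> scalar_forms 3"
  shows "\<exists>b\<in>ball2. jac (\<phi> 0) (\<phi> 1) (\<phi> 2) b \<noteq> 0"
proof (rule ccontr)
  assume "\<not> ?thesis"
  then have zero: "jac (\<phi> 0) (\<phi> 1) (\<phi> 2) b = 0" if "b \<in> ball2" for b using that by blast
  let ?x = "x_form \<phi>" and ?r = "vector [0, 0, 1] :: complex^3"
  have hol: "holomorphic2_on (\<phi> 0) ball2" "holomorphic2_on (\<phi> 1) ball2" "holomorphic2_on (\<phi> 2) ball2"
    by (auto intro!: scalar_formD(1) phi)
  obtain p q where m: "mirror_of \<phi> 3 4 ?r p q"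
    using mirror_of_3_4[OF eps equiv FJ] by blast
  have mirror: "z \<in> mirror ?r \<longleftrightarrow> z \<in> ball2 \<and> fst z = 0" for z
    by (simp add: mirror_def herm_def)
  have eq: "\<phi> 1 z = \<phi> 2 z" if "z \<in> mirror ?r" for z
  proof -
    have "?x 3 z = ?x 4 z" using m that by (simp add: mirror_of_def)
    then show ?thesis by (simp add: x_form_def)
  qed
  have pq: "p \<in> mirror ?r" "q \<in> mirror ?r" using m by (simp_all add: mirror_of_def)
  have nprop: "\<phi> 2 p * \<phi> 0 q \<noteq> \<phi> 2 q * \<phi> 0 p"
  proof
    assume pr: "\<phi> 2 p * \<phi> 0 q = \<phi> 2 q * \<phi> 0 p"
    have comb: "\<exists>\<beta> \<gamma>. ?x i p = \<beta> * \<phi> 0 p + \<gamma> * \<phi> 2 p \<and> ?x i q = \<beta> * \<phi> 0 q + \<gamma> * \<phi> 2 q" for i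
    proof -
      have "?x i p = (if i = 2 then - 3 else 1) * \<phi> 0 p + (if i = 1 \<or> i = 2 then 2 else - 2) * \<phi> 2 p
        \<and> ?x i q = (if i = 2 then - 3 else 1) * \<phi> 0 q + (if i = 1 \<or> i = 2 then 2 else - 2) * \<phi> 2 q"
        using eq[OF pq(1)] eq[OF pq(2)] by (simp add: x_form_def)
      then show ?thesis by blast
    qed
    obtain i j where ij: "?x i p * ?x j q \<noteq> ?x j p * ?x i q" using m by (auto simp: mirror_of_def)
    obtain \<beta> \<gamma> where i: "?x i p = \<beta> * \<phi> 0 p + \<gamma> * \<phi> 2 p" "?x i q = \<beta> * \<phi> 0 q + \<gamma> * \<phi> 2 q"
      using comb by blast
    obtain \<beta>' \<gamma>' where j: "?x j p = \<beta>' * \<phi> 0 p + \<gamma>' * \<phi> 2 p" "?x j q = \<beta>' * \<phi> 0 q + \<gamma>' * \<phi> 2 q"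
      using comb by blast
    have "?x i p * ?x j q - ?x j p * ?x i q
        = (\<gamma> * \<beta>' - \<beta> * \<gamma>') * (\<phi> 2 p * \<phi> 0 q - \<phi> 2 q * \<phi> 0 p)"
      unfolding i j by (simp add: algebra_simps)
    also have "\<dots> = 0" using pr by simp
    finally show False using ij by simp
  qed
  obtain v1 v2 where v: "p = (0, v1)" "q = (0, v2)"
    using pq mirror by (metis prod.collapse)
  have "\<phi> 1 b - \<phi> 2 b = 0" if "b \<in> ball2" for b
  proof (rule jac_zero_imp_zero[of "\<lambda>b. \<phi> 1 b - \<phi> 2 b" "\<phi> 2" "\<phi> 0" v1 v2 b])
    fix b assume b: "b \<in> ball2"
    have "jac (\<lambda>b. \<phi> 1 b - \<phi> 2 b) (\<phi> 2) (\<phi> 0) b = jac (\<phi> 0) (\<phi> 1) (\<phi> 2) b"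
      unfolding jac_def grad_diff[OF hol(2,3) b] wedge_def by (simp add: algebra_simps)
    then show "jac (\<lambda>b. \<phi> 1 b - \<phi> 2 b) (\<phi> 2) (\<phi> 0) b = 0" using zero[OF b] by simp
  next
    fix v assume "(0, v) \<in> ball2"
    then show "\<phi> 1 (0, v) - \<phi> 2 (0, v) = 0" using eq mirror by simp
  qed (use hol pq mirror v nprop that in \<open>auto intro: holomorphic2_on_diff\<close>)
  then have eq': "?x 3 b = ?x 4 b" if "b \<in> ball2" for b using that by (simp add: x_form_def)
  have "\<exists>r p q. mirror_of \<phi> 3 1 r p q" by (rule mirror_of_exists[OF eps equiv FJ]) auto
  then obtain r p q where m: "mirror_of \<phi> 3 1 r p q" by blast
  have "?x 3 p \<noteq> ?x 4 p \<or> ?x 3 q \<noteq> ?x 4 q"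
    by (rule difference_nonzero_on_mirror[OF m]) (auto simp: doubleton_eq_iff)
  then show False using eq' m by (auto simp: mirror_of_def mirror_def)
qed

definition Phi4 :: "(nat \<Rightarrow> complex \<times> complex \<Rightarrow> complex) \<Rightarrow> nat \<Rightarrow> complex \<times> complex \<Rightarrow> complex^2" where
  "Phi4 \<phi> i b = (if i < 3 then Phi \<phi> i b else Phi \<phi> 0 b + Phi \<phi> 1 b + Phi \<phi> 2 b)"

lemma eis_num_eq: "eis_num \<phi> i b = symv 3 (Phi4 \<phi> i b)"
  by (simp add: eis_num_def Phi4_def)

lemma Phi4_act:
  assumes phi: "\<And>i. i < 3 \<Longrightarrow> \<phi> i \<in> scalar_forms 3" and g: "g \<in> Gam_sqrt" "b \<in> ball2"
  shows "Phi4 \<phi> i (act g b) = (j1 g b ^ 7) *s (j2 g b *v Phi4 \<phi> i b)"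
proof -
  have "Phi \<phi> l (act g b) = (j1 g b ^ 7) *s (j2 g b *v Phi \<phi> l b)" for l
  proof -
    have "bracket 3 3 (\<phi> ((l + 1) mod 3)) (\<phi> ((l + 2) mod 3)) (act g b) =
        (j1 g b ^ 7) *s (j2 g b *v bracket 3 3 (\<phi> ((l + 1) mod 3)) (\<phi> ((l + 2) mod 3)) b)"
      by (intro bracket_act phi g) simp_all
    then show ?thesis
      unfolding Phi_def
      by (simp add: vec_eq_iff forall_2 matrix_vector_mult_def sum_2 algebra_simps add_divide_distrib)
  qed
  then show ?thesis
    by (simp add: Phi4_def vec_eq_iff forall_2 matrix_vector_mult_def sum_2 algebra_simps)
qed

lemma wedge_mult: "wedge (c *s (A *v x)) (c *s (A *v y)) = c\<^sup>2 * det A * wedge x y"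
  by (simp add: wedge_def det_2 matrix_vector_mult_def sum_2 power2_eq_square algebra_simps)

text \<open>The fourth vector being the sum of the others, every wedge product is the Jacobian times a linear
  form in the generators.\<close>

lemma wedge_Phi4:
  defines "\<kappa> \<equiv> (- 1 / (18 * pi * \<i>))\<^sup>2 :: complex"
  shows "wedge (Phi4 \<phi> 0 b) (Phi4 \<phi> 1 b) = \<kappa> * jac (\<phi> 0) (\<phi> 1) (\<phi> 2) b * \<phi> 2 b" (is ?t1)
    "wedge (Phi4 \<phi> 0 b) (Phi4 \<phi> 2 b) = - \<kappa> * jac (\<phi> 0) (\<phi> 1) (\<phi> 2) b * \<phi> 1 b" (is ?t2)
    "wedge (Phi4 \<phi> 0 b) (Phi4 \<phi> 3 b) = \<kappa> * jac (\<phi> 0) (\<phi> 1) (\<phi> 2) b * (\<phi> 2 b - \<phi> 1 b)" (is ?t3)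
    "wedge (Phi4 \<phi> 1 b) (Phi4 \<phi> 2 b) = \<kappa> * jac (\<phi> 0) (\<phi> 1) (\<phi> 2) b * \<phi> 0 b" (is ?t4)
    "wedge (Phi4 \<phi> 1 b) (Phi4 \<phi> 3 b) = \<kappa> * jac (\<phi> 0) (\<phi> 1) (\<phi> 2) b * (\<phi> 0 b - \<phi> 2 b)" (is ?t5)
    "wedge (Phi4 \<phi> 2 b) (Phi4 \<phi> 3 b) = \<kappa> * jac (\<phi> 0) (\<phi> 1) (\<phi> 2) b * (\<phi> 1 b - \<phi> 0 b)" (is ?t6)
proof -
  define \<mu> :: complex where "\<mu> = - 1 / (18 * pi * \<i>)"
  have \<kappa>: "\<kappa> = \<mu> * \<mu>" by (simp add: assms \<mu>_def power2_eq_square)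
  have Phi: "Phi \<phi> i b $ l = \<mu> * (\<phi> ((i + 1) mod 3) b * grad (\<phi> ((i + 2) mod 3)) b $ l
      - \<phi> ((i + 2) mod 3) b * grad (\<phi> ((i + 1) mod 3)) b $ l)" for i l
    by (simp add: Phi_def bracket_def \<mu>_def field_simps)
  have m: "Suc (Suc 0) mod 3 = 2" "(3::nat) mod 3 = 0" "(4::nat) mod 3 = 1" by simp_all
  note defs = \<kappa> wedge_def Phi4_def Phi jac_def m
  show ?t1 ?t2 ?t3 ?t4 ?t5 ?t6
    by (simp_all add: defs algebra_simps)
qed

lemma discr_eq:
  "discr \<phi> b = 4096 * (\<phi> 0 b * \<phi> 1 b * \<phi> 2 b
    * ((\<phi> 1 b - \<phi> 0 b) * (\<phi> 2 b - \<phi> 0 b) * (\<phi> 2 b - \<phi> 1 b)))"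
proof -
  have d: "x_form \<phi> 1 b - x_form \<phi> 2 b = 4 * \<phi> 0 b" "x_form \<phi> 1 b - x_form \<phi> 3 b = 4 * \<phi> 1 b"
    "x_form \<phi> 1 b - x_form \<phi> 4 b = 4 * \<phi> 2 b" "x_form \<phi> 2 b - x_form \<phi> 3 b = 4 * (\<phi> 1 b - \<phi> 0 b)"
    "x_form \<phi> 2 b - x_form \<phi> 4 b = 4 * (\<phi> 2 b - \<phi> 0 b)" "x_form \<phi> 3 b - x_form \<phi> 4 b = 4 * (\<phi> 2 b - \<phi> 1 b)"
    by (simp_all add: x_form_def)
  have "discr \<phi> b = (4 * \<phi> 0 b) * ((4 * \<phi> 1 b) * ((4 * \<phi> 2 b) * ((4 * (\<phi> 1 b - \<phi> 0 b))
      * ((4 * (\<phi> 2 b - \<phi> 0 b)) * (4 * (\<phi> 2 b - \<phi> 1 b))))))"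
    unfolding d[symmetric] by (simp add: discr_def pairs_def)
  moreover have "(4 * x) * ((4 * y) * ((4 * z) * ((4 * p) * ((4 * q) * (4 * r))))) = 4096 * (x * y * z * (p * q * r))"
    for x y z p q r :: complex by simp
  ultimately show ?thesis by (simp only:)
qed

lemma nat_less_4_cases:
  assumes "i < (4::nat)"
  obtains "i = 0" | "i = 1" | "i = 2" | "i = 3"
proof -
  have "i \<le> 3" using assms by presburger
  then show thesis using that by (rule nat_le_3_cases)
qed

lemma eis_den_eq:
  "eis_den \<phi> 0 b = (\<phi> 1 b * \<phi> 2 b * (\<phi> 1 b - \<phi> 2 b))\<^sup>2" (is ?t0)
  "eis_den \<phi> 1 b = (\<phi> 2 b * \<phi> 0 b * (\<phi> 2 b - \<phi> 0 b))\<^sup>2" (is ?t1)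
  "eis_den \<phi> 2 b = (\<phi> 0 b * \<phi> 1 b * (\<phi> 0 b - \<phi> 1 b))\<^sup>2" (is ?t2)
  "eis_den \<phi> 3 b = ((\<phi> 0 b - \<phi> 1 b) * (\<phi> 0 b - \<phi> 2 b) * (\<phi> 1 b - \<phi> 2 b))\<^sup>2" (is ?t3)
proof -
  have m: "Suc (Suc 0) mod 3 = 2" "(3::nat) mod 3 = 0" "(4::nat) mod 3 = 1" by simp_all
  show ?t0 ?t1 ?t2 ?t3
    by (simp_all add: eis_den_def m)
qed

lemma eis_den_nonzero:
  assumes "discr \<phi> b \<noteq> 0" "i < 4"
  shows "eis_den \<phi> i b \<noteq> 0"
  using assms(2) assms(1)[unfolded discr_eq]
  by (cases rule: nat_less_4_cases) (simp_all only: eis_den_eq, auto)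

lemma eis_den_act:
  assumes phi: "\<And>i. i < 3 \<Longrightarrow> \<phi> i \<in> scalar_forms 3" and g: "g \<in> Gam_sqrt" "b \<in> ball2" and "i < 4"
  shows "eis_den \<phi> i (act g b) = j1 g b ^ 18 * eis_den \<phi> i b"
proof -
  define j where "j = j1 g b"
  have v: "\<phi> l (act g b) = j ^ 3 * \<phi> l b" if "l < 3" for l
    using scalar_formD(3)[OF phi[OF that] g] by (simp add: j_def)
  have sq: "(j ^ 3 * x * (j ^ 3 * y) * (j ^ 3 * x' - j ^ 3 * y'))\<^sup>2 = j ^ 18 * (x * y * (x' - y'))\<^sup>2"
    "((j ^ 3 * x - j ^ 3 * y) * (j ^ 3 * x - j ^ 3 * z) * (j ^ 3 * y - j ^ 3 * z))\<^sup>2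
      = j ^ 18 * ((x - y) * (x - z) * (y - z))\<^sup>2" for x y x' y' z
  proof -
    have j18: "j ^ 18 = (j ^ 3 * j ^ 3 * j ^ 3)\<^sup>2" by (simp flip: power_add power_mult)
    have "t * x * (t * y) * (t * x' - t * y') = t * t * t * (x * y * (x' - y'))"
      "(t * x - t * y) * (t * x - t * z) * (t * y - t * z) = t * t * t * ((x - y) * (x - z) * (y - z))" for t
      by (simp_all add: algebra_simps)
    then show "(j ^ 3 * x * (j ^ 3 * y) * (j ^ 3 * x' - j ^ 3 * y'))\<^sup>2 = j ^ 18 * (x * y * (x' - y'))\<^sup>2"
      "((j ^ 3 * x - j ^ 3 * y) * (j ^ 3 * x - j ^ 3 * z) * (j ^ 3 * y - j ^ 3 * z))\<^sup>2
      = j ^ 18 * ((x - y) * (x - z) * (y - z))\<^sup>2"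
      unfolding j18 by (simp_all only: power_mult_distrib)
  qed
  from \<open>i < 4\<close> show ?thesis
    by (cases rule: nat_less_4_cases; simp only: eis_den_eq; simp only: v zero_less_numeral
        one_less_numeral_iff numeral_less_iff semiring_norm sq j_def[symmetric])
qed

text \<open>The quotient transforms as it should where the denominator does not vanish, hence everywhere.\<close>

lemma eisenstein_modular_form:
  assumes phi: "\<And>i. i < 3 \<Longrightarrow> \<phi> i \<in> scalar_forms 3"
    and cancel: "\<And>G z. holomorphic2_on G ball2 \<Longrightarrow> (\<And>z. z \<in> ball2 \<Longrightarrow> discr \<phi> z * G z = 0)
      \<Longrightarrow> z \<in> ball2 \<Longrightarrow> G z = 0"
    and E: "is_eisenstein \<phi> i E" and i: "i < 4"
  shows "E \<in> modular_forms 3 3"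
proof -
  have hol: "\<And>m. m \<le> 3 \<Longrightarrow> holomorphic2_on (\<lambda>b. E b m) ball2"
    and out: "\<And>b m. b \<notin> ball2 \<or> 3 < m \<Longrightarrow> E b m = 0"
    and val: "\<And>b m. b \<in> ball2 \<Longrightarrow> eis_den \<phi> i b \<noteq> 0 \<Longrightarrow> E b m = eis_num \<phi> i b m / eis_den \<phi> i b"
    using E unfolding is_eisenstein_def holo_maps_def by auto
  have "slash 3 3 g E = E" if g: "g \<in> Gam_sqrt" for g
  proof (intro ext)
    fix b and m :: nat
    have gG: "g \<in> Gam" using g by (simp add: Gam_sqrt_def)
    consider "b \<notin> ball2" | "3 < m" | "b \<in> ball2" "m \<le> 3" by linarith
    then show "slash 3 3 g E b m = E b m"
    proof cases
      case 1
      then show ?thesis using out by (simp add: slash_def)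
    next
      case 2
      then show ?thesis using out is_symm_symm[of 3] by (simp add: slash_def is_symm_def)
    next
      case 3
      define G where "G = (\<lambda>b. j1 g b powi (- 3) *
        (\<Sum>n\<le>3. symm 3 (matrix_inv (j2 g b)) m n * E (act g b) n) - E b m)"
      have "G b = 0"
      proof (rule cancel[OF _ _ 3(1)])
        show "holomorphic2_on G ball2"
          unfolding G_def
          by (intro holomorphic2_on_diff holomorphic2_on_mult holomorphic2_on_sum
              holomorphic2_on_power_int holomorphic2_on_j1 holomorphic2_on_symm_j2[OF gG]
              holomorphic2_on_compose_act[OF gG] hol)
            (use 3 j1_neq_0[OF gG] in auto)
        fix b assume b: "b \<in> ball2"
        show "discr \<phi> b * G b = 0"
        proof (cases "discr \<phi> b = 0")
          case False
          define j where "j = j1 g b"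
          have j: "j \<noteq> 0" unfolding j_def by (rule j1_neq_0[OF gG b])
          have den: "eis_den \<phi> i b \<noteq> 0" by (rule eis_den_nonzero[OF False i])
          have den_act: "eis_den \<phi> i (act g b) = j ^ 18 * eis_den \<phi> i b"
            unfolding j_def by (rule eis_den_act[OF phi g b i])
          define A where "A = j2 g b"
          have dA: "det A \<noteq> 0" unfolding A_def by (rule det_j2_nonzero[OF gG b])
          have inv: "matrix_inv A *v (A *v x) = x" for x
          proof -
            have "matrix_inv A ** A = mat 1"
              unfolding matrix_inv_2[OF dA] using dA
              by (simp add: vec_eq_iff forall_2 matrix_matrix_mult_def sum_2 mat_def divide_simps)
                (simp add: det_2 algebra_simps)
            then show ?thesis by (simp add: matrix_vector_mul_assoc)
          qed
          have "E (act g b) n = symv 3 (j ^ 7 *s (A *v Phi4 \<phi> i b)) n / (j ^ 18 * eis_den \<phi> i b)" for n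
            using val[OF act_in_ball2[OF gG b], of n] den j
            by (simp add: den_act eis_num_eq Phi4_act[OF phi g b] j_def A_def)
          then have "(\<Sum>n\<le>3. symm 3 (matrix_inv A) m n * E (act g b) n)
              = (\<Sum>n\<le>3. symm 3 (matrix_inv A) m n * symv 3 (j ^ 7 *s (A *v Phi4 \<phi> i b)) n)
                / (j ^ 18 * eis_den \<phi> i b)"
            by (simp add: sum_divide_distrib)
          also have "\<dots> = symv 3 (j ^ 7 *s Phi4 \<phi> i b) m / (j ^ 18 * eis_den \<phi> i b)"
            unfolding symm_symv by (simp add: inv vector_scalar_commute)
          also have "\<dots> = j ^ 3 * E b m"
          proof -
            have p: "(j ^ 7) ^ 3 = j ^ 18 * j ^ 3" by (simp flip: power_add power_mult)
            have cancel_left: "t * s * x / (t * y) = s * (x / y)" if "t \<noteq> 0" for t s x y :: complex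
              using that by simp
            show ?thesis
              unfolding symv_scale val[OF b den] eis_num_eq p by (rule cancel_left) (use j in simp)
          qed
          finally have "G b = 0"
            unfolding G_def A_def[symmetric] j_def[symmetric] using j by (simp add: power_int_minus)
          then show ?thesis by simp
        qed simp
      qed
      then show ?thesis using 3(1) by (simp add: slash_def G_def)
    qed
  qed
  then show ?thesis using E by (simp add: modular_forms_def is_eisenstein_def)
qed

lemma det4_coefficients_zero:
  assumes "\<And>i. i \<le> 3 \<Longrightarrow> a * A i + b * B i + c * C i + d * D i = 0"
  shows "det4 A B C D * a = 0" "det4 A B C D * b = 0" "det4 A B C D * c = 0" "det4 A B C D * d = 0"
proof -
  define V where "V = (\<lambda>i. a * A i + b * B i + c * C i + d * D i)"
  have V: "V 0 = 0" "V 1 = 0" "V 2 = 0" "V 3 = 0" unfolding V_def by (rule assms; simp)+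
  have "det4 A B C D * a = det4 V B C D" "det4 A B C D * b = det4 A V C D"
    "det4 A B C D * c = det4 A B V D" "det4 A B C D * d = det4 A B C V"
    unfolding det4_def Let_def V_def by (simp_all add: algebra_simps)
  moreover have "det4 V B C D = 0" "det4 A V C D = 0" "det4 A B V D = 0" "det4 A B C V = 0"
    unfolding det4_def Let_def V by simp_all
  ultimately show "det4 A B C D * a = 0" "det4 A B C D * b = 0" "det4 A B C D * c = 0" "det4 A B C D * d = 0"
    by simp_all
qed

lemma holomorphic2_on_det4:
  assumes "\<And>V i. V \<in> {F, G, H, K} \<Longrightarrow> i \<le> 3 \<Longrightarrow> holomorphic2_on (\<lambda>b. V b i) S"
  shows "holomorphic2_on (\<lambda>b. det4 (F b) (G b) (H b) (K b)) S"
  unfolding det4_def Let_def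
  by (intro holomorphic2_on_add holomorphic2_on_diff holomorphic2_on_mult assms) simp_all

text \<open>Each of the six wedge products has weight \<open>14\<close> and the multiplier \<open>det j2\<close>, that is, weight
  \<open>15\<close> up to a sixth root of unity; the denominators have total weight \<open>72\<close>, and \<open>6 \<cdot> 15 - 72 = 18\<close>.\<close>

lemma det4_eisenstein_scalar_form:
  assumes phi: "\<And>i. i < 3 \<Longrightarrow> \<phi> i \<in> scalar_forms 3"
    and cancel: "\<And>G z. holomorphic2_on G ball2 \<Longrightarrow> (\<And>z. z \<in> ball2 \<Longrightarrow> discr \<phi> z * G z = 0)
      \<Longrightarrow> z \<in> ball2 \<Longrightarrow> G z = 0"
    and E: "\<And>i. i < 4 \<Longrightarrow> is_eisenstein \<phi> i (E i)"
  shows "(\<lambda>b. det4 (E 0 b) (E 1 b) (E 2 b) (E 3 b)) \<in> scalar_forms 18"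
    and "\<And>b. b \<in> ball2 \<Longrightarrow> discr \<phi> b \<noteq> 0 \<Longrightarrow> jac (\<phi> 0) (\<phi> 1) (\<phi> 2) b \<noteq> 0
      \<Longrightarrow> det4 (E 0 b) (E 1 b) (E 2 b) (E 3 b) \<noteq> 0"
proof -
  let ?d = "\<lambda>b. det4 (E 0 b) (E 1 b) (E 2 b) (E 3 b)"
  let ?w = "\<lambda>b. wedge (Phi4 \<phi> 0 b) (Phi4 \<phi> 1 b) * wedge (Phi4 \<phi> 0 b) (Phi4 \<phi> 2 b)
      * wedge (Phi4 \<phi> 0 b) (Phi4 \<phi> 3 b) * wedge (Phi4 \<phi> 1 b) (Phi4 \<phi> 2 b)
      * wedge (Phi4 \<phi> 1 b) (Phi4 \<phi> 3 b) * wedge (Phi4 \<phi> 2 b) (Phi4 \<phi> 3 b)"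
  let ?e = "\<lambda>b. eis_den \<phi> 0 b * eis_den \<phi> 1 b * eis_den \<phi> 2 b * eis_den \<phi> 3 b"
  have d_eq: "?d b * ?e b = ?w b" "?e b \<noteq> 0" if b: "b \<in> ball2" "discr \<phi> b \<noteq> 0" for b
  proof -
    have den: "eis_den \<phi> i b \<noteq> 0" if "i < 4" for i by (rule eis_den_nonzero[OF b(2) that])
    show "?e b \<noteq> 0" using den by simp
    have "symv 3 (Phi4 \<phi> i b) = (\<lambda>m. eis_den \<phi> i b * E i b m)" if "i < 4" for i
    proof
      fix m
      have "E i b m = eis_num \<phi> i b m / eis_den \<phi> i b"
        using E[OF that] b(1) den[OF that] unfolding is_eisenstein_def by blast
      then show "symv 3 (Phi4 \<phi> i b) m = eis_den \<phi> i b * E i b m"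
        using den[OF that] by (simp add: eis_num_eq)
    qed
    then have "det4 (symv 3 (Phi4 \<phi> 0 b)) (symv 3 (Phi4 \<phi> 1 b)) (symv 3 (Phi4 \<phi> 2 b)) (symv 3 (Phi4 \<phi> 3 b))
        = ?e b * ?d b"
      by (simp add: det4_scale)
    then show "?d b * ?e b = ?w b" unfolding det4_symv by (simp add: mult.commute)
  qed
  have hol: "holomorphic2_on ?d ball2"
    by (rule holomorphic2_on_det4) (use E in \<open>auto simp: is_eisenstein_def holo_maps_def\<close>)
  show "?d \<in> scalar_forms 18"
  proof (rule scalar_formI[OF hol])
    fix b assume "b \<notin> ball2"
    then have "E i b m = 0" if "i < 4" for i m
      using E[OF that] unfolding is_eisenstein_def holo_maps_def by blast
    then show "?d b = 0" by (simp add: det4_def)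
  next
    fix g b assume g: "g \<in> Gam_sqrt" and b: "b \<in> ball2"
    have gG: "g \<in> Gam" using g by (simp add: Gam_sqrt_def)
    have "?d (act g b) - j1 g b ^ 18 * ?d b = 0"
    proof (rule cancel[of "\<lambda>b. ?d (act g b) - j1 g b ^ 18 * ?d b", OF _ _ b])
      show "holomorphic2_on (\<lambda>b. ?d (act g b) - j1 g b ^ 18 * ?d b) ball2"
        by (intro holomorphic2_on_diff holomorphic2_on_mult holomorphic2_on_power holomorphic2_on_j1
            hol holomorphic2_on_compose_act[OF gG hol])
      fix b assume b: "b \<in> ball2"
      show "discr \<phi> b * (?d (act g b) - j1 g b ^ 18 * ?d b) = 0"
      proof (cases "discr \<phi> b = 0")
        case False
        define j t where "j = j1 g b" and "t = det g"
        have j: "j \<noteq> 0" unfolding j_def by (rule j1_neq_0[OF gG b])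
        have t: "t ^ 6 = 1" "t \<noteq> 0" using det_Gam[OF gG] by (simp_all add: t_def)
        have v: "\<phi> l (act g b) = j ^ 3 * \<phi> l b" if "l < 3" for l
          using scalar_formD(3)[OF phi[OF that] g b] by (simp add: j_def)
        have disc: "discr \<phi> (act g b) = j ^ 18 * discr \<phi> b"
        proof -
          have "(s * x) * (s * y) * (s * z) * ((s * y - s * x) * (s * z - s * x) * (s * z - s * y))
              = s ^ 6 * (x * y * z * ((y - x) * (z - x) * (z - y)))" for s x y z :: complex
            by (simp add: eval_nat_numeral algebra_simps)
          from this[of "j ^ 3"] show ?thesis
            unfolding discr_eq by (simp add: v flip: power_mult)
        qed
        have act: "discr \<phi> (act g b) \<noteq> 0" "act g b \<in> ball2"
          using False j act_in_ball2[OF gG b] by (simp_all add: disc)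
        have W: "wedge (Phi4 \<phi> l (act g b)) (Phi4 \<phi> m (act g b)) = j ^ 15 / t * wedge (Phi4 \<phi> l b) (Phi4 \<phi> m b)" for l m
        proof -
          have "j ^ (7 * 2 + 1) = (j ^ 7)\<^sup>2 * j" by (simp only: power_add power_mult power_one_right)
          then have p: "(j ^ 7)\<^sup>2 * (j / t) = j ^ 15 / t" by simp
          have "Phi4 \<phi> l (act g b) = (j1 g b ^ 7) *s (j2 g b *v Phi4 \<phi> l b)" for l
            by (rule Phi4_act[OF phi g b])
          then show ?thesis
            by (simp only: wedge_mult det_j2[OF gG] j_def[symmetric] t_def[symmetric] p)
        qed
        have e: "?e (act g b) = j ^ 72 * ?e b"
        proof -
          have "j ^ 72 = j ^ 18 * j ^ 18 * j ^ 18 * j ^ 18" by (simp flip: power_add)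
          then show ?thesis
            using eis_den_act[OF phi g b] by (simp add: j_def mult_ac)
        qed
        have factor: "(s * p) * (s * q) * (s * r) * (s * x) * (s * y) * (s * z) = s ^ 6 * (p * q * r * x * y * z)"
          for s p q r x y z :: complex
          by (simp add: eval_nat_numeral mult_ac)
        have "(?d (act g b) * j ^ 72) * ?e b = ?w (act g b)"
          using d_eq(1)[OF act(2,1)] unfolding e by (simp add: mult_ac)
        also have "\<dots> = (j ^ 15 / t) ^ 6 * ?w b"
          unfolding W by (rule factor)
        also have "(j ^ 15 / t) ^ 6 = j ^ 18 * j ^ 72"
          using t by (simp add: power_divide flip: power_mult power_add)
        also have "?w b = ?d b * ?e b" using d_eq(1)[OF b False] by simp
        finally have "?e b * j ^ 72 * ?d (act g b) = ?e b * j ^ 72 * (j ^ 18 * ?d b)"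
          by (simp only: mult_ac)
        then have "?d (act g b) = j ^ 18 * ?d b"
          using j d_eq(2)[OF b False] by (simp only: mult_cancel_left) simp
        then show ?thesis by (simp add: j_def)
      qed simp
    qed
    then show "?d (act g b) = j1 g b powi 18 * ?d b" by simp
  qed
  show "?d b \<noteq> 0" if "b \<in> ball2" "discr \<phi> b \<noteq> 0" "jac (\<phi> 0) (\<phi> 1) (\<phi> 2) b \<noteq> 0" for b
  proof -
    have "?w b \<noteq> 0"
      unfolding wedge_Phi4 using that(2,3) by (auto simp: discr_eq)
    then show ?thesis using d_eq(1)[OF that(1,2)] by auto
  qed
qed

section \<open>Generation\<close>

text \<open>At a point and at its image the form \<open>F\<close> is expressed by the \<open>E\<^sub>l\<close>; the linear map that carries one
  set of values to the other gives a second expression at the point itself, and the \<open>E\<^sub>l\<close> are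
  independent where \<open>\<Delta> \<noteq> 0\<close>.\<close>

lemma cramer_coefficients_automorphic:
  fixes E :: "nat \<Rightarrow> complex \<times> complex \<Rightarrow> nat \<Rightarrow> complex"
  assumes E: "\<And>i. i < 4 \<Longrightarrow> E i \<in> modular_forms 3 3"
    and d: "(\<lambda>b. det4 (E 0 b) (E 1 b) (E 2 b) (E 3 b)) \<in> scalar_forms 18"
    and nz: "b0 \<in> ball2" "det4 (E 0 b0) (E 1 b0) (E 2 b0) (E 3 b0) \<noteq> 0"
    and F: "F \<in> modular_forms 3 k"
  shows "(\<lambda>b. det4 (F b) (E 1 b) (E 2 b) (E 3 b)) \<in> scalar_forms (k + 15)" (is "?N0 \<in> _")
    "(\<lambda>b. det4 (E 0 b) (F b) (E 2 b) (E 3 b)) \<in> scalar_forms (k + 15)" (is "?N1 \<in> _")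
    "(\<lambda>b. det4 (E 0 b) (E 1 b) (F b) (E 3 b)) \<in> scalar_forms (k + 15)" (is "?N2 \<in> _")
    "(\<lambda>b. det4 (E 0 b) (E 1 b) (E 2 b) (F b)) \<in> scalar_forms (k + 15)" (is "?N3 \<in> _")
proof -
  let ?d = "\<lambda>b. det4 (E 0 b) (E 1 b) (E 2 b) (E 3 b)"
  have forms: "E 0 \<in> modular_forms 3 3" "E 1 \<in> modular_forms 3 3" "E 2 \<in> modular_forms 3 3" "E 3 \<in> modular_forms 3 3"
    by (auto intro!: E)
  have hol: "holomorphic2_on (\<lambda>b. V b i) ball2" if "V \<in> {F, E 0, E 1, E 2, E 3}" "i \<le> 3" for V i
    using that modular_formD(1)[OF F] forms[THEN modular_formD(1)] by auto
  have N_hol: "holomorphic2_on ?N0 ball2" "holomorphic2_on ?N1 ball2" "holomorphic2_on ?N2 ball2" "holomorphic2_on ?N3 ball2"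
    by (rule holomorphic2_on_det4; rule hol; blast)+
  have out: "V b i = 0" if "b \<notin> ball2" "V \<in> {F, E 0, E 1, E 2, E 3}" for V b i
    using that modular_forms_outside[OF F that(1)] forms[THEN modular_forms_outside, OF that(1)]
    by (elim insertE emptyE) (simp_all only:)
  have key: "?d b * (?N0 (act g b) - j1 g b powi (k + 15) * ?N0 b) = 0
      \<and> ?d b * (?N1 (act g b) - j1 g b powi (k + 15) * ?N1 b) = 0
      \<and> ?d b * (?N2 (act g b) - j1 g b powi (k + 15) * ?N2 b) = 0
      \<and> ?d b * (?N3 (act g b) - j1 g b powi (k + 15) * ?N3 b) = 0"
    if g: "g \<in> Gam_sqrt" and b: "b \<in> ball2" for g b
  proof -
    define j where "j = j1 g b"
    have j: "j \<noteq> 0" unfolding j_def by (rule j1_nonzero[OF g b])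
    define S where "S = (\<lambda>V i. \<Sum>m\<le>3. symm 3 (matrix_inv (j2 g b)) i m * V m)"
    have S_F: "S (F (act g b)) i = j powi k * F b i" for i
      using modular_formD(3)[OF F g b, of i] by (simp add: S_def j_def)
    have S_E: "S (E l (act g b)) i = j ^ 3 * E l b i" if "l < 4" for l i
      using modular_formD(3)[OF E[OF that] g b, of i] by (simp add: S_def j_def)
    have d_act: "?d (act g b) = j ^ 18 * ?d b"
      using scalar_formD(3)[OF d g b] by (simp add: j_def)
    have "(?N0 (act g b) - j powi (k + 15) * ?N0 b) * E 0 b i + (?N1 (act g b) - j powi (k + 15) * ?N1 b) * E 1 b i
        + (?N2 (act g b) - j powi (k + 15) * ?N2 b) * E 2 b i + (?N3 (act g b) - j powi (k + 15) * ?N3 b) * E 3 b i = 0"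
      if i: "i \<le> 3" for i
    proof -
      let ?a = "act g b"
      have SE: "S (E 0 ?a) i = j ^ 3 * E 0 b i" "S (E 1 ?a) i = j ^ 3 * E 1 b i"
        "S (E 2 ?a) i = j ^ 3 * E 2 b i" "S (E 3 ?a) i = j ^ 3 * E 3 b i"
        by (rule S_E; simp)+
      have "?d ?a * S (F ?a) i = (\<Sum>m\<le>3. symm 3 (matrix_inv (j2 g b)) i m * (?d ?a * F ?a m))"
        unfolding S_def sum_distrib_left by (intro sum.cong refl) (simp only: mult_ac)
      also have "\<dots> = (\<Sum>m\<le>3. symm 3 (matrix_inv (j2 g b)) i m
          * (?N0 ?a * E 0 ?a m + ?N1 ?a * E 1 ?a m + ?N2 ?a * E 2 ?a m + ?N3 ?a * E 3 ?a m))"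
        by (intro sum.cong refl, subst det4_cramer) auto
      also have "\<dots> = ?N0 ?a * S (E 0 ?a) i + ?N1 ?a * S (E 1 ?a) i + ?N2 ?a * S (E 2 ?a) i + ?N3 ?a * S (E 3 ?a) i"
        unfolding S_def sum_distrib_left sum.distrib[symmetric]
        by (intro sum.cong refl) (simp only: distrib_left mult_ac)
      finally have "j ^ 18 * ?d b * (j powi k * F b i) = ?N0 ?a * (j ^ 3 * E 0 b i) + ?N1 ?a * (j ^ 3 * E 1 b i)
          + ?N2 ?a * (j ^ 3 * E 2 b i) + ?N3 ?a * (j ^ 3 * E 3 b i)"
        unfolding S_F SE d_act .
      moreover have "j ^ 18 * ?d b * (j powi k * F b i) = j ^ 3 * (j powi (k + 15) * (?d b * F b i))"
      proof -
        have "j powi (k + 15) = j powi k * j ^ 15" using j by (simp add: power_int_add)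
        moreover have "j ^ 18 = j ^ 3 * j ^ 15" by (simp flip: power_add)
        ultimately show ?thesis by (simp only: mult_ac)
      qed
      ultimately have "?N0 ?a * (j ^ 3 * E 0 b i) + ?N1 ?a * (j ^ 3 * E 1 b i)
          + ?N2 ?a * (j ^ 3 * E 2 b i) + ?N3 ?a * (j ^ 3 * E 3 b i) = j ^ 3 * (j powi (k + 15) * (?d b * F b i))"
        by (simp only:)
      also have "?d b * F b i = ?N0 b * E 0 b i + ?N1 b * E 1 b i + ?N2 b * E 2 b i + ?N3 b * E 3 b i"
        by (rule det4_cramer[OF i])
      finally have eq: "?N0 ?a * (j ^ 3 * E 0 b i) + ?N1 ?a * (j ^ 3 * E 1 b i)
          + ?N2 ?a * (j ^ 3 * E 2 b i) + ?N3 ?a * (j ^ 3 * E 3 b i)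
          = j ^ 3 * (j powi (k + 15) * (?N0 b * E 0 b i + ?N1 b * E 1 b i + ?N2 b * E 2 b i + ?N3 b * E 3 b i))" .
      have rearrange: "t * ((x0 - w * y0) * e0 + (x1 - w * y1) * e1 + (x2 - w * y2) * e2 + (x3 - w * y3) * e3) = 0"
        if "x0 * (t * e0) + x1 * (t * e1) + x2 * (t * e2) + x3 * (t * e3)
          = t * (w * (y0 * e0 + y1 * e1 + y2 * e2 + y3 * e3))"
        for t w x0 x1 x2 x3 y0 y1 y2 y3 e0 e1 e2 e3 :: complex
        using that by (simp add: algebra_simps)
      from rearrange[OF eq]
      show ?thesis using j by simp
    qed
    from det4_coefficients_zero[OF this] show ?thesis by (simp add: j_def)
  qed
  have form: "N \<in> scalar_forms (k + 15)"
    if N: "holomorphic2_on N ball2" "\<And>b. b \<notin> ball2 \<Longrightarrow> N b = 0"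
      "\<And>g b. g \<in> Gam_sqrt \<Longrightarrow> b \<in> ball2 \<Longrightarrow> ?d b * (N (act g b) - j1 g b powi (k + 15) * N b) = 0" for N
  proof (rule scalar_formI[OF N(1,2)])
    fix g b assume g: "g \<in> Gam_sqrt" and b: "b \<in> ball2"
    have gG: "g \<in> Gam" using g by (simp add: Gam_sqrt_def)
    have "N (act g b) - j1 g b powi (k + 15) * N b = 0"
    proof (rule holomorphic2_product_zero[OF scalar_formD(1)[OF d] _ N(3)[OF g] nz b])
      show "holomorphic2_on (\<lambda>b. N (act g b) - j1 g b powi (k + 15) * N b) ball2"
        using j1_neq_0[OF gG]
        by (intro holomorphic2_on_diff holomorphic2_on_mult holomorphic2_on_power_int holomorphic2_on_j1
            N(1) holomorphic2_on_compose_act[OF gG N(1)]) auto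
    qed
    then show "N (act g b) = j1 g b powi (k + 15) * N b" by simp
  qed
  show "?N0 \<in> scalar_forms (k + 15)"
  proof (rule form[OF N_hol(1)])
    show "?N0 b = 0" if "b \<notin> ball2" for b by (simp add: det4_def out[OF that])
  qed (use key in blast)
  show "?N1 \<in> scalar_forms (k + 15)"
  proof (rule form[OF N_hol(2)])
    show "?N1 b = 0" if "b \<notin> ball2" for b by (simp add: det4_def out[OF that])
  qed (use key in blast)
  show "?N2 \<in> scalar_forms (k + 15)"
  proof (rule form[OF N_hol(3)])
    show "?N2 b = 0" if "b \<notin> ball2" for b by (simp add: det4_def out[OF that])
  qed (use key in blast)
  show "?N3 \<in> scalar_forms (k + 15)"
  proof (rule form[OF N_hol(4)])
    show "?N3 b = 0" if "b \<notin> ball2" for b by (simp add: det4_def out[OF that])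
  qed (use key in blast)
qed

lemma sum_lessThan_4: "(\<Sum>l<(4::nat). f l) = f 0 + f 1 + f 2 + f 3"
  by (simp add: eval_nat_numeral)

lemma eisenstein_independent:
  fixes E :: "nat \<Rightarrow> complex \<times> complex \<Rightarrow> nat \<Rightarrow> complex" and l :: nat
  assumes E: "\<And>i. i < 4 \<Longrightarrow> E i \<in> modular_forms 3 3"
    and nz: "b0 \<in> ball2" "det4 (E 0 b0) (E 1 b0) (E 2 b0) (E 3 b0) \<noteq> 0"
    and a: "\<And>l. l < 4 \<Longrightarrow> a l \<in> scalar_forms k"
    and zero: "\<And>b m. (\<Sum>l<4. a l b * E l b m) = 0" and l: "l < 4"
  shows "a l = (\<lambda>_. 0)"
proof
  fix b
  let ?d = "\<lambda>b. det4 (E 0 b) (E 1 b) (E 2 b) (E 3 b)"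
  show "a l b = 0"
  proof (cases "b \<in> ball2")
    case True
    have hol: "holomorphic2_on ?d ball2"
    proof (rule holomorphic2_on_det4)
      fix V and i :: nat assume "V \<in> {E 0, E 1, E 2, E 3}" "i \<le> 3"
      then have "V \<in> modular_forms 3 3" using E by auto
      then show "holomorphic2_on (\<lambda>b. V b i) ball2" using \<open>i \<le> 3\<close> by (rule modular_formD(1))
    qed
    show ?thesis
    proof (rule holomorphic2_product_zero[OF hol scalar_formD(1)[OF a[OF l]] _ nz True])
      fix b assume "b \<in> ball2"
      have "a 0 b * E 0 b i + a 1 b * E 1 b i + a 2 b * E 2 b i + a 3 b * E 3 b i = 0" for i
        using zero[of b i] unfolding sum_lessThan_4 .
      from det4_coefficients_zero[OF this] l show "?d b * a l b = 0"
        by (auto elim: nat_less_4_cases)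
    qed
  qed (use scalar_formD(2)[OF a[OF l]] in simp)
qed

text \<open>All four coefficients in Cramer's rule and \<open>\<Delta>\<close> itself are divisible by the discriminant, and the
  quotient of \<open>\<Delta>\<close> is a constant.\<close>

lemma eisenstein_generate:
  fixes E :: "nat \<Rightarrow> complex \<times> complex \<Rightarrow> nat \<Rightarrow> complex"
  assumes gen: "polynomial_generators \<phi>" and phi: "\<And>i. i < 3 \<Longrightarrow> \<phi> i \<in> scalar_forms 3"
    and mirrors: "\<And>a b. a \<in> {1..4} \<Longrightarrow> b \<in> {1..4} \<Longrightarrow> a \<noteq> b \<Longrightarrow> \<exists>r p q. mirror_of \<phi> a b r p q"
    and E: "\<And>i. i < 4 \<Longrightarrow> E i \<in> modular_forms 3 3"
    and d: "(\<lambda>b. det4 (E 0 b) (E 1 b) (E 2 b) (E 3 b)) \<in> scalar_forms 18"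
    and nz: "b0 \<in> ball2" "det4 (E 0 b0) (E 1 b0) (E 2 b0) (E 3 b0) \<noteq> 0"
    and F: "F \<in> modular_forms 3 k"
  shows "\<exists>a. (\<forall>l<4. a l \<in> scalar_forms (k - 3)) \<and> (\<forall>b m. F b m = (\<Sum>l<4. a l b * E l b m))"
proof -
  have forms: "E 0 \<in> modular_forms 3 3" "E 1 \<in> modular_forms 3 3" "E 2 \<in> modular_forms 3 3" "E 3 \<in> modular_forms 3 3"
    by (auto intro!: E)
  have division: "\<exists>N'\<in>scalar_forms (w - 18). \<forall>z\<in>ball2. N z = discr \<phi> z * N' z"
    if "N \<in> scalar_forms w" "\<And>r z. root r \<Longrightarrow> z \<in> mirror r \<Longrightarrow> N z = 0" for N w
    using divide_by_differences[OF gen phi mirrors that pairs_props(1) pairs_props(3)]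
    by (simp add: pairs_props(2) discr_def)
  note coeffs = cramer_coefficients_automorphic[OF E d nz F]
  note zero = det4_zero_on_mirror
  obtain R where R: "R \<in> scalar_forms (18 - 18)"
    "\<And>z. z \<in> ball2 \<Longrightarrow> det4 (E 0 z) (E 1 z) (E 2 z) (E 3 z) = discr \<phi> z * R z"
    using division[OF d] zero[OF _ _ forms] by blast
  obtain n0 where n0: "n0 \<in> scalar_forms (k + 15 - 18)"
    "\<And>z. z \<in> ball2 \<Longrightarrow> det4 (F z) (E 1 z) (E 2 z) (E 3 z) = discr \<phi> z * n0 z"
    using division[OF coeffs(1)] zero[OF _ _ F forms(2-4)] by blast
  obtain n1 where n1: "n1 \<in> scalar_forms (k + 15 - 18)"
    "\<And>z. z \<in> ball2 \<Longrightarrow> det4 (E 0 z) (F z) (E 2 z) (E 3 z) = discr \<phi> z * n1 z"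
    using division[OF coeffs(2)] zero[OF _ _ forms(1) F forms(3,4)] by blast
  obtain n2 where n2: "n2 \<in> scalar_forms (k + 15 - 18)"
    "\<And>z. z \<in> ball2 \<Longrightarrow> det4 (E 0 z) (E 1 z) (F z) (E 3 z) = discr \<phi> z * n2 z"
    using division[OF coeffs(3)] zero[OF _ _ forms(1,2) F forms(4)] by blast
  obtain n3 where n3: "n3 \<in> scalar_forms (k + 15 - 18)"
    "\<And>z. z \<in> ball2 \<Longrightarrow> det4 (E 0 z) (E 1 z) (E 2 z) (F z) = discr \<phi> z * n3 z"
    using division[OF coeffs(4)] zero[OF _ _ forms(1-3) F] by blast
  have "\<exists>c. \<forall>z\<in>ball2. R z = c"
    by (rule weight_0_const[OF gen phi]) (use R(1) in simp_all)
  then obtain c where c: "\<And>z. z \<in> ball2 \<Longrightarrow> R z = c" by blast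
  have "c \<noteq> 0" using nz R(2)[OF nz(1)] c[OF nz(1)] by auto
  define a where "a = (\<lambda>(l::nat) b. 1 / c * (if l = 0 then n0 b else if l = 1 then n1 b else if l = 2 then n2 b else n3 b))"
  have "a l \<in> scalar_forms (k - 3)" if "l < 4" for l
    using that unfolding a_def
    by (cases rule: nat_less_4_cases) (use n0(1) n1(1) n2(1) n3(1) in \<open>simp_all add: scalar_forms_scale del: times_divide_eq_left\<close>)
  moreover have "F b m = (\<Sum>l<4. a l b * E l b m)" for b m
  proof (cases "b \<in> ball2 \<and> m \<le> 3")
    case True
    then have b: "b \<in> ball2" and m: "m \<le> 3" by auto
    define G where "G = (\<lambda>b. c * F b m - (n0 b * E 0 b m + n1 b * E 1 b m + n2 b * E 2 b m + n3 b * E 3 b m))"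
    have "G b = 0"
    proof (rule discr_cancel[OF phi mirrors _ _ b])
      show "holomorphic2_on G ball2"
        unfolding G_def
        by (intro holomorphic2_on_diff holomorphic2_on_add holomorphic2_on_mult holomorphic2_on_const
            scalar_formD(1)[OF n0(1)] scalar_formD(1)[OF n1(1)] scalar_formD(1)[OF n2(1)]
            scalar_formD(1)[OF n3(1)] modular_formD(1)[OF F m] forms[THEN modular_formD(1), OF m])
      fix z assume z: "z \<in> ball2"
      have "discr \<phi> z * c * F z m = discr \<phi> z * n0 z * E 0 z m + discr \<phi> z * n1 z * E 1 z m
          + discr \<phi> z * n2 z * E 2 z m + discr \<phi> z * n3 z * E 3 z m"
        using det4_cramer[OF m, of "E 0 z" "E 1 z" "E 2 z" "E 3 z" "F z"]
        unfolding R(2)[OF z] c[OF z] n0(2)[OF z] n1(2)[OF z] n2(2)[OF z] n3(2)[OF z] .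
      then show "discr \<phi> z * G z = 0" by (simp add: G_def algebra_simps)
    qed simp_all
    then show ?thesis using \<open>c \<noteq> 0\<close> by (simp add: G_def a_def sum_lessThan_4 field_simps)
  next
    case False
    have vanish: "V b m = 0" if "V \<in> modular_forms 3 w" for V w
      using False modular_forms_outside[OF that] modular_formD(2)[OF that] by (cases "b \<in> ball2") auto
    show ?thesis using vanish[OF F] vanish[OF E] by simp
  qed
  ultimately show ?thesis by blast
qed

section \<open>The graded module\<close>

lemma finsum_form_module:
  assumes "finite A" "\<And>x. x \<in> A \<Longrightarrow> f x \<in> carrier (form_module j)"
  shows "finsum (form_module j) f A = sum f A"
proof -
  interpret M: Module.module form_ring "form_module j" by (rule module_form_module)
  show ?thesis
    using assms
  proof (induction A)
    case empty
    have "finsum (form_module j) f {} = \<zero>\<^bsub>form_module j\<^esub>" by (rule M.finsum_empty)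
    then show ?case by (simp add: form_module_def)
  next
    case (insert x A)
    have "finsum (form_module j) f (insert x A) = f x \<oplus>\<^bsub>form_module j\<^esub> finsum (form_module j) f A"
      using insert by (intro M.finsum_insert) auto
    then show ?case using insert by (simp add: form_module_def)
  qed
qed

lemma lookup_sum_poly_mapping:
  "Poly_Mapping.lookup (sum f A) n = (\<Sum>x\<in>A. Poly_Mapping.lookup (f x) n)"
  by (induction A rule: infinite_finite_induct) (simp_all add: lookup_add)

lemma lookup_smult_single:
  "Poly_Mapping.lookup (form_smult a (Poly_Mapping.single 3 e)) n b m
    = Poly_Mapping.lookup a (n - 3) b * e b m"
proof -
  have "Poly_Mapping.lookup (form_smult a (Poly_Mapping.single 3 e)) n b m =
      (\<Sum>k\<in>Poly_Mapping.keys a. if k = n - 3 then Poly_Mapping.lookup a (n - 3) b * e b m else 0)"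
    unfolding lookup_form_smult
    by (intro sum.cong refl) (auto simp: lookup_single when_def)
  also have "\<dots> = Poly_Mapping.lookup a (n - 3) b * e b m"
    by (simp add: in_keys_iff)
  finally show ?thesis .
qed

text \<open>An equation in the graded module holds if and only if it holds in every weight.\<close>

lemma free_generators_of_weight_3:
  fixes E :: "nat \<Rightarrow> complex \<times> complex \<Rightarrow> nat \<Rightarrow> complex"
  assumes E: "\<And>i. i < n \<Longrightarrow> E i \<in> modular_forms j 3"
    and generate: "\<And>F k. F \<in> modular_forms j k \<Longrightarrow>
      \<exists>a. (\<forall>l<n. a l \<in> scalar_forms (k - 3)) \<and> (\<forall>b m. F b m = (\<Sum>l<n. a l b * E l b m))"
    and independent: "\<And>a k l. (\<And>l. l < n \<Longrightarrow> a l \<in> scalar_forms k) \<Longrightarrow>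
      (\<And>b m. (\<Sum>l<n. a l b * E l b m) = 0) \<Longrightarrow> l < n \<Longrightarrow> a l = (\<lambda>_. 0)"
  shows "freely_generated_by form_ring (form_module j) n (\<lambda>i. Poly_Mapping.single 3 (E i))"
proof -
  let ?e = "\<lambda>i. Poly_Mapping.single 3 (E i)"
  let ?T = "\<lambda>a. \<Oplus>\<^bsub>form_module j\<^esub>i\<in>{..<n}. a i \<odot>\<^bsub>form_module j\<^esub> ?e i"
  interpret M: Module.module form_ring "form_module j" by (rule module_form_module)
  have e: "?e i \<in> carrier (form_module j)" if "i < n" for i
    using E[OF that] modular_forms_zero by (auto simp: form_module_def lookup_single when_def)
  have T: "Poly_Mapping.lookup (?T a) k b m = (\<Sum>l<n. Poly_Mapping.lookup (a l) (k - 3) b * E l b m)"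
    if a: "a \<in> {..<n} \<rightarrow>\<^sub>E carrier form_ring" for a k b m
  proof -
    have "?T a = (\<Sum>i<n. a i \<odot>\<^bsub>form_module j\<^esub> ?e i)"
      using a e by (intro finsum_form_module) auto
    also have "\<dots> = (\<Sum>i<n. form_smult (a i) (?e i))" by (simp add: form_module_def)
    finally show ?thesis by (simp add: lookup_sum_poly_mapping sum_fun_apply lookup_smult_single)
  qed
  have forms: "Poly_Mapping.lookup (a l) k \<in> scalar_forms k"
    if "a \<in> {..<n} \<rightarrow>\<^sub>E carrier form_ring" "l < n" for a l k
    using that by (auto simp: form_ring_def)
  have "inj_on ?T ({..<n} \<rightarrow>\<^sub>E carrier form_ring)"
  proof (rule inj_onI)
    fix a a' assume a: "a \<in> {..<n} \<rightarrow>\<^sub>E carrier form_ring" and a': "a' \<in> {..<n} \<rightarrow>\<^sub>E carrier form_ring"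
      and eq: "?T a = ?T a'"
    show "a = a'"
    proof (rule PiE_ext[OF a a'])
      fix l assume l: "l \<in> {..<n}"
      show "a l = a' l"
      proof (rule poly_mapping_eqI)
        fix k
        have "(\<Sum>l<n. (Poly_Mapping.lookup (a l) k b - Poly_Mapping.lookup (a' l) k b) * E l b m) = 0" for b m
          using T[OF a, of "k + 3" b m] T[OF a', of "k + 3" b m] eq
          by (simp add: left_diff_distrib sum_subtractf)
        then have "(\<lambda>b. Poly_Mapping.lookup (a l) k b - Poly_Mapping.lookup (a' l) k b) = (\<lambda>_. 0)"
          using l by (intro independent[of "\<lambda>l b. Poly_Mapping.lookup (a l) k b - Poly_Mapping.lookup (a' l) k b" k]
              scalar_forms_diff forms[OF a] forms[OF a']) auto
        then show "Poly_Mapping.lookup (a l) k = Poly_Mapping.lookup (a' l) k"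
          by (simp add: fun_eq_iff)
      qed
    qed
  qed
  moreover have "?T ` ({..<n} \<rightarrow>\<^sub>E carrier form_ring) = carrier (form_module j)"
  proof (intro equalityI subsetI)
    fix F assume "F \<in> ?T ` ({..<n} \<rightarrow>\<^sub>E carrier form_ring)"
    then show "F \<in> carrier (form_module j)"
      using e by (auto intro!: M.finsum_closed M.smult_closed)
  next
    fix F assume F: "F \<in> carrier (form_module j)"
    have "\<forall>k. \<exists>a. (\<forall>l<n. a l \<in> scalar_forms (k - 3)) \<and> (Poly_Mapping.lookup F k = 0 \<longrightarrow> (\<forall>l. a l = 0))
        \<and> (\<forall>b m. Poly_Mapping.lookup F k b m = (\<Sum>l<n. a l b * E l b m))"
    proof
      fix k
      show "\<exists>a. (\<forall>l<n. a l \<in> scalar_forms (k - 3)) \<and> (Poly_Mapping.lookup F k = 0 \<longrightarrow> (\<forall>l. a l = 0))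
        \<and> (\<forall>b m. Poly_Mapping.lookup F k b m = (\<Sum>l<n. a l b * E l b m))"
      proof (cases "Poly_Mapping.lookup F k = 0")
        case True
        then show ?thesis
          using scalar_forms_0 by (intro exI[of _ "\<lambda>_. 0"]) (simp add: zero_fun_def)
      next
        case False
        have "Poly_Mapping.lookup F k \<in> modular_forms j k" using F by (simp add: form_module_def)
        from generate[OF this] False show ?thesis by blast
      qed
    qed
    from choice[OF this] obtain a where "\<forall>k. (\<forall>l<n. a k l \<in> scalar_forms (k - 3))
        \<and> (Poly_Mapping.lookup F k = 0 \<longrightarrow> (\<forall>l. a k l = 0))
        \<and> (\<forall>b m. Poly_Mapping.lookup F k b m = (\<Sum>l<n. a k l b * E l b m))" ..
    then have a: "\<And>k l. l < n \<Longrightarrow> a k l \<in> scalar_forms (k - 3)"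
      "\<And>k l. Poly_Mapping.lookup F k = 0 \<Longrightarrow> a k l = 0"
      "\<And>k b m. Poly_Mapping.lookup F k b m = (\<Sum>l<n. a k l b * E l b m)"
      by blast+
    define c where "c = (\<lambda>l\<in>{..<n}. Abs_poly_mapping (\<lambda>k. a (k + 3) l))"
    have lookup: "Poly_Mapping.lookup (Abs_poly_mapping (\<lambda>k. a (k + 3) l)) k = a (k + 3) l" for l k
    proof -
      have "{k. a (k + 3) l \<noteq> 0} \<subseteq> (\<lambda>k. k - 3) ` Poly_Mapping.keys F"
      proof
        fix k assume "k \<in> {k. a (k + 3) l \<noteq> 0}"
        then have "k + 3 \<in> Poly_Mapping.keys F" using a(2)[of "k + 3" l] by (auto simp: in_keys_iff)
        then show "k \<in> (\<lambda>k. k - 3) ` Poly_Mapping.keys F" by (intro image_eqI[of _ _ "k + 3"]) auto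
      qed
      then have "finite {k. a (k + 3) l \<noteq> 0}" by (rule finite_subset) simp
      then show ?thesis by simp
    qed
    have "a (k + 3) l \<in> scalar_forms k" if "l < n" for k l
      using a(1)[OF that, of "k + 3"] by simp
    then have c: "c \<in> {..<n} \<rightarrow>\<^sub>E carrier form_ring"
      by (auto simp: c_def form_ring_def lookup)
    have "?T c = F"
    proof (intro poly_mapping_eqI ext)
      fix k b m
      have "(\<Sum>l<n. Poly_Mapping.lookup (c l) (k - 3) b * E l b m) = (\<Sum>l<n. a k l b * E l b m)"
        by (intro sum.cong) (simp_all add: c_def lookup)
      then show "Poly_Mapping.lookup (?T c) k b m = Poly_Mapping.lookup F k b m"
        unfolding T[OF c] a(3) .
    qed
    then show "F \<in> ?T ` ({..<n} \<rightarrow>\<^sub>E carrier form_ring)" using c by blast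
  qed
  ultimately show ?thesis
    unfolding freely_generated_by_def bij_betw_def using module_form_module e by blast
qed

theorem proposition15p2:
  fixes eps :: complex
    and \<phi> :: "nat \<Rightarrow> complex \<times> complex \<Rightarrow> complex"
    and E :: "nat \<Rightarrow> complex \<times> complex \<Rightarrow> nat \<Rightarrow> complex"
  assumes "eps = 1 \<or> eps = - 1"
    and "\<forall>i<3. \<phi> i \<in> scalar_forms 3"
    and "polynomial_generators \<phi>"
    and "\<forall>i<3. FJ_constant_term_one (\<phi> i)"
    and "\<forall>g\<in>Gam1. \<forall>\<sigma>. \<sigma> permutes {1..4} \<and> induces eps g \<sigma> \<longrightarrow>
           (\<forall>i\<in>{1..4}. slash 0 3 (matrix_inv g) (scal (x_form \<phi> i)) =
              scal (\<lambda>b. of_int (sign \<sigma>) * x_form \<phi> (\<sigma> i) b))"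
    and "\<forall>i<4. is_eisenstein \<phi> i (E i)"
  shows "freely_generated_by form_ring (form_module 3) 4 (\<lambda>i. Poly_Mapping.single 3 (E i))"
proof -
  have phi: "\<And>i. i < 3 \<Longrightarrow> \<phi> i \<in> scalar_forms 3" using assms(2) by blast
  have FJ: "\<And>i. i < 3 \<Longrightarrow> FJ_constant_term_one (\<phi> i)" using assms(4) by blast
  have eis: "\<And>i. i < 4 \<Longrightarrow> is_eisenstein \<phi> i (E i)" using assms(6) by blast
  have equiv: "sgn_equivariant eps \<phi>" unfolding sgn_equivariant_def by (rule assms(5))
  have mirrors: "\<exists>r p q. mirror_of \<phi> a b r p q" if "a \<in> {1..4}" "b \<in> {1..4}" "a \<noteq> b" for a b
    by (rule mirror_of_exists[OF assms(1) equiv FJ that])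
  have cancel: "G z = 0"
    if "holomorphic2_on G ball2" "\<And>z. z \<in> ball2 \<Longrightarrow> discr \<phi> z * G z = 0" "z \<in> ball2" for G z
    by (rule discr_cancel[OF phi mirrors that])
  have E: "E i \<in> modular_forms 3 3" if i: "i < 4" for i
    by (rule eisenstein_modular_form[OF phi _ eis[OF i] i]; (assumption | blast intro: cancel))
  have d: "(\<lambda>b. det4 (E 0 b) (E 1 b) (E 2 b) (E 3 b)) \<in> scalar_forms 18"
    by (rule det4_eisenstein_scalar_form(1)[OF phi _ eis]; (assumption | blast intro: cancel))
  obtain b0 where b0: "b0 \<in> ball2" "discr \<phi> b0 * jac (\<phi> 0) (\<phi> 1) (\<phi> 2) b0 \<noteq> 0"
  proof -
    have "holomorphic2_on (jac (\<phi> 0) (\<phi> 1) (\<phi> 2)) ball2"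
      by (intro holomorphic2_on_jac scalar_formD(1)[OF phi]) simp_all
    moreover have "\<exists>b\<in>ball2. jac (\<phi> 0) (\<phi> 1) (\<phi> 2) b \<noteq> 0"
      by (rule jac_phi_nonzero[OF assms(1) equiv FJ phi])
    ultimately show ?thesis using cancel that by blast
  qed
  have nz: "det4 (E 0 b0) (E 1 b0) (E 2 b0) (E 3 b0) \<noteq> 0"
    by (rule det4_eisenstein_scalar_form(2)[OF phi _ eis b0(1)];
        (assumption | use b0(2) in force | blast intro: cancel))
  show ?thesis
  proof (rule free_generators_of_weight_3)
    show "\<exists>a. (\<forall>l<4. a l \<in> scalar_forms (k - 3)) \<and> (\<forall>b m. F b m = (\<Sum>l<4. a l b * E l b m))"
      if "F \<in> modular_forms 3 k" for F k
      by (rule eisenstein_generate[OF assms(3) phi mirrors E d b0(1) nz that])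
    show "a l = (\<lambda>_. 0)" if "\<And>l. l < 4 \<Longrightarrow> a l \<in> scalar_forms k"
      "\<And>b m. (\<Sum>l<4. a l b * E l b m) = 0" "l < 4" for a k l
      by (rule eisenstein_independent[OF E b0(1) nz that])
  qed (rule E)
qed

end
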